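(* Let $M$ be a complete simply connected surface of constant curvature, let $\Omega\subset M$ be a domain bounded by finitely many totally geodesic walls, and suppose there is an open set of $k$-periodic billiard orbits in $\Omega$, all with the same itinerary $a_1,\dots,a_k$; let $g=H_{a_1}\cdots H_{a_k}$, where $H_a$ is the reflection of $M$ in the wall $a$. (i) The case $M=\mathbb{H}^2$ is impossible: a hyperbolic isometry translates only its axis, and elliptic, parabolic and identity isometries translate no geodesic by a positive length. So a geodesic-walled billiard in the hyperbolic plane is never $k$-reflective, for any $k$. (ii) The case $M=\mathbb{E}^2$ is impossible: a translation by $v\neq0$ translates exactly the geodesics parallel to $v$, a one-parameter family; a glide reflection translates only its axis; rotations and reflections translate none. So a flat-mirror (metric) billiard in the Euclidean plane is never $k$-reflective. (iii) The case $M=S^2$ is possible, and only in one way: the isometries translating every great circle along itself are exactly $\pm I$, with translation lengths $\pi$ (for $-I$) and $2\pi$ (for $I$); every other isometry translates at most one great circle. So $g=\pm I$, and every orbit of the family has length congruent to $\pi$ or to $0$ modulo $2\pi$.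
   Context: $\mathbb{H}^2$, $\mathbb{E}^2$ and $S^2$ denote the hyperbolic plane, the Euclidean plane and the unit round sphere in $\mathbb{R}^3$ (with isometry group $\mathrm{O}(3)$). The billiard is the ordinary metric billiard: a trajectory follows geodesics in $\overline\Omega$ and at a point of a wall $a$ its velocity is transformed by (the differential of) the isometric reflection $H_a\in\mathrm{Isom}(M)$ fixing the wall pointwise. The itinerary is the sequence of walls hit. A $k$-periodic orbit is one that returns after $k$ bounces to its initial point with its initial velocity; "open set of orbits" means open in the two-dimensional space of orbits (equivalently, an open set of pairs of first two impact points), and "$k$-reflective" means that such a nonempty open set of $k$-periodic orbits exists. An isometry $g$ translates a geodesic $\sigma$ (parametrised by arc length) along itself by the length $\ell$ if $g\sigma(t)=\sigma(t+\ell)$ for all $t$. *)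

theory Defs
  imports "HOL-Analysis.Analysis" "HOL-Library.Real_Mod"
begin

text \<open>
  The three model surfaces are subsets of a Euclidean space with their intrinsic distance: the
  plane, the unit sphere with \<open>cos (d x y) = x \<bullet> y\<close>, and the upper sheet of the hyperboloid
  \<open>\<langle>x, x\<rangle> = - 1\<close> with \<open>cosh (d x y) = - \<langle>x, y\<rangle>\<close>, where \<open>\<langle>_, _\<rangle>\<close> is the Lorentz form.
  The absolute values below matter only off the surface, since \<^locale>\<open>Metric_space\<close> wants the
  distance to be nonnegative on the whole type.
\<close>

definition lorentz :: "real^3 \<Rightarrow> real^3 \<Rightarrow> real" where
  "lorentz x y = x $ 1 * y $ 1 + x $ 2 * y $ 2 - x $ 3 * y $ 3"

definition hyperboloid :: "(real^3) set" where
  "hyperboloid = {x. lorentz x x = - 1 \<and> x $ 3 > 0}"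

definition E2 :: "(real^2) metric" where
  "E2 = euclidean_metric"

definition S2 :: "(real^3) metric" where
  "S2 = metric (sphere 0 1, \<lambda>x y. \<bar>arccos (x \<bullet> y)\<bar>)"

definition H2 :: "(real^3) metric" where
  "H2 = metric (hyperboloid, \<lambda>x y. \<bar>arcosh (- lorentz x y)\<bar>)"

lemma mspace_E2 [simp]: "mspace E2 = UNIV"
  and mdist_E2 [simp]: "mdist E2 = dist"
  by (simp_all add: E2_def)

lemma gram_sphere:
  fixes x y z :: "real^3"
  shows "\<exists>D. (x \<bullet> x) * (y \<bullet> y) * (z \<bullet> z) + 2 * (x \<bullet> y) * (y \<bullet> z) * (x \<bullet> z)
           - (x \<bullet> x) * (y \<bullet> z)\<^sup>2 - (y \<bullet> y) * (x \<bullet> z)\<^sup>2 - (z \<bullet> z) * (x \<bullet> y)\<^sup>2 = D\<^sup>2"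
  by (rule exI[of _ "x$1 * (y$2 * z$3 - y$3 * z$2) - x$2 * (y$1 * z$3 - y$3 * z$1)
        + x$3 * (y$1 * z$2 - y$2 * z$1)"])
     (simp add: inner_vec_def sum_3, algebra)

lemma gram_lorentz:
  "\<exists>D. lorentz x x * lorentz y y * lorentz z z + 2 * lorentz x y * lorentz y z * lorentz x z
      - lorentz x x * (lorentz y z)\<^sup>2 - lorentz y y * (lorentz x z)\<^sup>2 - lorentz z z * (lorentz x y)\<^sup>2
      = - (D\<^sup>2)"
  by (rule exI[of _ "x$1 * (y$2 * z$3 - y$3 * z$2) - x$2 * (y$1 * z$3 - y$3 * z$1)
        + x$3 * (y$1 * z$2 - y$2 * z$1)"])
     (simp add: lorentz_def, algebra)

lemma lorentz_le:
  assumes "x \<in> hyperboloid" "y \<in> hyperboloid"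
  shows "lorentz x y \<le> - 1" "lorentz x y = - 1 \<longleftrightarrow> x = y"
proof -
  define a b where "a = lorentz x y" and "b = x $ 3 * y $ 3"
  have xx: "(x$1)\<^sup>2 + (x$2)\<^sup>2 = (x$3)\<^sup>2 - 1" and yy: "(y$1)\<^sup>2 + (y$2)\<^sup>2 = (y$3)\<^sup>2 - 1"
    and pos: "x $ 3 > 0" "y $ 3 > 0"
    using assms by (auto simp: hyperboloid_def lorentz_def power2_eq_square)
  have bpos: "b > 0" using pos by (simp add: b_def)
  have cs: "((x$1)\<^sup>2 + (x$2)\<^sup>2) * ((y$1)\<^sup>2 + (y$2)\<^sup>2)
      = (a + b)\<^sup>2 + (x$1 * y$2 - x$2 * y$1)\<^sup>2"
    unfolding a_def b_def lorentz_def by algebra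
  have id: "((x$3)\<^sup>2 - 1) * ((y$3)\<^sup>2 - 1) = (b - 1)\<^sup>2 - (x$3 - y$3)\<^sup>2"
    unfolding b_def by algebra
  have main: "(a + b)\<^sup>2 + (x$1 * y$2 - x$2 * y$1)\<^sup>2 + (x$3 - y$3)\<^sup>2 = (b - 1)\<^sup>2"
    using cs id xx yy by simp
  have "1 \<le> (x$3)\<^sup>2" "1 \<le> (y$3)\<^sup>2"
    using xx yy by (smt (verit) zero_le_power2)+
  then have "1 \<le> b\<^sup>2"
    unfolding b_def power_mult_distrib using mult_mono[of 1 "(x$3)\<^sup>2" 1 "(y$3)\<^sup>2"] by simp
  then have b1: "1 \<le> b"
    using bpos by (simp add: power2_nonneg_ge_1_iff)
  have "(a + b)\<^sup>2 \<le> (b - 1)\<^sup>2" using main by (smt (verit) zero_le_power2)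
  then have "a + b \<le> b - 1" using b1 by (simp add: power2_le_iff_abs_le)
  then show "lorentz x y \<le> - 1" by (simp add: a_def)
  show "lorentz x y = - 1 \<longleftrightarrow> x = y"
  proof
    assume "x = y"
    then show "lorentz x y = - 1" using assms by (simp add: hyperboloid_def)
  next
    assume "lorentz x y = - 1"
    then have a: "a = - 1" by (simp add: a_def)
    then have "(a + b)\<^sup>2 = (b - 1)\<^sup>2" by simp
    then have "(x$3 - y$3)\<^sup>2 = 0" using main
      by (smt (verit) zero_le_power2)
    then have 3: "x$3 = y$3" by simp
    have "(x$1 - y$1)\<^sup>2 + (x$2 - y$2)\<^sup>2
        = ((x$1)\<^sup>2 + (x$2)\<^sup>2) + ((y$1)\<^sup>2 + (y$2)\<^sup>2) - 2 * (a + b)"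
      unfolding a_def b_def lorentz_def by algebra
    also have "\<dots> = 0" using xx yy a 3 by (simp add: b_def power2_eq_square)
    finally have "x$1 = y$1 \<and> x$2 = y$2" by (simp add: sum_power2_eq_zero_iff)
    with 3 show "x = y" by (simp add: vec_eq_iff forall_3)
  qed
qed

lemma Metric_space_S2: "Metric_space (sphere (0::real^3) 1) (\<lambda>x y. \<bar>arccos (x \<bullet> y)\<bar>)"
proof
  have cs: "- 1 \<le> u \<bullet> w" "u \<bullet> w \<le> 1"
    if "u \<in> sphere 0 1" "w \<in> sphere 0 1" for u w :: "real^3"
    using Cauchy_Schwarz_ineq2[of u w] that by auto
  fix x y z :: "real^3"
  show "0 \<le> \<bar>arccos (x \<bullet> y)\<bar>" by simp
  show "\<bar>arccos (x \<bullet> y)\<bar> = \<bar>arccos (y \<bullet> x)\<bar>" by (simp add: inner_commute)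
  assume x: "x \<in> sphere 0 1" and y: "y \<in> sphere 0 1"
  show "\<bar>arccos (x \<bullet> y)\<bar> = 0 \<longleftrightarrow> x = y"
  proof
    assume "\<bar>arccos (x \<bullet> y)\<bar> = 0"
    then have "x \<bullet> y = cos 0"
      using cos_arccos[OF cs[OF x y]] by simp
    then have "(norm (x - y))\<^sup>2 = 0"
      using x y by (simp add: power2_norm_eq_inner inner_diff inner_commute norm_eq_1)
    then show "x = y" by simp
  next
    assume "x = y"
    then show "\<bar>arccos (x \<bullet> y)\<bar> = 0" using x by (simp add: norm_eq_1)
  qed
  assume z: "z \<in> sphere 0 1"
  define a b c where "a = x \<bullet> y" and "b = y \<bullet> z" and "c = x \<bullet> z"
  define \<alpha> \<beta> where "\<alpha> = arccos a" and "\<beta> = arccos b"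
  have bds: "- 1 \<le> a" "a \<le> 1" "- 1 \<le> b" "b \<le> 1" "- 1 \<le> c" "c \<le> 1"
    using cs x y z by (auto simp: a_def b_def c_def)
  have \<alpha>: "0 \<le> \<alpha>" "\<alpha> \<le> pi" "cos \<alpha> = a" and \<beta>: "0 \<le> \<beta>" "\<beta> \<le> pi" "cos \<beta> = b"
    using bds by (auto simp: \<alpha>_def \<beta>_def arccos_lbound arccos_ubound)
  obtain D where "1 + 2 * a * b * c - b\<^sup>2 - c\<^sup>2 - a\<^sup>2 = D\<^sup>2"
    using gram_sphere[of x y z] x y z by (auto simp: norm_eq_1 a_def b_def c_def)
  then have "(c - a * b)\<^sup>2 + D\<^sup>2 = (1 - a\<^sup>2) * (1 - b\<^sup>2)" by algebra
  also have "\<dots> = (sin \<alpha> * sin \<beta>)\<^sup>2"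
    by (simp add: \<alpha>(3)[symmetric] \<beta>(3)[symmetric] power_mult_distrib sin_squared_eq)
  finally have "(c - a * b)\<^sup>2 \<le> (sin \<alpha> * sin \<beta>)\<^sup>2" by (smt (verit) zero_le_power2)
  moreover have "0 \<le> sin \<alpha> * sin \<beta>" using \<alpha> \<beta> by (simp add: sin_ge_zero)
  ultimately have "\<bar>c - a * b\<bar> \<le> sin \<alpha> * sin \<beta>"
    by (simp add: power2_le_iff_abs_le)
  then have c: "cos (\<alpha> + \<beta>) \<le> c" by (simp add: cos_add \<alpha> \<beta>)
  have "arccos c \<le> \<alpha> + \<beta>"
  proof (cases "\<alpha> + \<beta> \<le> pi")
    case True
    then have "arccos (cos (\<alpha> + \<beta>)) = \<alpha> + \<beta>" using \<alpha> \<beta> by (intro arccos_cos) auto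
    then show ?thesis using arccos_le_mono[of c "cos (\<alpha> + \<beta>)"] c bds by auto
  next
    case False
    then show ?thesis using arccos_ubound[of c] bds by linarith
  qed
  moreover have "0 \<le> arccos c" using bds by (intro arccos_lbound)
  ultimately show "\<bar>arccos (x \<bullet> z)\<bar> \<le> \<bar>arccos (x \<bullet> y)\<bar> + \<bar>arccos (y \<bullet> z)\<bar>"
    by (simp add: \<alpha>_def \<beta>_def a_def b_def c_def)
qed

lemma Metric_space_H2: "Metric_space hyperboloid (\<lambda>x y. \<bar>arcosh (- lorentz x y)\<bar>)"
proof
  fix x y z :: "real^3"
  show "0 \<le> \<bar>arcosh (- lorentz x y)\<bar>" by simp
  show "\<bar>arcosh (- lorentz x y)\<bar> = \<bar>arcosh (- lorentz y x)\<bar>"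
    by (simp add: lorentz_def mult.commute)
  assume x: "x \<in> hyperboloid" and y: "y \<in> hyperboloid"
  show "\<bar>arcosh (- lorentz x y)\<bar> = 0 \<longleftrightarrow> x = y"
  proof -
    have "arcosh (- lorentz x y) = 0 \<longleftrightarrow> - lorentz x y = 1"
      using lorentz_le(1)[OF x y] by (intro arcosh_eq_0_iff_real) linarith
    also have "\<dots> \<longleftrightarrow> lorentz x y = - 1" by linarith
    also have "\<dots> \<longleftrightarrow> x = y" by (rule lorentz_le(2)[OF x y])
    finally show ?thesis by simp
  qed
  assume z: "z \<in> hyperboloid"
  define a b c where "a = - lorentz x y" and "b = - lorentz y z" and "c = - lorentz x z"
  define \<alpha> \<beta> where "\<alpha> = arcosh a" and "\<beta> = arcosh b"
  have bds: "1 \<le> a" "1 \<le> b" "1 \<le> c"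
    using lorentz_le(1) x y z by (force simp: a_def b_def c_def)+
  have \<alpha>: "0 \<le> \<alpha>" "cosh \<alpha> = a" and \<beta>: "0 \<le> \<beta>" "cosh \<beta> = b"
    using bds by (auto simp: \<alpha>_def \<beta>_def)
  obtain D where "- 1 - 2 * a * b * c + b\<^sup>2 + c\<^sup>2 + a\<^sup>2 = - (D\<^sup>2)"
    using gram_lorentz[of x y z] x y z by (auto simp: hyperboloid_def a_def b_def c_def)
  then have "(c - a * b)\<^sup>2 + D\<^sup>2 = (a\<^sup>2 - 1) * (b\<^sup>2 - 1)" by algebra
  also have "\<dots> = (sinh \<alpha> * sinh \<beta>)\<^sup>2"
    by (simp add: \<alpha>(2)[symmetric] \<beta>(2)[symmetric] power_mult_distrib sinh_square_eq)
  finally have "(c - a * b)\<^sup>2 \<le> (sinh \<alpha> * sinh \<beta>)\<^sup>2" by (smt (verit) zero_le_power2)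
  moreover have "0 \<le> sinh \<alpha> * sinh \<beta>" using \<alpha> \<beta> by simp
  ultimately have "\<bar>c - a * b\<bar> \<le> sinh \<alpha> * sinh \<beta>"
    by (simp add: power2_le_iff_abs_le)
  then have "c \<le> cosh (\<alpha> + \<beta>)" by (simp add: cosh_add \<alpha> \<beta>)
  then have "arcosh c \<le> arcosh (cosh (\<alpha> + \<beta>))"
    using bds arcosh_less_iff_real[of "cosh (\<alpha> + \<beta>)" c] cosh_real_ge_1[of "\<alpha> + \<beta>"] by linarith
  also have "\<dots> = \<alpha> + \<beta>" using \<alpha> \<beta> by (simp add: arcosh_cosh_real)
  finally show "\<bar>arcosh (- lorentz x z)\<bar> \<le> \<bar>arcosh (- lorentz x y)\<bar> + \<bar>arcosh (- lorentz y z)\<bar>"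
    using \<alpha> \<beta> bds by (simp add: \<alpha>_def \<beta>_def a_def b_def c_def)
qed

lemma mspace_S2 [simp]: "mspace S2 = sphere 0 1"
  and mdist_S2: "mdist S2 x y = \<bar>arccos (x \<bullet> y)\<bar>"
  by (simp_all add: S2_def Metric_space.mspace_metric[OF Metric_space_S2]
        Metric_space.mdist_metric[OF Metric_space_S2])

lemma mspace_H2 [simp]: "mspace H2 = hyperboloid"
  and mdist_H2: "mdist H2 x y = \<bar>arcosh (- lorentz x y)\<bar>"
  by (simp_all add: H2_def Metric_space.mspace_metric[OF Metric_space_H2]
        Metric_space.mdist_metric[OF Metric_space_H2])


text \<open>A geodesic is a complete curve parametrised by arc length that locally realises distances.\<close>

definition geodesic :: "'a metric \<Rightarrow> (real \<Rightarrow> 'a) \<Rightarrow> bool" where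
  "geodesic M \<sigma> \<longleftrightarrow> range \<sigma> \<subseteq> mspace M \<and>
     (\<forall>t. \<exists>\<epsilon>>0. \<forall>s\<in>ball t \<epsilon>. \<forall>u\<in>ball t \<epsilon>. mdist M (\<sigma> s) (\<sigma> u) = \<bar>s - u\<bar>)"

text \<open>Isometries are total functions on the ambient space; only their values on \<open>mspace M\<close> count.\<close>

definition isometry :: "'a metric \<Rightarrow> ('a \<Rightarrow> 'a) \<Rightarrow> bool" where
  "isometry M g \<longleftrightarrow> bij_betw g (mspace M) (mspace M) \<and>
     (\<forall>x\<in>mspace M. \<forall>y\<in>mspace M. mdist M (g x) (g y) = mdist M x y)"

definition is_identity :: "'a metric \<Rightarrow> ('a \<Rightarrow> 'a) \<Rightarrow> bool" where
  "is_identity M g \<longleftrightarrow> (\<forall>x\<in>mspace M. g x = x)"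

definition translates :: "('a \<Rightarrow> 'a) \<Rightarrow> (real \<Rightarrow> 'a) \<Rightarrow> real \<Rightarrow> bool" where
  "translates g \<sigma> l \<longleftrightarrow> (\<forall>t. g (\<sigma> t) = \<sigma> (t + l))"

text \<open>
  The classification of isometries by their displacement function \<open>x \<mapsto> d x (g x)\<close>. It covers
  orientation-reversing isometries too: on the hyperbolic plane, glide reflections are hyperbolic
  and reflections are elliptic.
\<close>

definition min_displacement_set :: "'a metric \<Rightarrow> ('a \<Rightarrow> 'a) \<Rightarrow> 'a set" where
  "min_displacement_set M g =
     {x \<in> mspace M. \<forall>y\<in>mspace M. mdist M x (g x) \<le> mdist M y (g y)}"

definition elliptic :: "'a metric \<Rightarrow> ('a \<Rightarrow> 'a) \<Rightarrow> bool" where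
  "elliptic M g \<longleftrightarrow> isometry M g \<and> \<not> is_identity M g \<and> (\<exists>x\<in>mspace M. g x = x)"

definition parabolic :: "'a metric \<Rightarrow> ('a \<Rightarrow> 'a) \<Rightarrow> bool" where
  "parabolic M g \<longleftrightarrow> isometry M g \<and> min_displacement_set M g = {}"

definition hyperbolic :: "'a metric \<Rightarrow> ('a \<Rightarrow> 'a) \<Rightarrow> bool" where
  "hyperbolic M g \<longleftrightarrow> isometry M g \<and> (\<exists>x\<in>min_displacement_set M g. mdist M x (g x) > 0)"

text \<open>The axis of a hyperbolic isometry: the set where its displacement is minimal.\<close>

abbreviation axis_of :: "'a metric \<Rightarrow> ('a \<Rightarrow> 'a) \<Rightarrow> 'a set" where
  "axis_of \<equiv> min_displacement_set"


text \<open>Walls: segments, rays or whole lines of geodesics.\<close>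

definition wall :: "'a metric \<Rightarrow> 'a set \<Rightarrow> bool" where
  "wall M a \<longleftrightarrow> (\<exists>\<sigma> I. geodesic M \<sigma> \<and> is_interval I \<and> closed I \<and> interior I \<noteq> {} \<and> a = \<sigma> ` I)"

text \<open>The reflection in a wall: the non-identical isometry that fixes the wall pointwise.\<close>

definition wall_reflection :: "'a metric \<Rightarrow> 'a set \<Rightarrow> 'a \<Rightarrow> 'a" where
  "wall_reflection M a = (SOME h. isometry M h \<and> \<not> is_identity M h \<and> (\<forall>x\<in>a. h x = x))"

definition billiard_table :: "'a::real_normed_vector metric \<Rightarrow> 'a set \<Rightarrow> 'a set set \<Rightarrow> bool" where
  "billiard_table M \<Omega> W \<longleftrightarrow>
     \<Omega> \<noteq> {} \<and> openin (top_of_set (mspace M)) \<Omega> \<and> connected \<Omega> \<and>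
     finite W \<and> (\<forall>a\<in>W. wall M a) \<and> top_of_set (mspace M) frontier_of \<Omega> = \<Union>W"

text \<open>
  Points at which the reflection law is unambiguous: relative interior points of the wall \<open>a\<close>
  that lie on no other wall. Trajectories that run into a corner are not continued.
\<close>

definition regular_point :: "'a metric \<Rightarrow> 'a set set \<Rightarrow> 'a set \<Rightarrow> 'a \<Rightarrow> bool" where
  "regular_point M W a p \<longleftrightarrow> a \<in> W \<and> (\<forall>b\<in>W. p \<in> b \<longrightarrow> b = a) \<and>
     (\<exists>\<sigma> \<epsilon>. geodesic M \<sigma> \<and> \<epsilon> > 0 \<and> \<sigma> 0 = p \<and> \<sigma> ` {-\<epsilon><..<\<epsilon>} \<subseteq> a)"

text \<open>
  The two-dimensional space of orbits: pairs of an impact point and an outgoing unit velocity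
  that points into the domain. It carries the topology induced by the ambient space.
\<close>

definition orbit_space ::
    "'a::real_normed_vector metric \<Rightarrow> 'a set \<Rightarrow> 'a set set \<Rightarrow> ('a \<times> 'a) set" where
  "orbit_space M \<Omega> W = {(p, v). (\<exists>a. regular_point M W a p) \<and>
     (\<exists>\<sigma> \<epsilon>. geodesic M \<sigma> \<and> \<sigma> 0 = p \<and> (\<sigma> has_vector_derivative v) (at 0) \<and>
            \<epsilon> > 0 \<and> \<sigma> ` {0<..<\<epsilon>} \<subseteq> \<Omega>)}"

text \<open>
  One step of the billiard: from \<open>p\<close> with velocity \<open>v\<close> follow the geodesic \<open>\<sigma>\<close> inside the domain
  for a length \<open>l\<close> up to the first impact, on the wall \<open>a\<close>. The new velocity is the image of
  \<open>\<sigma>' l\<close> under the differential of the reflection, that is, the derivative at \<open>l\<close> of its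
  composition with \<open>\<sigma>\<close>.
\<close>

definition bounce ::
    "'a::real_normed_vector metric \<Rightarrow> 'a set \<Rightarrow> 'a set set \<Rightarrow> 'a \<times> 'a \<Rightarrow> 'a set \<Rightarrow> real \<Rightarrow> 'a \<times> 'a \<Rightarrow> bool"
  where
  "bounce M \<Omega> W x a l y \<longleftrightarrow>
     (\<exists>\<sigma>. geodesic M \<sigma> \<and> \<sigma> 0 = fst x \<and> (\<sigma> has_vector_derivative snd x) (at 0) \<and>
          l > 0 \<and> \<sigma> ` {0<..<l} \<subseteq> \<Omega> \<and> \<sigma> l = fst y \<and> regular_point M W a (fst y) \<and>
          ((wall_reflection M a \<circ> \<sigma>) has_vector_derivative snd y) (at l))"

text \<open>\<open>trajectory M \<Omega> W x as L y\<close>: a trajectory from \<open>x\<close> to \<open>y\<close> with itinerary \<open>as\<close> and length \<open>L\<close>.\<close>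

inductive trajectory ::
    "'a::real_normed_vector metric \<Rightarrow> 'a set \<Rightarrow> 'a set set \<Rightarrow> 'a \<times> 'a \<Rightarrow> 'a set list \<Rightarrow> real \<Rightarrow> 'a \<times> 'a \<Rightarrow> bool"
  for M \<Omega> W where
  Nil: "trajectory M \<Omega> W x [] 0 x"
| Cons: "bounce M \<Omega> W x a l y \<Longrightarrow> trajectory M \<Omega> W y as L z \<Longrightarrow> trajectory M \<Omega> W x (a # as) (l + L) z"

definition periodic_orbit ::
    "'a::real_normed_vector metric \<Rightarrow> 'a set \<Rightarrow> 'a set set \<Rightarrow> 'a set list \<Rightarrow> real \<Rightarrow> 'a \<times> 'a \<Rightarrow> bool" where
  "periodic_orbit M \<Omega> W as L x \<longleftrightarrow> x \<in> orbit_space M \<Omega> W \<and> trajectory M \<Omega> W x as L x"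

definition k_reflective ::
    "'a::real_normed_vector metric \<Rightarrow> 'a set \<Rightarrow> 'a set set \<Rightarrow> nat \<Rightarrow> bool" where
  "k_reflective M \<Omega> W k \<longleftrightarrow>
     (\<exists>U. U \<noteq> {} \<and> openin (top_of_set (orbit_space M \<Omega> W)) U \<and>
          (\<forall>x\<in>U. \<exists>as L. length as = k \<and> periodic_orbit M \<Omega> W as L x))"

definition periodic_family ::
    "'a::real_normed_vector metric \<Rightarrow> 'a set \<Rightarrow> 'a set set \<Rightarrow> 'a set list \<Rightarrow> ('a \<times> 'a) set \<Rightarrow> bool" where
  "periodic_family M \<Omega> W as U \<longleftrightarrow>
     U \<noteq> {} \<and> openin (top_of_set (orbit_space M \<Omega> W)) U \<and>
     (\<forall>x\<in>U. \<exists>L. periodic_orbit M \<Omega> W as L x)"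

definition reflection_product :: "'a metric \<Rightarrow> 'a set list \<Rightarrow> 'a \<Rightarrow> 'a" where
  "reflection_product M as = foldr (\<lambda>a h. wall_reflection M a \<circ> h) as id"


definition parallel_to :: "(real \<Rightarrow> real^2) \<Rightarrow> real^2 \<Rightarrow> bool" where
  "parallel_to \<sigma> v \<longleftrightarrow> (\<forall>s t. \<sigma> t - \<sigma> s \<in> span {v})"

definition rotation_about :: "real^2 \<Rightarrow> real \<Rightarrow> real^2 \<Rightarrow> real^2" where
  "rotation_about c \<theta> x = c + vector [cos \<theta> * (x - c) $ 1 - sin \<theta> * (x - c) $ 2,
                                      sin \<theta> * (x - c) $ 1 + cos \<theta> * (x - c) $ 2]"

end

theory Submission
  imports Defs
begin

text \<open>
  Unfold the billiard: the leg after an impact is the image, under the reflection in the wall, of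
  the straight continuation of the leg before it. Hence an orbit of length \<open>L\<close> that closes up after
  the itinerary \<open>a\<^sub>1, \<dots>, a\<^sub>k\<close> has the property that the product \<open>g\<close> of the reflections translates the
  geodesic of its first leg by \<open>L\<close> (\<open>trajectory_unfold\<close>, \<open>periodic_orbit_translates\<close>).

  The openness of a family of orbits matters only at one impact point \<open>p\<close>: the family contains a whole
  fan of orbits that start at \<open>p\<close> (\<open>open_family_contains_fan\<close>). So \<open>g\<close> would translate many geodesics
  through \<open>p\<close>, each of which also contains \<open>g p\<close>. In the Euclidean and in the hyperbolic plane two distinct
  points lie on only one geodesic, so each itinerary accounts for at most one direction at \<open>p\<close>. There are
  finitely many itineraries of length \<open>k\<close> but infinitely many directions in the fan, so no table is
  \<open>k\<close>-reflective (\<open>not_k_reflective\<close>); the itinerary may vary from orbit to orbit in this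
  argument. On the sphere the same reasoning forces \<open>g p = \<plusminus> p\<close>; two translated great circles through \<open>p\<close>
  span the space, so \<open>g\<close> is plus or minus the identity (\<open>translates_two_circles_through_point\<close>), and the
  hemisphere shows that this occurs.

  Everything above is proved once, for curves \<open>t \<mapsto> C t p + S t v\<close>, where \<open>C\<close> and \<open>S\<close> are the solutions of
  \<open>f'' = - \<kappa> f\<close> with the initial values of cosine and sine, so that the three surfaces differ only in \<open>\<kappa>\<close>.
  The locales below isolate what is used: geodesics are these curves, directions at a point
  form a circle, and each geodesic is the mirror of a reflection. The sphere and the hyperboloid satisfy this
  for the same reason, as the quadrics \<open>\<langle>x, x\<rangle> = \<kappa>\<close> of the forms \<open>x\<^sub>1 y\<^sub>1 + x\<^sub>2 y\<^sub>2 + \<kappa> x\<^sub>3 y\<^sub>3\<close>.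

  The classification of translated geodesics is linear algebra in a frame adapted to the geodesic.
  In the hyperbolic plane the displacement of a point grows with its distance from a translated geodesic
  (\<open>displacement_lower_bound\<close>), so a translated geodesic is the set of minimal displacement; conversely
  points of minimal positive displacement lie on a translated geodesic (\<open>hyperbolic_translates_geodesic\<close>).
\<close>

section \<open>Isometries, geodesics and walls of an arbitrary metric\<close>

lemma isometry_comp:
  assumes "isometry M g" "isometry M h"
  shows "isometry M (g \<circ> h)"
  using assms bij_betw_trans[of h "mspace M" "mspace M" g "mspace M"]
  unfolding isometry_def by (auto simp: bij_betwE)

lemma isometry_id: "isometry M id"
  by (simp add: isometry_def)

lemma isometry_mem: "isometry M g \<Longrightarrow> x \<in> mspace M \<Longrightarrow> g x \<in> mspace M"
  by (auto simp: isometry_def bij_betwE)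

lemma isometry_mdist:
  "isometry M g \<Longrightarrow> x \<in> mspace M \<Longrightarrow> y \<in> mspace M \<Longrightarrow> mdist M (g x) (g y) = mdist M x y"
  by (auto simp: isometry_def)

lemma isometry_if_involution:
  assumes "\<And>x. x \<in> mspace M \<Longrightarrow> r x \<in> mspace M" "\<And>x. x \<in> mspace M \<Longrightarrow> r (r x) = x"
    and "\<And>x y. x \<in> mspace M \<Longrightarrow> y \<in> mspace M \<Longrightarrow> mdist M (r x) (r y) = mdist M x y"
  shows "isometry M r"
  unfolding isometry_def using assms by (auto intro!: bij_betw_byWitness[where f' = r])

lemma geodesic_mem: "geodesic M \<sigma> \<Longrightarrow> \<sigma> t \<in> mspace M"
  by (auto simp: geodesic_def)

lemma geodesic_isometry:
  assumes "isometry M g" "geodesic M \<sigma>"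
  shows "geodesic M (g \<circ> \<sigma>)"
  using assms isometry_mem[OF assms(1)] isometry_mdist[OF assms(1)]
  unfolding geodesic_def by (auto simp: image_subset_iff)

lemma geodesic_reparam:
  assumes "geodesic M \<sigma>" "\<bar>e\<bar> = 1"
  shows "geodesic M (\<lambda>t. \<sigma> (c + e * t))"
  unfolding geodesic_def
proof (intro conjI allI)
  show "range (\<lambda>t. \<sigma> (c + e * t)) \<subseteq> mspace M"
    using geodesic_mem[OF assms(1)] by auto
  fix t
  have e: "\<bar>(c + e * x) - (c + e * y)\<bar> = \<bar>x - y\<bar>" for x y
  proof -
    have "(c + e * x) - (c + e * y) = e * (x - y)" by algebra
    then show ?thesis by (simp add: abs_mult assms(2))
  qed
  obtain \<epsilon> where "\<epsilon> > 0" and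
    \<epsilon>: "\<forall>s\<in>ball (c + e * t) \<epsilon>. \<forall>u\<in>ball (c + e * t) \<epsilon>. mdist M (\<sigma> s) (\<sigma> u) = \<bar>s - u\<bar>"
    using assms(1) unfolding geodesic_def by blast
  have "mdist M (\<sigma> (c + e * s)) (\<sigma> (c + e * u)) = \<bar>s - u\<bar>"
    if "s \<in> ball t \<epsilon>" "u \<in> ball t \<epsilon>" for s u
    using \<epsilon>[rule_format, of "c + e * s" "c + e * u"] that e
    unfolding mem_ball dist_real_def by metis
  with \<open>\<epsilon> > 0\<close> show "\<exists>\<epsilon>>0. \<forall>s\<in>ball t \<epsilon>. \<forall>u\<in>ball t \<epsilon>.
      mdist M (\<sigma> (c + e * s)) (\<sigma> (c + e * u)) = \<bar>s - u\<bar>" by blast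
qed

lemma wall_range: "geodesic M \<tau> \<Longrightarrow> wall M (range \<tau>)"
  unfolding wall_def by (rule exI[of _ \<tau>], rule exI[of _ UNIV]) auto

lemma wall_obtain_two_points:
  assumes "wall M a"
  obtains \<tau> s u where "geodesic M \<tau>" "a \<subseteq> range \<tau>" "\<tau> s \<in> a" "\<tau> u \<in> a" "s \<noteq> u" "\<bar>s - u\<bar> < 2"
proof -
  obtain \<tau> I where \<tau>: "geodesic M \<tau>" "interior I \<noteq> {}" "a = \<tau> ` I"
    using assms by (auto simp: wall_def)
  then obtain x d where d: "d > 0" "ball x d \<subseteq> I"
    by (meson ex_in_conv mem_interior)
  define u where "u = x + min (d/2) 1"
  have "x \<in> ball x d" "u \<in> ball x d"
    using d(1) by (auto simp: dist_real_def u_def)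
  with d(2) have "x \<in> I" "u \<in> I" by blast+
  then show thesis
    using \<tau> d(1) by (intro that[of \<tau> x u]) (auto simp: u_def)
qed

lemma regular_point_mem:
  assumes "regular_point M W a p"
  shows "a \<in> W" "p \<in> a" 
  using assms unfolding regular_point_def
proof safe
  fix \<sigma> :: "real \<Rightarrow> 'a" and \<epsilon> :: real assume "\<epsilon> > 0" "\<sigma> ` {-\<epsilon><..<\<epsilon>} \<subseteq> a" 
  moreover have "\<sigma> 0 \<in> \<sigma> ` {-\<epsilon><..<\<epsilon>}" using \<open>\<epsilon> > 0\<close> by (intro imageI) auto
  ultimately show "\<sigma> 0 \<in> a" by blast
qed

section \<open>Planes of constant curvature\<close>

text \<open>
  The functions are cosine and sine for \<open>\<kappa> = 1\<close>, the constant \<open>1\<close> and the identity for \<open>\<kappa> = 0\<close>, and the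
  hyperbolic cosine and sine for \<open>\<kappa> = - 1\<close>. The bound \<open>2\<close> stands for any positive number below \<open>\<pi>\<close>.
\<close>

locale curvature_trig =
  fixes \<kappa> :: real and C S :: "real \<Rightarrow> real"
  assumes C_deriv: "(C has_real_derivative - \<kappa> * S t) (at t)"
    and S_deriv: "(S has_real_derivative C t) (at t)"
    and C_0: "C 0 = 1" and S_0: "S 0 = 0"
    and C_S: "C t * C t + \<kappa> * (S t * S t) = 1"
    and S_pos: "0 < t \<Longrightarrow> t < 2 \<Longrightarrow> S t > 0"

text \<open>
  \<open>T p\<close> is the circle of unit tangent vectors at \<open>p\<close>. The second assumption is local because geodesics are
  defined by a local condition on distances.
\<close>

locale geodesics_by_initial_data = curvature_trig \<kappa> C S
  for \<kappa> :: real and C S :: "real \<Rightarrow> real" +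
  fixes M :: "'a::real_normed_vector metric" and T :: "'a \<Rightarrow> 'a set"
  assumes geodesic_geo: "p \<in> mspace M \<Longrightarrow> v \<in> T p \<Longrightarrow> geodesic M (\<lambda>t. C t *\<^sub>R p + S t *\<^sub>R v)"
    and geodesic_local: "geodesic M \<sigma> \<Longrightarrow>
      \<exists>\<epsilon>>0. \<exists>v\<in>T (\<sigma> t). \<forall>s. \<bar>s\<bar> < \<epsilon> \<longrightarrow> \<sigma> (t + s) = C s *\<^sub>R \<sigma> t + S s *\<^sub>R v"
begin

definition geo :: "'a \<Rightarrow> 'a \<Rightarrow> real \<Rightarrow> 'a" where
  "geo p v = (\<lambda>t. C t *\<^sub>R p + S t *\<^sub>R v)"

lemma isCont_C [continuous_intros]: "isCont C t" and isCont_S [continuous_intros]: "isCont S t"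
  using C_deriv S_deriv DERIV_isCont by blast+

lemma continuous_on_C [continuous_intros]: "continuous_on X f \<Longrightarrow> continuous_on X (\<lambda>x. C (f x))"
  and continuous_on_S [continuous_intros]: "continuous_on X f \<Longrightarrow> continuous_on X (\<lambda>x. S (f x))"
  using continuous_on_compose2[of UNIV C X f] continuous_on_compose2[of UNIV S X f]
  by (simp_all add: continuous_at_imp_continuous_on isCont_C isCont_S)

lemma geo_0: "geo p v 0 = p"
  by (simp add: geo_def C_0 S_0)

lemma geo_deriv: "(geo p v has_vector_derivative (- \<kappa> * S t) *\<^sub>R p + C t *\<^sub>R v) (at t)"
  unfolding geo_def
  using has_vector_derivative_add[OF has_vector_derivative_scaleR[OF C_deriv[of t], of "\<lambda>_. p" 0]
      has_vector_derivative_scaleR[OF S_deriv[of t], of "\<lambda>_. v" 0]] by simp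

lemma geo_deriv_0: "(geo p v has_vector_derivative v) (at 0)"
  using geo_deriv[of p v 0] by (simp add: C_0 S_0)

text \<open>
  Locally every geodesic is a curve \<open>geo\<close>, so it solves the linear equation \<open>\<sigma>'' = - \<kappa> \<sigma>\<close>
  on the whole line. Multiplying the solution by the fundamental system \<open>C\<close>, \<open>S\<close> gives two constants
  of motion, which express \<open>\<sigma>\<close> by its initial data.
\<close>

lemma geodesic_obtain_geo:
  assumes "geodesic M \<sigma>"
  obtains v where "v \<in> T (\<sigma> 0)" "\<sigma> = geo (\<sigma> 0) v"
proof -
  obtain \<epsilon> D where \<epsilon>: "\<And>t. \<epsilon> t > 0" and D: "\<And>t. D t \<in> T (\<sigma> t)"
    and loc: "\<And>t s. \<bar>s\<bar> < \<epsilon> t \<Longrightarrow> \<sigma> (t + s) = C s *\<^sub>R \<sigma> t + S s *\<^sub>R D t"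
    using geodesic_local[OF assms] by metis
  have loc': "\<sigma> x = geo (\<sigma> t) (D t) (x - t)" if "\<bar>x - t\<bar> < \<epsilon> t" for x t
    using loc[OF that] by (simp add: geo_def)
  have nbhd: "(\<sigma> has_vector_derivative (- \<kappa> * S s) *\<^sub>R \<sigma> t + C s *\<^sub>R D t) (at (t + s))"
    if "\<bar>s\<bar> < \<epsilon> t" for s t
  proof -
    have "((\<lambda>x. geo (\<sigma> t) (D t) (x - t)) has_vector_derivative
        (- \<kappa> * S s) *\<^sub>R \<sigma> t + C s *\<^sub>R D t) (at (t + s))"
    proof -
      have "((\<lambda>x. x - t) has_vector_derivative 1) (at (t + s))"
        by (auto intro!: derivative_eq_intros)
      moreover have "(geo (\<sigma> t) (D t) has_vector_derivative (- \<kappa> * S s) *\<^sub>R \<sigma> t + C s *\<^sub>R D t)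
          (at ((t + s) - t))"
        using geo_deriv[of "\<sigma> t" "D t" s] by simp
      ultimately show ?thesis
        using vector_diff_chain_at[of "\<lambda>x. x - t" 1 "t + s" "geo (\<sigma> t) (D t)"] by (simp add: o_def)
    qed
    then show ?thesis
      by (rule has_vector_derivative_transform_within_open[where S = "ball t (\<epsilon> t)"])
        (use that loc' \<epsilon> in \<open>auto simp: dist_real_def abs_minus_commute\<close>)
  qed
  have \<sigma>': "(\<sigma> has_vector_derivative D t) (at t)" for t
    using nbhd[of 0 t] \<epsilon>[of t] by (simp add: C_0 S_0)
  have D_eq: "D x = (- \<kappa> * S (x - t)) *\<^sub>R \<sigma> t + C (x - t) *\<^sub>R D t" if "\<bar>x - t\<bar> < \<epsilon> t" for x t
    using vector_derivative_unique_at[OF \<sigma>'[of x]] nbhd[OF that] by simp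
  have D': "(D has_vector_derivative - \<kappa> *\<^sub>R \<sigma> t) (at t)" for t
  proof -
    have "((\<lambda>x. x - t) has_real_derivative 1) (at t)" by (auto intro!: derivative_eq_intros)
    then have "((\<lambda>x. S (x - t)) has_real_derivative 1) (at t)"
      "((\<lambda>x. C (x - t)) has_real_derivative 0) (at t)"
      using DERIV_chain2[of S "C 0" "\<lambda>x. x - t" t 1 UNIV] DERIV_chain2[of C "- \<kappa> * S 0" "\<lambda>x. x - t" t 1 UNIV]
        S_deriv[of 0] C_deriv[of 0] by (simp_all add: C_0 S_0)
    then have "((\<lambda>x. (- \<kappa> * S (x - t)) *\<^sub>R \<sigma> t + C (x - t) *\<^sub>R D t) has_vector_derivative - \<kappa> *\<^sub>R \<sigma> t) (at t)"
      by (auto intro!: derivative_eq_intros)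
    then show ?thesis
      by (rule has_vector_derivative_transform_within_open[where S = "ball t (\<epsilon> t)"])
        (use D_eq \<epsilon> in \<open>auto simp: dist_real_def abs_minus_commute\<close>)
  qed
  have F': "((\<lambda>t. C t *\<^sub>R \<sigma> t - S t *\<^sub>R D t) has_vector_derivative 0) (at t)" for t
    by (rule has_vector_derivative_eq_rhs)
      (rule has_vector_derivative_diff[OF has_vector_derivative_scaleR[OF C_deriv \<sigma>']
        has_vector_derivative_scaleR[OF S_deriv D']], simp add: algebra_simps)
  obtain c where "\<And>x. x \<in> UNIV \<Longrightarrow> C x *\<^sub>R \<sigma> x - S x *\<^sub>R D x = c"
    by (rule has_vector_derivative_zero_constant[OF convex_UNIV, of "\<lambda>t. C t *\<^sub>R \<sigma> t - S t *\<^sub>R D t"])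
      (use F' in simp_all)
  then have F: "C t *\<^sub>R \<sigma> t - S t *\<^sub>R D t = \<sigma> 0" for t
    by (metis C_0 S_0 UNIV_I diff_zero scaleR_one scaleR_zero_left)
  have G': "((\<lambda>t. \<kappa> *\<^sub>R (S t *\<^sub>R \<sigma> t) + C t *\<^sub>R D t) has_vector_derivative 0) (at t)" for t
    by (rule has_vector_derivative_eq_rhs)
      (rule has_vector_derivative_add[OF
        bounded_linear.has_vector_derivative[OF bounded_linear_scaleR_right
          has_vector_derivative_scaleR[OF S_deriv \<sigma>']]
        has_vector_derivative_scaleR[OF C_deriv D']], simp add: algebra_simps)
  obtain c where c: "\<And>x. x \<in> UNIV \<Longrightarrow> \<kappa> *\<^sub>R (S x *\<^sub>R \<sigma> x) + C x *\<^sub>R D x = c"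
    by (rule has_vector_derivative_zero_constant[OF convex_UNIV,
        of "\<lambda>t. \<kappa> *\<^sub>R (S t *\<^sub>R \<sigma> t) + C t *\<^sub>R D t"])
      (use G' in simp_all)
  have G: "\<kappa> *\<^sub>R (S t *\<^sub>R \<sigma> t) + C t *\<^sub>R D t = D 0" for t
    using c[of t] c[of 0] by (simp add: C_0 S_0)
  have "\<sigma> t = geo (\<sigma> 0) (D 0) t" for t
  proof -
    have "geo (\<sigma> 0) (D 0) t = C t *\<^sub>R (C t *\<^sub>R \<sigma> t - S t *\<^sub>R D t)
        + S t *\<^sub>R (\<kappa> *\<^sub>R (S t *\<^sub>R \<sigma> t) + C t *\<^sub>R D t)"
      unfolding geo_def F G ..
    also have "\<dots> = (C t * C t + \<kappa> * (S t * S t)) *\<^sub>R \<sigma> t"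
      by (simp add: algebra_simps)
    finally show ?thesis by (simp add: C_S)
  qed
  with D[of 0] that show thesis by blast
qed

lemma geodesic_iff_geo: "geodesic M \<sigma> \<longleftrightarrow> (\<exists>p\<in>mspace M. \<exists>v\<in>T p. \<sigma> = geo p v)"
proof
  assume \<sigma>: "geodesic M \<sigma>"
  then obtain v where "v \<in> T (\<sigma> 0)" "\<sigma> = geo (\<sigma> 0) v" by (rule geodesic_obtain_geo)
  with geodesic_mem[OF \<sigma>] show "\<exists>p\<in>mspace M. \<exists>v\<in>T p. \<sigma> = geo p v" by blast
next
  assume "\<exists>p\<in>mspace M. \<exists>v\<in>T p. \<sigma> = geo p v"
  then show "geodesic M \<sigma>" using geodesic_geo by (auto simp: geo_def)
qed

lemma geodesic_determined:
  assumes "geodesic M \<sigma>" "(\<sigma> has_vector_derivative v) (at 0)"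
  shows "\<sigma> = geo (\<sigma> 0) v" "v \<in> T (\<sigma> 0)"
proof -
  obtain w where w: "w \<in> T (\<sigma> 0)" "\<sigma> = geo (\<sigma> 0) w" using geodesic_obtain_geo[OF assms(1)] .
  have "(\<sigma> has_vector_derivative w) (at 0)" using geo_deriv_0 w(2) by metis
  then have "v = w" using vector_derivative_unique_at assms(2) by blast
  with w show "\<sigma> = geo (\<sigma> 0) v" "v \<in> T (\<sigma> 0)" by auto
qed

end

text \<open>
  The first assumption provides the circle of directions at \<open>p\<close> and says that each line lies in the zero set of a
  function that is linear in the coordinates: \<open>A\<close>, \<open>b\<close>, \<open>c\<close> are the values at \<open>p\<close>, \<open>v\<close>, \<open>w\<close> of a linear
  (for \<open>\<kappa> = 0\<close>, at \<open>p\<close>, affine) form given by a normal vector of the line. The second one provides the mirror image \<open>r y\<close> of a point as the only other point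
  with the same distances from two points of the line, and says that the points equidistant from a point off the
  line and its mirror image lie on the line.
\<close>

locale constant_curvature_plane = geodesics_by_initial_data +
  assumes tangent_circle: "p \<in> mspace M \<Longrightarrow> v \<in> T p \<Longrightarrow>
      \<exists>w. (\<forall>\<theta>. cos \<theta> *\<^sub>R v + sin \<theta> *\<^sub>R w \<in> T p) \<and>
          (\<forall>a b. a *\<^sub>R v + b *\<^sub>R w = 0 \<longrightarrow> a = 0 \<and> b = 0) \<and>
          (\<forall>\<tau>. geodesic M \<tau> \<longrightarrow>
             (\<exists>A b c. (A \<noteq> 0 \<or> b \<noteq> 0 \<or> c \<noteq> 0) \<and>
                (\<forall>\<theta> t. geo p (cos \<theta> *\<^sub>R v + sin \<theta> *\<^sub>R w) t \<in> range \<tau> \<longrightarrow>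
                   C t * A + S t * (cos \<theta> * b + sin \<theta> * c) = 0)))"
    and reflection: "geodesic M \<tau> \<Longrightarrow> \<exists>r. isometry M r \<and> \<not> is_identity M r \<and>
          (\<forall>x\<in>mspace M. r (r x) = x) \<and> (\<forall>t. r (\<tau> t) = \<tau> t) \<and>
          (\<forall>s u. s \<noteq> u \<longrightarrow> \<bar>s - u\<bar> < 2 \<longrightarrow> (\<forall>y\<in>mspace M. \<forall>z\<in>mspace M.
             mdist M z (\<tau> s) = mdist M y (\<tau> s) \<longrightarrow> mdist M z (\<tau> u) = mdist M y (\<tau> u) \<longrightarrow>
             z = y \<or> z = r y)) \<and>
          (\<forall>y\<in>mspace M. \<forall>z\<in>mspace M. mdist M y (r z) = mdist M y z \<longrightarrow> r y = y \<or> r z = z)"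
begin

subsection \<open>Reflections in walls\<close>

text \<open>
  An isometry that fixes two points of a wall moves every point either not at all or to its mirror
  image, because these are the only points with the right distances from the two fixed ones. If it
  moves a point \<open>z\<close> and fixes \<open>y\<close>, then \<open>y\<close> is equidistant from \<open>z\<close> and its mirror image, so \<open>y\<close>
  lies on the mirror. Hence a wall admits exactly one non-identical isometry that fixes it.
\<close>

lemma wall_reflection_exists:
  assumes "wall M a"
  obtains r where "isometry M r" "\<not> is_identity M r" "\<And>x. x \<in> mspace M \<Longrightarrow> r (r x) = x"
    "\<And>x. x \<in> a \<Longrightarrow> r x = x"
    "\<And>h x. isometry M h \<Longrightarrow> \<not> is_identity M h \<Longrightarrow> (\<And>x. x \<in> a \<Longrightarrow> h x = x) \<Longrightarrow> x \<in> mspace M \<Longrightarrow> h x = r x"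
proof -
  obtain \<tau> s u where \<tau>: "geodesic M \<tau>" "a \<subseteq> range \<tau>" "\<tau> s \<in> a" "\<tau> u \<in> a" "s \<noteq> u" "\<bar>s - u\<bar> < 2"
    using wall_obtain_two_points[OF assms] .
  obtain r where r: "isometry M r" "\<not> is_identity M r" "\<And>x. x \<in> mspace M \<Longrightarrow> r (r x) = x"
    "\<And>t. r (\<tau> t) = \<tau> t"
    and r1: "\<And>y z. y \<in> mspace M \<Longrightarrow> z \<in> mspace M \<Longrightarrow> mdist M z (\<tau> s) = mdist M y (\<tau> s) \<Longrightarrow>
        mdist M z (\<tau> u) = mdist M y (\<tau> u) \<Longrightarrow> z = y \<or> z = r y"
    and r2: "\<And>y z. y \<in> mspace M \<Longrightarrow> z \<in> mspace M \<Longrightarrow> mdist M y (r z) = mdist M y z \<Longrightarrow> r y = y \<or> r z = z"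
    using reflection[OF \<tau>(1)] \<tau>(5,6) by metis
  have "h x = r x"
    if h: "isometry M h" "\<not> is_identity M h" "\<And>x. x \<in> a \<Longrightarrow> h x = x" and x: "x \<in> mspace M" for h x
  proof -
    have two: "h y = y \<or> h y = r y" if y: "y \<in> mspace M" for y
      using r1[OF y isometry_mem[OF h(1) y]] isometry_mdist[OF h(1) y] geodesic_mem[OF \<tau>(1)]
        h(3)[OF \<tau>(3)] h(3)[OF \<tau>(4)] by metis
    obtain z where z: "z \<in> mspace M" "h z \<noteq> z" using h(2) by (auto simp: is_identity_def)
    show ?thesis
    proof (cases "h x = x")
      case True
      then have "mdist M x (r z) = mdist M x z"
        using isometry_mdist[OF h(1) x z(1)] two[OF z(1)] z(2) by auto
      then show ?thesis using r2[OF x z(1)] two[OF z(1)] z(2) True by auto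
    qed (use two x in blast)
  qed
  moreover have "r x = x" if "x \<in> a" for x using \<tau>(2) r(4) that by blast
  ultimately show thesis using r that by blast
qed

lemma wall_reflection_properties:
  assumes "wall M a"
  shows wall_reflection_isometry: "isometry M (wall_reflection M a)"
    and wall_reflection_fix: "x \<in> a \<Longrightarrow> wall_reflection M a x = x"
    and wall_reflection_involution: "x \<in> mspace M \<Longrightarrow> wall_reflection M a (wall_reflection M a x) = x"
    and wall_reflection_eq: "isometry M h \<Longrightarrow> \<not> is_identity M h \<Longrightarrow> (\<And>x. x \<in> a \<Longrightarrow> h x = x) \<Longrightarrow>
           x \<in> mspace M \<Longrightarrow> wall_reflection M a x = h x"
proof -
  obtain r where r: "isometry M r" "\<not> is_identity M r" "\<And>x. x \<in> mspace M \<Longrightarrow> r (r x) = x"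
    "\<And>x. x \<in> a \<Longrightarrow> r x = x"
    and uniq: "\<And>h x. isometry M h \<Longrightarrow> \<not> is_identity M h \<Longrightarrow> (\<And>x. x \<in> a \<Longrightarrow> h x = x) \<Longrightarrow> x \<in> mspace M \<Longrightarrow> h x = r x"
    using wall_reflection_exists[OF assms] by blast
  let ?P = "\<lambda>h. isometry M h \<and> \<not> is_identity M h \<and> (\<forall>x\<in>a. h x = x)"
  have "?P (wall_reflection M a)"
    unfolding wall_reflection_def by (rule someI[of ?P r]) (use r in auto)
  then have H: "isometry M (wall_reflection M a)" "\<not> is_identity M (wall_reflection M a)"
    "\<And>x. x \<in> a \<Longrightarrow> wall_reflection M a x = x" by auto
  have eq: "wall_reflection M a x = r x" if "x \<in> mspace M" for x
    using uniq[OF H that] by blast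
  show "isometry M (wall_reflection M a)" "x \<in> a \<Longrightarrow> wall_reflection M a x = x"
    using H by auto
  show "x \<in> mspace M \<Longrightarrow> wall_reflection M a (wall_reflection M a x) = x"
    using eq r isometry_mem by metis
  show "isometry M h \<Longrightarrow> \<not> is_identity M h \<Longrightarrow> (\<And>x. x \<in> a \<Longrightarrow> h x = x) \<Longrightarrow>
           x \<in> mspace M \<Longrightarrow> wall_reflection M a x = h x"
    using uniq eq by metis
qed

lemma isometry_reflection_product:
  assumes "\<And>a. a \<in> set as \<Longrightarrow> wall M a"
  shows "isometry M (reflection_product M as)"
  using assms
  by (induction as) (auto simp: reflection_product_def isometry_id intro!: isometry_comp wall_reflection_isometry)

subsection \<open>Unfolding\<close>

text \<open>
  Instead of reflecting the trajectory, one reflects the surface: the leg after the impact on \<open>a\<close> is the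
  image under the reflection in \<open>a\<close> of the straight continuation of the leg before it.
\<close>

lemma trajectory_unfold:
  assumes "trajectory M \<Omega> W x as L y" "\<And>a. a \<in> W \<Longrightarrow> wall M a"
    and "geodesic M \<sigma>" "\<sigma> 0 = fst x" "(\<sigma> has_vector_derivative snd x) (at 0)"
  shows "\<exists>\<tau>. geodesic M \<tau> \<and> \<tau> 0 = fst y \<and> (\<tau> has_vector_derivative snd y) (at 0) \<and>
    (\<forall>t. \<sigma> (t + L) = reflection_product M as (\<tau> t)) \<and> set as \<subseteq> W \<and> 0 \<le> L \<and> (as \<noteq> [] \<longrightarrow> 0 < L)"
  using assms(1,3-)
proof (induction arbitrary: \<sigma>)
  case (Nil x)
  then show ?case by (intro exI[of _ \<sigma>]) (auto simp: reflection_product_def)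
next
  case (Cons x a l y as L z)
  let ?H = "wall_reflection M a"
  obtain \<sigma>1 where \<sigma>1: "geodesic M \<sigma>1" "\<sigma>1 0 = fst x" "(\<sigma>1 has_vector_derivative snd x) (at 0)"
      "l > 0" "\<sigma>1 l = fst y" "regular_point M W a (fst y)"
      "((?H \<circ> \<sigma>1) has_vector_derivative snd y) (at l)"
    using Cons.hyps(1) unfolding bounce_def by blast
  have "\<sigma>1 = \<sigma>"
    using geodesic_determined(1)[OF \<sigma>1(1,3)] geodesic_determined(1)[OF Cons.prems(1,3)] \<sigma>1(2) Cons.prems(2)
    by simp
  note \<sigma>1 = \<sigma>1[unfolded this]
  have a: "a \<in> W" "\<sigma> l \<in> a" using regular_point_mem[OF \<sigma>1(6)] \<sigma>1(5) by auto
  note H = wall_reflection_properties[OF assms(2)[OF a(1)]]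
  \<comment> \<open>\<open>\<rho>\<close> is the geodesic of the next leg.\<close>
  define \<rho> where "\<rho> = (\<lambda>t. (?H \<circ> \<sigma>) (l + 1 * t))"
  have "geodesic M \<rho>"
    unfolding \<rho>_def by (intro geodesic_reparam geodesic_isometry H(1) Cons.prems(1)) simp
  moreover have "\<rho> 0 = fst y" using H(2)[OF a(2)] \<sigma>1(5) by (simp add: \<rho>_def)
  moreover have "(\<rho> has_vector_derivative snd y) (at 0)"
  proof -
    have "((\<lambda>t. l + 1 * t) has_vector_derivative 1) (at 0)" by (auto intro!: derivative_eq_intros)
    then show ?thesis
      using vector_diff_chain_at[of "\<lambda>t. l + 1 * t" 1 0 "?H \<circ> \<sigma>" "snd y"] \<sigma>1(7)
      by (simp add: \<rho>_def o_def)
  qed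
  ultimately obtain \<tau> where \<tau>: "geodesic M \<tau>" "\<tau> 0 = fst z" "(\<tau> has_vector_derivative snd z) (at 0)"
      "\<And>t. \<rho> (t + L) = reflection_product M as (\<tau> t)" "set as \<subseteq> W" "0 \<le> L"
    using Cons.IH by blast
  have "\<sigma> (t + (l + L)) = reflection_product M (a # as) (\<tau> t)" for t
  proof -
    have "?H (\<sigma> (t + (l + L))) = reflection_product M as (\<tau> t)"
      using \<tau>(4)[of t] by (simp add: \<rho>_def algebra_simps)
    then have "\<sigma> (t + (l + L)) = ?H (reflection_product M as (\<tau> t))"
      using H(3)[OF geodesic_mem[OF Cons.prems(1)]] by metis
    then show ?thesis by (simp add: reflection_product_def)
  qed
  with \<tau> a \<open>l > 0\<close> show ?case by (intro exI[of _ \<tau>]) auto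
qed

lemma orbit_space_tangent:
  assumes "(p, v) \<in> orbit_space M \<Omega> W"
  shows "p \<in> mspace M" "v \<in> T p"
proof -
  obtain \<sigma> where "geodesic M \<sigma>" "\<sigma> 0 = p" "(\<sigma> has_vector_derivative v) (at 0)"
    using assms by (auto simp: orbit_space_def)
  then show "p \<in> mspace M" "v \<in> T p"
    using geodesic_determined(2) geodesic_mem by auto
qed

lemma periodic_orbit_translates:
  assumes "periodic_orbit M \<Omega> W as L (p, v)" "billiard_table M \<Omega> W"
  shows "translates (reflection_product M as) (geo p v) L" "set as \<subseteq> W" "as \<noteq> [] \<Longrightarrow> 0 < L"
proof -
  have pv: "p \<in> mspace M" "v \<in> T p" and tr: "trajectory M \<Omega> W (p, v) as L (p, v)"
    using assms orbit_space_tangent by (auto simp: periodic_orbit_def)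
  have g: "geodesic M (geo p v)" using pv geodesic_iff_geo by blast
  have "\<And>a. a \<in> W \<Longrightarrow> wall M a" using assms(2) by (auto simp: billiard_table_def)
  from trajectory_unfold[OF tr this g] obtain \<tau> where
    \<tau>: "geodesic M \<tau>" "\<tau> 0 = p" "(\<tau> has_vector_derivative v) (at 0)"
      "\<And>t. geo p v (t + L) = reflection_product M as (\<tau> t)" and *: "set as \<subseteq> W" "as \<noteq> [] \<longrightarrow> 0 < L"
    by (auto simp: geo_0 geo_deriv_0)
  have "\<tau> = geo p v" using geodesic_determined(1)[OF \<tau>(1,3)] \<tau>(2) by simp
  with \<tau>(4) * show "translates (reflection_product M as) (geo p v) L" "set as \<subseteq> W" "as \<noteq> [] \<Longrightarrow> 0 < L"
    by (auto simp: translates_def)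
qed

subsection \<open>Fans of orbits\<close>

text \<open>
  If \<open>A \<noteq> 0\<close>, then \<open>p\<close> is off the line and continuity in \<open>t\<close> suffices, uniformly in \<open>\<theta>\<close>. Otherwise the line
  passes through \<open>p\<close>, and only its own two directions at \<open>p\<close> must be avoided. The direction \<open>\<theta> = 0\<close> may be
  one of them, which is why \<open>\<theta> > 0\<close> is required.
\<close>

lemma fan_avoids_line:
  assumes "A \<noteq> 0 \<or> b \<noteq> 0 \<or> c \<noteq> 0"
  shows "\<exists>\<delta>>0. \<forall>\<theta> t. 0 < \<theta> \<longrightarrow> \<theta> < \<delta> \<longrightarrow> 0 < t \<longrightarrow> t < \<delta> \<longrightarrow>
    C t * A + S t * (cos \<theta> * b + sin \<theta> * c) \<noteq> 0"
proof (cases "A = 0")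
  case False
  have "isCont (\<lambda>t. \<bar>C t * A\<bar> - \<bar>S t\<bar> * (\<bar>b\<bar> + \<bar>c\<bar>)) 0"
    by (intro continuous_intros)
  then have "((\<lambda>t. \<bar>C t * A\<bar> - \<bar>S t\<bar> * (\<bar>b\<bar> + \<bar>c\<bar>)) \<longlongrightarrow> \<bar>A\<bar>) (at 0)"
    by (simp add: isCont_def C_0 S_0)
  then have "eventually (\<lambda>t. \<bar>C t * A\<bar> - \<bar>S t\<bar> * (\<bar>b\<bar> + \<bar>c\<bar>) > 0) (at 0)"
    using False by (intro order_tendstoD(1)) auto
  then obtain d where d: "d > 0" "\<And>t. t \<noteq> 0 \<Longrightarrow> \<bar>t\<bar> < d \<Longrightarrow> \<bar>C t * A\<bar> > \<bar>S t\<bar> * (\<bar>b\<bar> + \<bar>c\<bar>)"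
    by (auto simp: eventually_at dist_real_def)
  have "C t * A + S t * (cos \<theta> * b + sin \<theta> * c) \<noteq> 0" if "0 < t" "t < d" for \<theta> t
  proof
    assume "C t * A + S t * (cos \<theta> * b + sin \<theta> * c) = 0"
    then have "\<bar>C t * A\<bar> = \<bar>S t\<bar> * \<bar>cos \<theta> * b + sin \<theta> * c\<bar>"
      by (simp add: abs_mult[symmetric] add_eq_0_iff)
    moreover have "\<bar>cos \<theta> * b + sin \<theta> * c\<bar> \<le> \<bar>b\<bar> + \<bar>c\<bar>"
    proof -
      have "\<bar>cos \<theta> * b\<bar> \<le> \<bar>b\<bar>" "\<bar>sin \<theta> * c\<bar> \<le> \<bar>c\<bar>"
        by (auto simp: abs_mult intro!: mult_left_le_one_le)
      then show ?thesis by linarith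
    qed
    ultimately have "\<bar>C t * A\<bar> \<le> \<bar>S t\<bar> * (\<bar>b\<bar> + \<bar>c\<bar>)" by (simp add: mult_left_mono)
    with d(2)[of t] that show False by auto
  qed
  with d(1) show ?thesis by blast
next
  case A: True
  have S: "S t \<noteq> 0" if "0 < t" "t < 1" for t using S_pos[of t] that by auto
  show ?thesis
  proof (cases "b = 0")
    case True
    have "sin \<theta> > 0" if "0 < \<theta>" "\<theta> < 1" for \<theta> :: real
      using sin_gt_zero[of \<theta>] that pi_ge_two by linarith
    then show ?thesis using S A True assms by (intro exI[of _ 1]) force
  next
    case False
    have "isCont (\<lambda>\<theta>. cos \<theta> * b + sin \<theta> * c) 0" by (intro continuous_intros)
    then obtain d where "d > 0" "\<And>\<theta>. \<bar>\<theta>\<bar> < d \<Longrightarrow> cos \<theta> * b + sin \<theta> * c \<noteq> 0"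
      using continuous_at_avoid[of 0 "\<lambda>\<theta>. cos \<theta> * b + sin \<theta> * c" 0] False
      by (auto simp: dist_real_def)
    then show ?thesis using S A by (intro exI[of _ "min d 1"]) force
  qed
qed

text \<open>
  The openness of the family is used only at a fixed impact point \<open>p\<close>. The geodesics that leave \<open>p\<close> in
  the directions \<open>cos \<theta> v + sin \<theta> w\<close> for small \<open>\<theta> > 0\<close> meet none of the finitely many lines that carry
  the walls for a short while, and the geodesic for \<open>\<theta> = 0\<close> starts inside the domain. So these
  pieces form a connected set that meets the domain but not its frontier, hence a subset of the domain.
\<close>

lemma open_family_contains_fan:
  assumes table: "billiard_table M \<Omega> W"
    and U: "openin (top_of_set (orbit_space M \<Omega> W)) U" and pv: "(p, v) \<in> U"
  obtains w \<delta> where "\<delta> > 0" "\<delta> \<le> 1" "\<And>\<theta>. cos \<theta> *\<^sub>R v + sin \<theta> *\<^sub>R w \<in> T p"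
    "\<And>a b. a *\<^sub>R v + b *\<^sub>R w = 0 \<Longrightarrow> a = 0 \<and> b = 0"
    "\<And>\<theta>. 0 \<le> \<theta> \<Longrightarrow> \<theta> < \<delta> \<Longrightarrow> (p, cos \<theta> *\<^sub>R v + sin \<theta> *\<^sub>R w) \<in> U"
proof -
  let ?X = "top_of_set (mspace M)"
  obtain V where V: "open V" "U = orbit_space M \<Omega> W \<inter> V" using U by (auto simp: openin_open)
  have \<Omega>: "openin ?X \<Omega>" and fin: "finite W" and walls: "\<And>a. a \<in> W \<Longrightarrow> wall M a"
    and fr: "?X frontier_of \<Omega> = \<Union>W"
    using table by (auto simp: billiard_table_def)
  have pv': "(p, v) \<in> orbit_space M \<Omega> W" using pv V by auto
  note p = orbit_space_tangent[OF pv']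
  obtain \<sigma> \<epsilon> where reg: "\<exists>a. regular_point M W a p" and
    \<sigma>: "geodesic M \<sigma>" "\<sigma> 0 = p" "(\<sigma> has_vector_derivative v) (at 0)" "\<epsilon> > 0" "\<sigma> ` {0<..<\<epsilon>} \<subseteq> \<Omega>"
    using pv' by (auto simp: orbit_space_def)
  have \<sigma>_eq: "\<sigma> = geo p v" using geodesic_determined(1)[OF \<sigma>(1,3)] \<sigma>(2) by simp
  obtain w where w: "\<And>\<theta>. cos \<theta> *\<^sub>R v + sin \<theta> *\<^sub>R w \<in> T p"
    "\<And>a b. a *\<^sub>R v + b *\<^sub>R w = 0 \<Longrightarrow> a = 0 \<and> b = 0"
    and avoid: "\<And>\<tau>. geodesic M \<tau> \<Longrightarrow> \<exists>A b c. (A \<noteq> 0 \<or> b \<noteq> 0 \<or> c \<noteq> 0) \<and>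
                (\<forall>\<theta> t. geo p (cos \<theta> *\<^sub>R v + sin \<theta> *\<^sub>R w) t \<in> range \<tau> \<longrightarrow>
                   C t * A + S t * (cos \<theta> * b + sin \<theta> * c) = 0)"
    using tangent_circle[OF p] by metis
  define f where "f \<theta> = cos \<theta> *\<^sub>R v + sin \<theta> *\<^sub>R w" for \<theta>
  have f0: "f 0 = v" by (simp add: f_def)
  have "\<exists>\<delta>>0. \<forall>\<theta> t. 0 < \<theta> \<longrightarrow> \<theta> < \<delta> \<longrightarrow> 0 < t \<longrightarrow> t < \<delta> \<longrightarrow> geo p (f \<theta>) t \<notin> a" if "a \<in> W" for a
  proof -
    obtain \<tau> where \<tau>: "geodesic M \<tau>" "a \<subseteq> range \<tau>"
      using wall_obtain_two_points[OF walls[OF \<open>a \<in> W\<close>]] by metis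
    from avoid[OF \<tau>(1)] obtain A b c where "A \<noteq> 0 \<or> b \<noteq> 0 \<or> c \<noteq> 0"
      and *: "\<And>\<theta> t. geo p (f \<theta>) t \<in> range \<tau> \<Longrightarrow> C t * A + S t * (cos \<theta> * b + sin \<theta> * c) = 0"
      unfolding f_def by metis
    from fan_avoids_line[OF this(1)] * \<tau>(2) show ?thesis by (meson subsetD)
  qed
  then obtain d where d: "\<And>a. a \<in> W \<Longrightarrow> d a > 0"
    "\<And>a \<theta> t. a \<in> W \<Longrightarrow> 0 < \<theta> \<Longrightarrow> \<theta> < d a \<Longrightarrow> 0 < t \<Longrightarrow> t < d a \<Longrightarrow> geo p (f \<theta>) t \<notin> a"
    by metis
  \<comment> \<open>Below \<open>\<epsilon>\<close> the initial orbit stays in the domain; below each \<open>d a\<close> the fan avoids the wall \<open>a\<close>.\<close>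
  define \<eta> where "\<eta> = Min (insert \<epsilon> (d ` W))"
  have \<eta>: "\<eta> > 0" "\<eta> \<le> \<epsilon>" "\<And>a. a \<in> W \<Longrightarrow> \<eta> \<le> d a"
    using fin d(1) \<sigma>(4) by (auto simp: \<eta>_def)
  define F where "F = (\<lambda>(\<theta>, t). geo p (f \<theta>) t) ` ({0..<\<eta>} \<times> {0<..<\<eta>})"
  have "continuous_on ({0..<\<eta>} \<times> {0<..<\<eta>}) (\<lambda>(\<theta>, t). geo p (f \<theta>) t)"
    unfolding geo_def f_def case_prod_unfold by (intro continuous_intros)
  then have "connected F"
    unfolding F_def by (rule connected_continuous_image) (intro connected_Times connected_Ico connected_Ioo)
  moreover have "F \<subseteq> mspace M"
    using w(1) p(1) geodesic_iff_geo[of "geo p (f _)"] geodesic_mem[of M "geo p (f _)"]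
    unfolding F_def f_def by fastforce
  ultimately have conn: "connectedin ?X F" by (auto simp: connectedin_subtopology)
  have F_int: "geo p (f 0) t \<in> \<Omega>" if "0 < t" "t < \<eta>" for t
    using that \<sigma>(5) \<eta>(2) by (auto simp: f0 \<sigma>_eq image_subset_iff)
  have "\<Omega> \<inter> \<Union>W = {}"
    unfolding fr[symmetric] frontier_of_def using \<Omega> by (simp add: interior_of_openin)
  then have "geo p (f \<theta>) t \<notin> \<Union>W" if "0 \<le> \<theta>" "\<theta> < \<eta>" "0 < t" "t < \<eta>" for \<theta> t
    using F_int[of t] d(2)[of _ \<theta> t] \<eta>(3) that by (cases "\<theta> = 0") fastforce+
  then have "F \<inter> ?X frontier_of \<Omega> = {}" unfolding fr F_def by auto
  moreover have "geo p (f 0) (\<eta> / 2) \<in> F \<inter> \<Omega>"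
    using F_int[of "\<eta> / 2"] \<eta>(1) by (auto simp: F_def intro!: image_eqI[of _ _ "(0, \<eta> / 2)"])
  ultimately have F_sub: "F \<subseteq> \<Omega>" using connectedin_Int_frontier_of[OF conn, of \<Omega>] by auto
  have orb: "(p, f \<theta>) \<in> orbit_space M \<Omega> W" if "0 \<le> \<theta>" "\<theta> < \<eta>" for \<theta>
  proof -
    have "geo p (f \<theta>) ` {0<..<\<eta>} \<subseteq> \<Omega>" using F_sub that by (auto simp: F_def image_subset_iff)
    moreover have "geodesic M (geo p (f \<theta>))" using geodesic_iff_geo p(1) w(1) f_def by metis
    ultimately show ?thesis
      unfolding orbit_space_def using reg \<eta>(1) geo_0 geo_deriv_0 by blast
  qed
  have "isCont (\<lambda>\<theta>. (p, f \<theta>)) 0" unfolding f_def by (intro continuous_intros)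
  then have "eventually (\<lambda>\<theta>. (p, f \<theta>) \<in> V) (at 0)"
    using V pv f0 by (intro topological_tendstoD[of _ "(p, f 0)"]) (auto simp: isCont_def)
  then obtain d' where d': "d' > 0" "\<And>\<theta>. \<theta> \<noteq> 0 \<Longrightarrow> \<bar>\<theta>\<bar> < d' \<Longrightarrow> (p, f \<theta>) \<in> V"
    by (auto simp: eventually_at dist_real_def)
  have "(p, f \<theta>) \<in> U" if "0 \<le> \<theta>" "\<theta> < min 1 (min \<eta> d')" for \<theta>
    using that orb[of \<theta>] d'(2)[of \<theta>] pv f0 V by (cases "\<theta> = 0") auto
  then show thesis
    using w \<eta>(1) d'(1) by (intro that[of "min 1 (min \<eta> d')" w]) (auto simp: f_def)
qed

lemma fan_inj:
  fixes v w :: 'a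
  assumes "\<And>a b. a *\<^sub>R v + b *\<^sub>R w = 0 \<Longrightarrow> a = 0 \<and> b = 0" "\<delta> \<le> 1"
  shows "inj_on (\<lambda>\<theta>. cos \<theta> *\<^sub>R v + sin \<theta> *\<^sub>R w) {0..<\<delta>}"
proof
  fix x y assume "x \<in> {0..<\<delta>}" "y \<in> {0..<\<delta>}"
    and eq: "cos x *\<^sub>R v + sin x *\<^sub>R w = cos y *\<^sub>R v + sin y *\<^sub>R w"
  moreover have "(cos x - cos y) *\<^sub>R v + (sin x - sin y) *\<^sub>R w = 0"
  proof -
    have "(cos x - cos y) *\<^sub>R v + (sin x - sin y) *\<^sub>R w
        = (cos x *\<^sub>R v + sin x *\<^sub>R w) - (cos y *\<^sub>R v + sin y *\<^sub>R w)"
      by (simp add: scaleR_diff_left)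
    with eq show ?thesis by simp
  qed
  ultimately show "x = y"
    using assms(1)[of "cos x - cos y"] assms(2) cos_inj_pi[of x y] pi_ge_two by auto
qed

text \<open>
  Where a geodesic is determined by two distinct points, the point \<open>g p\<close> determines the direction at \<open>p\<close>
  of the only geodesic through \<open>p\<close> that \<open>g\<close> can translate. Finitely many itineraries of length \<open>k\<close>
  thus give finitely many periodic directions at \<open>p\<close>, whereas an open set contains a fan of them.
\<close>

lemma not_k_reflective:
  assumes uniq: "\<And>p v v' l l'. p \<in> mspace M \<Longrightarrow> v \<in> T p \<Longrightarrow> v' \<in> T p \<Longrightarrow> 0 < l \<Longrightarrow> 0 < l' \<Longrightarrow>
      geo p v l = geo p v' l' \<Longrightarrow> v = v'"
    and table: "billiard_table M \<Omega> W" and k: "k \<ge> 1"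
  shows "\<not> k_reflective M \<Omega> W k"
proof
  assume "k_reflective M \<Omega> W k"
  then obtain U p v where U: "openin (top_of_set (orbit_space M \<Omega> W)) U" and pv: "(p, v) \<in> U"
    and per: "\<And>x. x \<in> U \<Longrightarrow> \<exists>as L. length as = k \<and> periodic_orbit M \<Omega> W as L x"
    unfolding k_reflective_def by fastforce
  obtain w \<delta> where \<delta>: "\<delta> > 0" "\<delta> \<le> 1" and T: "\<And>\<theta>. cos \<theta> *\<^sub>R v + sin \<theta> *\<^sub>R w \<in> T p"
    and indep: "\<And>a b. a *\<^sub>R v + b *\<^sub>R w = 0 \<Longrightarrow> a = 0 \<and> b = 0"
    and fan: "\<And>\<theta>. 0 \<le> \<theta> \<Longrightarrow> \<theta> < \<delta> \<Longrightarrow> (p, cos \<theta> *\<^sub>R v + sin \<theta> *\<^sub>R w) \<in> U"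
    using open_family_contains_fan[OF table U pv] by metis
  have "(p, v) \<in> orbit_space M \<Omega> W" using U pv openin_imp_subset by blast
  then have p: "p \<in> mspace M" using orbit_space_tangent by blast
  define f where "f = (\<lambda>\<theta>. cos \<theta> *\<^sub>R v + sin \<theta> *\<^sub>R w)"
  define N where "N = {as. set as \<subseteq> W \<and> length as = k}"
  have "\<exists>as L. as \<in> N \<and> 0 < L \<and> geo p (f \<theta>) L = reflection_product M as p" if "\<theta> \<in> {0..<\<delta>}" for \<theta>
  proof -
    obtain as L where as: "length as = k" "periodic_orbit M \<Omega> W as L (p, f \<theta>)"
      using per[OF fan[of \<theta>]] \<open>\<theta> \<in> _\<close> unfolding f_def by fastforce
    note tr = periodic_orbit_translates[OF as(2) table]
    have "reflection_product M as p = geo p (f \<theta>) L"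
      using tr(1) geo_0[of p "f \<theta>"] unfolding translates_def by (metis add_0)
    moreover have "as \<noteq> []" using as(1) k by auto
    ultimately show ?thesis using tr(2,3) as(1) by (auto simp: N_def intro!: exI[of _ as] exI[of _ L])
  qed
  then obtain A L where AL: "\<And>\<theta>. \<theta> \<in> {0..<\<delta>} \<Longrightarrow> A \<theta> \<in> N"
    "\<And>\<theta>. \<theta> \<in> {0..<\<delta>} \<Longrightarrow> 0 < L \<theta> \<and> geo p (f \<theta>) (L \<theta>) = reflection_product M (A \<theta>) p" by metis
  have "inj_on A {0..<\<delta>}"
  proof
    fix x y assume x: "x \<in> {0..<\<delta>}" and y: "y \<in> {0..<\<delta>}" and "A x = A y"
    then have "geo p (f x) (L x) = geo p (f y) (L y)" using AL by metis
    then have "f x = f y"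
      using uniq[OF p, of "f x" "f y" "L x" "L y"] T AL(2) x y by (auto simp: f_def)
    then show "x = y" using fan_inj[OF indep \<delta>(2)] x y unfolding f_def inj_on_def by blast
  qed
  moreover have "finite N"
    unfolding N_def using table by (intro finite_lists_length_eq) (auto simp: billiard_table_def)
  ultimately have "finite {0..<\<delta>}"
    using AL(1) by (meson finite_subset image_subsetI finite_imageD)
  then show False using \<delta>(1) infinite_Ico by blast
qed

end

section \<open>The Euclidean plane\<close>

definition rot90 :: "real^2 \<Rightarrow> real^2" where
  "rot90 x = vector [- x $ 2, x $ 1]"

lemma rot90_inner [simp]: "rot90 x \<bullet> x = 0" "x \<bullet> rot90 x = 0" "rot90 x \<bullet> rot90 x = x \<bullet> x"
  by (simp_all add: rot90_def inner_vec_def sum_2 algebra_simps)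

lemma rot90_expand:
  assumes "u \<bullet> u = 1"
  shows "x = (x \<bullet> u) *\<^sub>R u + (x \<bullet> rot90 u) *\<^sub>R rot90 u"
proof -
  have u: "u$1 * u$1 + u$2 * u$2 = 1" using assms by (simp add: inner_vec_def sum_2)
  have "x$1 = (x$1 * u$1 + x$2 * u$2) * u$1 + (x$1 * (- u$2) + x$2 * u$1) * (- u$2)"
    "x$2 = (x$1 * u$1 + x$2 * u$2) * u$2 + (x$1 * (- u$2) + x$2 * u$1) * u$1"
    using u by algebra+
  then show ?thesis by (simp add: vec_eq_iff forall_2 rot90_def inner_vec_def sum_2)
qed

lemma rot90_coordinates_eq:
  assumes "u \<bullet> u = 1" "x \<bullet> u = y \<bullet> u" "x \<bullet> rot90 u = y \<bullet> rot90 u"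
  shows "x = y"
  using rot90_expand[OF assms(1)] assms(2,3) by metis

lemma dist_eq_iff_inner:
  fixes x y x' y' :: "'a::real_inner"
  shows "dist x y = dist x' y' \<longleftrightarrow> (x - y) \<bullet> (x - y) = (x' - y') \<bullet> (x' - y')"
  by (simp add: dist_norm norm_eq)

lemma inner_self_diff: "(a - b) \<bullet> (a - b) = a \<bullet> a - 2 * (a \<bullet> b) + b \<bullet> b"
  and inner_self_add: "(a + b) \<bullet> (a + b) = a \<bullet> a + 2 * (a \<bullet> b) + b \<bullet> b"
  for a b :: "'a::real_inner"
  by (simp_all add: inner_diff inner_add inner_commute[of b a])

text \<open>The reflection in the line through \<open>q\<close> with unit direction \<open>u\<close>.\<close>

definition mirror_E2 :: "real^2 \<Rightarrow> real^2 \<Rightarrow> real^2 \<Rightarrow> real^2" where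
  "mirror_E2 q u x = x - (2 * ((x - q) \<bullet> rot90 u)) *\<^sub>R rot90 u"

lemma mirror_E2_coordinates:
  assumes "u \<bullet> u = 1"
  shows "(mirror_E2 q u x - q) \<bullet> u = (x - q) \<bullet> u"
    "(mirror_E2 q u x - q) \<bullet> rot90 u = - ((x - q) \<bullet> rot90 u)"
  using assms by (simp_all add: mirror_E2_def inner_diff_left)

lemma mirror_E2_line: "u \<bullet> u = 1 \<Longrightarrow> mirror_E2 q u (q + t *\<^sub>R u) = q + t *\<^sub>R u"
  by (simp add: mirror_E2_def)

lemma mirror_E2_mirror_E2: "u \<bullet> u = 1 \<Longrightarrow> mirror_E2 q u (mirror_E2 q u x) = x"
  using mirror_E2_coordinates(2)[of u q x] by (simp add: mirror_E2_def[of q u "mirror_E2 q u x"])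
    (simp add: mirror_E2_def)

lemma mirror_E2_isometry:
  assumes "u \<bullet> u = 1"
  shows "isometry E2 (mirror_E2 q u)" "\<not> is_identity E2 (mirror_E2 q u)"
proof -
  show "isometry E2 (mirror_E2 q u)"
  proof (rule isometry_if_involution)
    fix x y
    let ?n = "rot90 u" let ?c = "(x - y) \<bullet> rot90 u"
    have "mirror_E2 q u x - mirror_E2 q u y = (x - y) - (2 * ?c) *\<^sub>R ?n"
      by (simp add: mirror_E2_def inner_diff_left algebra_simps)
    moreover have "((x - y) - (2 * ?c) *\<^sub>R ?n) \<bullet> ((x - y) - (2 * ?c) *\<^sub>R ?n) = (x - y) \<bullet> (x - y)"
      using assms by (simp add: inner_self_diff[of "x - y"])
    ultimately show "mdist E2 (mirror_E2 q u x) (mirror_E2 q u y) = mdist E2 x y"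
      by (simp add: dist_eq_iff_inner)
  qed (simp_all add: mirror_E2_mirror_E2 assms)
  have "mirror_E2 q u (q + rot90 u) \<noteq> q + rot90 u"
    using assms by (simp add: mirror_E2_def) (metis inner_zero_left rot90_inner(3) zero_neq_one)
  then show "\<not> is_identity E2 (mirror_E2 q u)"
    by (auto simp: is_identity_def)
qed

text \<open>
  Let \<open>v\<close> be the unit vector from \<open>\<sigma> t\<close> to a second nearby point of the geodesic. The distances of
  \<open>\<sigma> (t + s)\<close> from these two points determine the product of \<open>\<sigma> (t + s) - \<sigma> t\<close> with \<open>v\<close>. It is \<open>s\<close>, which is
  up to sign the length of that difference, so equality holds in the Cauchy-Schwarz inequality.
\<close>

lemma geodesic_E2_local:
  assumes \<sigma>: "geodesic E2 \<sigma>"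
  shows "\<exists>\<epsilon>>0. \<exists>v\<in>{v. norm v = 1}. \<forall>s. \<bar>s\<bar> < \<epsilon> \<longrightarrow> \<sigma> (t + s) = 1 *\<^sub>R \<sigma> t + s *\<^sub>R v"
proof -
  obtain \<epsilon> where \<epsilon>: "\<epsilon> > 0" "\<And>s u. s \<in> ball t \<epsilon> \<Longrightarrow> u \<in> ball t \<epsilon> \<Longrightarrow> dist (\<sigma> s) (\<sigma> u) = \<bar>s - u\<bar>"
    using \<sigma> unfolding geodesic_def mdist_E2 by metis
  define d where "d = \<epsilon> / 2"
  have d: "d > 0" "t + d \<in> ball t \<epsilon>" "t \<in> ball t \<epsilon>" using \<epsilon>(1) by (auto simp: d_def dist_real_def)
  define v where "v = (1 / d) *\<^sub>R (\<sigma> (t + d) - \<sigma> t)"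
  have q: "\<sigma> (t + d) - \<sigma> t = d *\<^sub>R v" using d(1) by (simp add: v_def)
  have "norm (\<sigma> (t + d) - \<sigma> t) = d" using \<epsilon>(2)[OF d(2,3)] d(1) by (simp add: dist_norm)
  then have v: "norm v = 1" using d(1) unfolding q by simp
  then have vv: "v \<bullet> v = 1" by (simp add: norm_eq_1)
  have "\<sigma> (t + s) = 1 *\<^sub>R \<sigma> t + s *\<^sub>R v" if "\<bar>s\<bar> < \<epsilon>" for s
  proof -
    have ts: "t + s \<in> ball t \<epsilon>" using that by (simp add: dist_real_def)
    define x where "x = \<sigma> (t + s) - \<sigma> t"
    have sq: "y \<bullet> y = r * r" if "norm y = \<bar>r\<bar>" for y :: "real^2" and r :: real
      using that by (metis abs_mult_self_eq norm_eq_sqrt_inner norm_ge_zero real_sqrt_eq_iff real_sqrt_abs2 dot_square_norm power2_eq_square)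
    have xx: "x \<bullet> x = s * s" using \<epsilon>(2)[OF ts d(3)] by (intro sq) (simp add: dist_norm x_def)
    have xd: "x - d *\<^sub>R v = \<sigma> (t + s) - \<sigma> (t + d)" unfolding q[symmetric] x_def by simp
    have "(x - d *\<^sub>R v) \<bullet> (x - d *\<^sub>R v) = (s - d) * (s - d)"
      using \<epsilon>(2)[OF ts d(2)] unfolding xd by (intro sq) (simp add: dist_norm)
    then have "2 * d * (x \<bullet> v) = 2 * d * s"
      using xx vv by (auto simp: inner_self_diff inner_commute[of v x] algebra_simps)
    then have xv: "x \<bullet> v = s" using d(1) by simp
    have "(x - s *\<^sub>R v) \<bullet> (x - s *\<^sub>R v) = 0"
      using xx xv vv by (simp add: inner_self_diff[of x])
    then have "x = s *\<^sub>R v" by simp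
    then show ?thesis by (simp add: x_def diff_eq_eq add.commute)
  qed
  with v \<epsilon>(1) show ?thesis by blast
qed

lemma geodesic_E2_line:
  assumes "norm v = 1"
  shows "geodesic E2 (\<lambda>t. p + t *\<^sub>R v)"
proof -
  have "dist (p + s *\<^sub>R v) (p + u *\<^sub>R v) = \<bar>s - u\<bar>" for s u
  proof -
    have "(p + s *\<^sub>R v) - (p + u *\<^sub>R v) = (s - u) *\<^sub>R v" by (simp add: algebra_simps)
    then show ?thesis by (simp add: dist_norm assms)
  qed
  then show ?thesis by (auto simp: geodesic_def intro: exI[of _ 1])
qed

interpretation E2: geodesics_by_initial_data 0 "\<lambda>_. 1" "\<lambda>t. t" E2 "\<lambda>_. {v. norm v = 1}"
  by standard (use geodesic_E2_line geodesic_E2_local in \<open>auto intro!: derivative_eq_intros\<close>)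

lemma geo_E2: "E2.geo p v t = p + t *\<^sub>R v"
  by (simp add: E2.geo_def)

lemma geodesic_E2_obtain:
  assumes "geodesic E2 \<sigma>"
  obtains p u where "u \<bullet> u = 1" "\<sigma> = (\<lambda>t. p + t *\<^sub>R u)"
proof -
  obtain v where "norm v = 1" "\<sigma> = E2.geo (\<sigma> 0) v"
    using E2.geodesic_obtain_geo[OF assms] by auto
  moreover have "E2.geo (\<sigma> 0) v = (\<lambda>t. \<sigma> 0 + t *\<^sub>R v)"
    by (simp add: fun_eq_iff geo_E2)
  ultimately show thesis using that[of v "\<sigma> 0"] by (simp add: norm_eq_1)
qed

interpretation E2: constant_curvature_plane 0 "\<lambda>_. 1" "\<lambda>t. t" E2 "\<lambda>_. {v. norm v = 1}"
proof
  fix p v :: "real^2" assume "p \<in> mspace E2" and v: "v \<in> {v. norm v = 1}"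
  have vv: "v \<bullet> v = 1" using v by (simp add: norm_eq_1)
  have "cos \<theta> *\<^sub>R v + sin \<theta> *\<^sub>R rot90 v \<in> {v. norm v = 1}" for \<theta>
    using vv by (simp add: norm_eq_1 inner_add_left inner_add_right flip: power2_eq_square)
  moreover have "a = 0 \<and> b = 0" if "a *\<^sub>R v + b *\<^sub>R rot90 v = 0" for a b
    using arg_cong[OF that, of "\<lambda>x. x \<bullet> v"] arg_cong[OF that, of "\<lambda>x. x \<bullet> rot90 v"] vv
    by (simp add: inner_add_left)
  moreover have "\<exists>A b c. (A \<noteq> 0 \<or> b \<noteq> 0 \<or> c \<noteq> 0) \<and>
     (\<forall>\<theta> t. E2.geo p (cos \<theta> *\<^sub>R v + sin \<theta> *\<^sub>R rot90 v) t \<in> range \<tau> \<longrightarrow>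
        1 * A + t * (cos \<theta> * b + sin \<theta> * c) = 0)" if \<tau>: "geodesic E2 \<tau>" for \<tau>
  proof -
    obtain q u where u: "u \<bullet> u = 1" "\<tau> = (\<lambda>t. q + t *\<^sub>R u)" using \<tau> by (rule geodesic_E2_obtain)
    let ?n = "rot90 u"
    have "v \<bullet> ?n \<noteq> 0 \<or> rot90 v \<bullet> ?n \<noteq> 0"
      using rot90_expand[OF vv, of ?n] u(1) by (metis add_0 inner_commute rot90_inner(3) scaleR_zero_left inner_zero_left zero_neq_one)
    moreover have "1 * ((p - q) \<bullet> ?n) + t * (cos \<theta> * (v \<bullet> ?n) + sin \<theta> * (rot90 v \<bullet> ?n)) = 0"
      if "E2.geo p (cos \<theta> *\<^sub>R v + sin \<theta> *\<^sub>R rot90 v) t \<in> range \<tau>" for \<theta> t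
    proof -
      from that obtain s where "p + t *\<^sub>R (cos \<theta> *\<^sub>R v + sin \<theta> *\<^sub>R rot90 v) = q + s *\<^sub>R u"
        unfolding u(2) geo_E2 by blast
      from arg_cong[OF this, of "\<lambda>x. x \<bullet> ?n"] show ?thesis
        by (simp add: inner_add_left inner_diff_left algebra_simps)
    qed
    ultimately show ?thesis by blast
  qed
  ultimately show "\<exists>w. (\<forall>\<theta>. cos \<theta> *\<^sub>R v + sin \<theta> *\<^sub>R w \<in> {v. norm v = 1}) \<and>
          (\<forall>a b. a *\<^sub>R v + b *\<^sub>R w = 0 \<longrightarrow> a = 0 \<and> b = 0) \<and>
          (\<forall>\<tau>. geodesic E2 \<tau> \<longrightarrow>
             (\<exists>A b c. (A \<noteq> 0 \<or> b \<noteq> 0 \<or> c \<noteq> 0) \<and>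
                (\<forall>\<theta> t. E2.geo p (cos \<theta> *\<^sub>R v + sin \<theta> *\<^sub>R w) t \<in> range \<tau> \<longrightarrow>
                   1 * A + t * (cos \<theta> * b + sin \<theta> * c) = 0)))" by blast
next
  fix \<tau> assume "geodesic E2 \<tau>"
  then obtain q u where u: "u \<bullet> u = 1" "\<tau> = (\<lambda>t. q + t *\<^sub>R u)" by (rule geodesic_E2_obtain)
  let ?r = "mirror_E2 q u" let ?n = "rot90 u"
  have "z = y \<or> z = ?r y" if su: "s \<noteq> s'" and eq: "dist z (\<tau> s) = dist y (\<tau> s)" "dist z (\<tau> s') = dist y (\<tau> s')"
    for s s' y z
  proof -
    have *: "(z - q) \<bullet> (z - q) - 2 * t * ((z - q) \<bullet> u) = (y - q) \<bullet> (y - q) - 2 * t * ((y - q) \<bullet> u)"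
      if "dist z (\<tau> t) = dist y (\<tau> t)" for t
    proof -
      have "(x - (q + t *\<^sub>R u)) \<bullet> (x - (q + t *\<^sub>R u)) = (x - q) \<bullet> (x - q) - 2 * t * ((x - q) \<bullet> u) + t * t" for x
      proof -
        have "x - (q + t *\<^sub>R u) = (x - q) - t *\<^sub>R u" by simp
        from u(1) show ?thesis
          unfolding \<open>_ = (x - q) - t *\<^sub>R u\<close> inner_self_diff[of "x - q"] by simp
      qed
      then show ?thesis using that unfolding u(2) dist_eq_iff_inner by simp
    qed
    have "(s - s') * ((z - q) \<bullet> u) = (s - s') * ((y - q) \<bullet> u)"
      using *[OF eq(1)] *[OF eq(2)] by (simp add: left_diff_distrib)
    then have zu: "(z - q) \<bullet> u = (y - q) \<bullet> u" using su by simp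
    then have "(z - q) \<bullet> (z - q) = (y - q) \<bullet> (y - q)" using *[OF eq(1)] by simp
    moreover have "x \<bullet> x = (x \<bullet> u)\<^sup>2 + (x \<bullet> ?n)\<^sup>2" for x
      using arg_cong[OF rot90_expand[OF u(1), of x], of "\<lambda>y. x \<bullet> y"]
      by (simp add: inner_add_right power2_eq_square)
    ultimately have "((z - q) \<bullet> ?n)\<^sup>2 = ((y - q) \<bullet> ?n)\<^sup>2" using zu by simp
    then have "(z - q) \<bullet> ?n = (y - q) \<bullet> ?n \<or> (z - q) \<bullet> ?n = - ((y - q) \<bullet> ?n)"
      by (simp add: power2_eq_iff)
    then have "z - q = y - q \<or> z - q = ?r y - q"
      using rot90_coordinates_eq[OF u(1)] zu mirror_E2_coordinates[OF u(1)] by metis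
    then show ?thesis by simp
  qed
  moreover have "?r y = y \<or> ?r z = z" if "dist y (?r z) = dist y z" for y z
  proof -
    define c where "c = (z - q) \<bullet> ?n"
    have "y - ?r z = (y - z) + (2 * c) *\<^sub>R ?n" by (simp add: mirror_E2_def c_def)
    then have "((y - z) + (2 * c) *\<^sub>R ?n) \<bullet> ((y - z) + (2 * c) *\<^sub>R ?n) = (y - z) \<bullet> (y - z)"
      using that unfolding dist_eq_iff_inner by metis
    then have "4 * c * ((y - z) \<bullet> ?n + c) = 0"
      using u(1) by (simp add: inner_self_add[of "y - z"] inner_commute[of "rot90 u" y] inner_commute[of "rot90 u" z] algebra_simps)
    then have "c = 0 \<or> (y - q) \<bullet> ?n = 0" by (auto simp: c_def inner_diff_left)
    then show ?thesis by (auto simp: c_def mirror_E2_def)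
  qed
  ultimately show "\<exists>r. isometry E2 r \<and> \<not> is_identity E2 r \<and>
          (\<forall>x\<in>mspace E2. r (r x) = x) \<and> (\<forall>t. r (\<tau> t) = \<tau> t) \<and>
          (\<forall>s u. s \<noteq> u \<longrightarrow> \<bar>s - u\<bar> < 2 \<longrightarrow> (\<forall>y\<in>mspace E2. \<forall>z\<in>mspace E2.
             mdist E2 z (\<tau> s) = mdist E2 y (\<tau> s) \<longrightarrow> mdist E2 z (\<tau> u) = mdist E2 y (\<tau> u) \<longrightarrow>
             z = y \<or> z = r y)) \<and>
          (\<forall>y\<in>mspace E2. \<forall>z\<in>mspace E2. mdist E2 y (r z) = mdist E2 y z \<longrightarrow> r y = y \<or> r z = z)"
    using mirror_E2_isometry[OF u(1)] mirror_E2_mirror_E2[OF u(1)] mirror_E2_line[OF u(1)] u(2)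
    by (intro exI[of _ ?r]) auto
qed

lemma E2_not_k_reflective:
  assumes "billiard_table E2 \<Omega> W" "k \<ge> 1"
  shows "\<not> k_reflective E2 \<Omega> W k"
proof (rule E2.not_k_reflective[OF _ assms])
  fix p v v' :: "real^2" and l l' :: real
  assume v: "v \<in> {v. norm v = 1}" "v' \<in> {v. norm v = 1}" and l: "0 < l" "0 < l'"
    and "E2.geo p v l = E2.geo p v' l'"
  then have eq: "l *\<^sub>R v = l' *\<^sub>R v'" by (simp add: geo_E2)
  from arg_cong[OF this, of norm] v l have "l = l'" by simp
  with eq l show "v = v'" by simp
qed

subsection \<open>Geodesics translated by isometries of the Euclidean plane\<close>

lemma translates_translation_iff:
  fixes p u v :: "real^2"
  shows
  "translates (\<lambda>x. x + v) (\<lambda>t. p + t *\<^sub>R u) l \<longleftrightarrow> v = l *\<^sub>R u"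
proof -
  have "p + t *\<^sub>R u + v = p + (t + l) *\<^sub>R u \<longleftrightarrow> v = l *\<^sub>R u" for t
    unfolding scaleR_left_distrib add.assoc[symmetric] by simp
  then show ?thesis by (simp add: translates_def)
qed

lemma parallel_to_iff: "parallel_to (\<lambda>t. p + t *\<^sub>R u) v \<longleftrightarrow> u \<in> span {v}"
proof
  assume "parallel_to (\<lambda>t. p + t *\<^sub>R u) v"
  then have "(p + 1 *\<^sub>R u) - (p + 0 *\<^sub>R u) \<in> span {v}" unfolding parallel_to_def by blast
  then show "u \<in> span {v}" by simp
next
  assume u: "u \<in> span {v}"
  have "(p + t *\<^sub>R u) - (p + s *\<^sub>R u) = (t - s) *\<^sub>R u" for s t by (simp add: algebra_simps)
  then show "parallel_to (\<lambda>t. p + t *\<^sub>R u) v"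
    unfolding parallel_to_def using span_mul[OF u] by metis
qed

lemma unit_in_span_iff:
  fixes u v :: "'a::real_inner"
  assumes "u \<bullet> u = 1" "v \<noteq> 0"
  shows "u \<in> span {v} \<longleftrightarrow> (\<exists>l. l \<noteq> 0 \<and> v = l *\<^sub>R u)"
proof
  assume "u \<in> span {v}"
  then obtain k where k: "u = k *\<^sub>R v" by (auto simp: span_singleton)
  then have "k \<noteq> 0" using assms(1) by auto
  then show "\<exists>l. l \<noteq> 0 \<and> v = l *\<^sub>R u" using k by (intro exI[of _ "1/k"]) auto
next
  assume "\<exists>l. l \<noteq> 0 \<and> v = l *\<^sub>R u"
  then obtain l where "l \<noteq> 0" "v = l *\<^sub>R u" by blast
  then have "u = (1/l) *\<^sub>R v" by simp
  then show "u \<in> span {v}" by (auto simp: span_singleton)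
qed

lemma translation_translates_iff:
  assumes "geodesic E2 \<sigma>" "v \<noteq> 0"
  shows "(\<exists>l. l \<noteq> 0 \<and> translates (\<lambda>x. x + v) \<sigma> l) \<longleftrightarrow> parallel_to \<sigma> v"
proof -
  obtain p u where u: "u \<bullet> u = 1" "\<sigma> = (\<lambda>t. p + t *\<^sub>R u)" using geodesic_E2_obtain[OF assms(1)] .
  show ?thesis
    unfolding u(2) translates_translation_iff parallel_to_iff unit_in_span_iff[OF u(1) assms(2)] ..
qed

lemma range_line_rescale:
  fixes p u :: "'a::real_vector"
  assumes "l \<noteq> 0"
  shows "range (\<lambda>t. p + a *\<^sub>R u + t *\<^sub>R (l *\<^sub>R u)) = range (\<lambda>t. p + t *\<^sub>R u)"
proof safe
  fix t
  show "p + a *\<^sub>R u + t *\<^sub>R (l *\<^sub>R u) \<in> range (\<lambda>t. p + t *\<^sub>R u)"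
    by (rule range_eqI[of _ _ "a + t * l"]) (simp add: algebra_simps)
  show "p + t *\<^sub>R u \<in> range (\<lambda>t. p + a *\<^sub>R u + t *\<^sub>R (l *\<^sub>R u))"
    by (rule range_eqI[of _ _ "(t - a) / l"])
      (use assms in \<open>simp add: add.assoc flip: scaleR_left_distrib\<close>)
qed

text \<open>
  The translated lines are the parallels to \<open>v\<close>. Each of them meets the line spanned by a transversal \<open>w\<close> in
  exactly one point \<open>c w\<close>, and \<open>c\<close> is the parameter.
\<close>

lemma translated_lines_one_parameter:
  assumes v: "v \<noteq> 0" and w: "w \<notin> span {v}"
  shows "bij_betw (\<lambda>c. range (\<lambda>t. c *\<^sub>R w + t *\<^sub>R v)) (UNIV :: real set)
    {range \<sigma> | \<sigma>. geodesic E2 \<sigma> \<and> (\<exists>l. l \<noteq> 0 \<and> translates (\<lambda>x. x + v) \<sigma> l)}"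
  unfolding bij_betw_def
proof
  let ?L = "\<lambda>c. range (\<lambda>t. c *\<^sub>R w + t *\<^sub>R v)"
  show "inj_on ?L UNIV"
  proof
    fix c c' assume "?L c = ?L c'"
    moreover have "c *\<^sub>R w \<in> ?L c" by (rule range_eqI[of _ _ 0]) simp
    ultimately obtain t where "c *\<^sub>R w = c' *\<^sub>R w + t *\<^sub>R v" by auto
    then have *: "(c - c') *\<^sub>R w = t *\<^sub>R v" by (simp add: algebra_simps)
    show "c = c'"
    proof (rule ccontr)
      assume "c \<noteq> c'"
      then have "w = (1 / (c - c')) *\<^sub>R ((c - c') *\<^sub>R w)" by simp
      then have "w = (t / (c - c')) *\<^sub>R v" unfolding * by simp
      with w show False by (auto simp: span_singleton)
    qed
  qed
  show "range ?L = {range \<sigma> | \<sigma>. geodesic E2 \<sigma> \<and> (\<exists>l. l \<noteq> 0 \<and> translates (\<lambda>x. x + v) \<sigma> l)}" (is "_ = ?R")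
  proof (rule set_eqI, rule iffI)
    fix A assume "A \<in> range ?L"
    then obtain c where c: "A = ?L c" by blast
    define u where "u = (1 / norm v) *\<^sub>R v"
    have u: "norm u = 1" "v = norm v *\<^sub>R u" using v by (auto simp: u_def)
    have "A = range (\<lambda>t. c *\<^sub>R w + t *\<^sub>R u)"
      using range_line_rescale[of "norm v" "c *\<^sub>R w" 0 u] v c u(2) by simp
    moreover have "geodesic E2 (\<lambda>t. c *\<^sub>R w + t *\<^sub>R u)" using geodesic_E2_line u(1) .
    moreover have "translates (\<lambda>x. x + v) (\<lambda>t. c *\<^sub>R w + t *\<^sub>R u) (norm v)"
      using u(2) by (simp add: translates_translation_iff)
    ultimately show "A \<in> ?R" using v by (metis (mono_tags, lifting) mem_Collect_eq norm_eq_zero)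
  next
    fix A assume "A \<in> ?R"
    then obtain \<sigma> l where \<sigma>: "A = range \<sigma>" "geodesic E2 \<sigma>" "l \<noteq> 0" "translates (\<lambda>x. x + v) \<sigma> l" by blast
    obtain p u where u: "u \<bullet> u = 1" "\<sigma> = (\<lambda>t. p + t *\<^sub>R u)" using geodesic_E2_obtain[OF \<sigma>(2)] .
    have vl: "v = l *\<^sub>R u" using \<sigma>(4) u(2) by (simp add: translates_translation_iff)
    have "w \<bullet> rot90 u \<noteq> 0"
    proof
      assume "w \<bullet> rot90 u = 0"
      then have "w = ((w \<bullet> u) / l) *\<^sub>R v" using rot90_expand[OF u(1), of w] \<sigma>(3) vl by simp
      with w show False by (auto simp: span_singleton)
    qed
    define c where "c = (p \<bullet> rot90 u) / (w \<bullet> rot90 u)"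
    have "(c *\<^sub>R w - p) \<bullet> rot90 u = 0" using \<open>w \<bullet> rot90 u \<noteq> 0\<close> by (simp add: c_def inner_diff_left)
    then have "c *\<^sub>R w - p = ((c *\<^sub>R w - p) \<bullet> u) *\<^sub>R u" using rot90_expand[OF u(1), of "c *\<^sub>R w - p"] by simp
    then have "c *\<^sub>R w = p + ((c *\<^sub>R w - p) \<bullet> u) *\<^sub>R u" by (metis add.commute diff_add_cancel)
    then have "A = ?L c"
      using range_line_rescale[OF \<sigma>(3), of p "(c *\<^sub>R w - p) \<bullet> u" u] \<sigma>(1) u(2) vl by simp
    then show "A \<in> range ?L" by blast
  qed
qed

lemma wall_reflection_E2:
  assumes "u \<bullet> u = 1"
  shows "wall_reflection E2 (range (\<lambda>t. q + t *\<^sub>R u)) x = mirror_E2 q u x"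
proof (rule E2.wall_reflection_eq)
  show "wall E2 (range (\<lambda>t. q + t *\<^sub>R u))"
    using assms by (intro wall_range geodesic_E2_line) (simp add: norm_eq_1)
qed (use mirror_E2_isometry[OF assms] mirror_E2_line[OF assms] in auto)

text \<open>Both a reflection and a glide reflection send the direction of a translated line to itself, so
  that line is parallel to the mirror.\<close>

lemma mirror_translates_parallel:
  assumes u: "u \<bullet> u = 1" and w: "w \<bullet> w = 1"
    and tr: "translates (\<lambda>x. mirror_E2 q u x + v) (\<lambda>t. p + t *\<^sub>R w) l"
  shows "w = u \<or> w = - u" "mirror_E2 q u p + v = p + l *\<^sub>R w"
proof -
  have *: "mirror_E2 q u (p + t *\<^sub>R w) + v = p + (t + l) *\<^sub>R w" for t
    using tr by (simp add: translates_def)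
  show "mirror_E2 q u p + v = p + l *\<^sub>R w" using *[of 0] by simp
  have "(2 * (w \<bullet> rot90 u)) *\<^sub>R rot90 u = 0"
    using *[of 0] *[of 1] by (simp add: mirror_E2_def inner_add_left inner_diff_left algebra_simps)
  then have "w \<bullet> rot90 u = 0" using u by (metis inner_zero_left mult_eq_0_iff rot90_inner(3) scaleR_eq_0_iff zero_neq_numeral zero_neq_one)
  then have w': "w = (w \<bullet> u) *\<^sub>R u" using rot90_expand[OF u, of w] by simp
  then have "(w \<bullet> u) * (w \<bullet> u) = 1" using w by (metis inner_scaleR_right)
  then have "w \<bullet> u = 1 \<or> w \<bullet> u = -1" by (simp add: square_eq_1_iff)
  with w' show "w = u \<or> w = - u" by (metis scaleR_minus1_left scaleR_one)
qed

text \<open>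
  A reflection preserves the coordinate along the mirror, while a translation along a line parallel to the
  mirror changes it.
\<close>

lemma reflection_E2_translates_none:
  assumes "geodesic E2 \<tau>" "geodesic E2 \<sigma>" "l > 0"
  shows "\<not> translates (wall_reflection E2 (range \<tau>)) \<sigma> l"
proof
  assume tr: "translates (wall_reflection E2 (range \<tau>)) \<sigma> l"
  obtain q u where u: "u \<bullet> u = 1" "\<tau> = (\<lambda>t. q + t *\<^sub>R u)" using geodesic_E2_obtain[OF assms(1)] .
  obtain p w where w: "w \<bullet> w = 1" "\<sigma> = (\<lambda>t. p + t *\<^sub>R w)" using geodesic_E2_obtain[OF assms(2)] .
  have "translates (\<lambda>x. mirror_E2 q u x + 0) (\<lambda>t. p + t *\<^sub>R w) l"
    using tr unfolding u(2) w(2) translates_def wall_reflection_E2[OF u(1)] by simp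
  note * = mirror_translates_parallel[OF u(1) w(1) this]
  have "(p - q) \<bullet> u + l * (w \<bullet> u) = (p - q) \<bullet> u"
    using arg_cong[OF *(2), of "\<lambda>x. (x - q) \<bullet> u"] mirror_E2_coordinates(1)[OF u(1), of q p]
    by (simp add: inner_diff_left inner_add_left)
  then show False using *(1) u(1) assms(3) by auto
qed

text \<open>
  A translated line is parallel to the mirror, and the glide reflection exchanges the two sides of the
  mirror, so the line can only be the mirror itself.
\<close>

lemma glide_reflection_translates_iff:
  assumes "geodesic E2 \<tau>" "v \<noteq> 0" "parallel_to \<tau> v" "geodesic E2 \<sigma>"
  shows "(\<exists>l. l \<noteq> 0 \<and> translates (\<lambda>x. wall_reflection E2 (range \<tau>) x + v) \<sigma> l) \<longleftrightarrow> range \<sigma> = range \<tau>"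
proof -
  obtain q u where u: "u \<bullet> u = 1" "\<tau> = (\<lambda>t. q + t *\<^sub>R u)" using geodesic_E2_obtain[OF assms(1)] .
  obtain p w where w: "w \<bullet> w = 1" "\<sigma> = (\<lambda>t. p + t *\<^sub>R w)" using geodesic_E2_obtain[OF assms(4)] .
  obtain k where k: "k \<noteq> 0" "v = k *\<^sub>R u"
    using assms(3) unfolding u(2) parallel_to_iff unit_in_span_iff[OF u(1) assms(2)] by blast
  show ?thesis
    unfolding u(2) w(2) wall_reflection_E2[OF u(1)]
  proof
    assume "\<exists>l. l \<noteq> 0 \<and> translates (\<lambda>x. mirror_E2 q u x + v) (\<lambda>t. p + t *\<^sub>R w) l"
    then obtain l where "l \<noteq> 0" and "translates (\<lambda>x. mirror_E2 q u x + v) (\<lambda>t. p + t *\<^sub>R w) l" by blast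
    note * = mirror_translates_parallel[OF u(1) w(1) this(2)]
    have "w \<bullet> rot90 u = 0" using *(1) by auto
    then have "(p - q) \<bullet> rot90 u = 0"
      using arg_cong[OF *(2), of "\<lambda>x. (x - q) \<bullet> rot90 u"] mirror_E2_coordinates(2)[OF u(1), of q p] k(2)
      by (simp add: inner_diff_left inner_add_left)
    then have "p - q = ((p - q) \<bullet> u) *\<^sub>R u" using rot90_expand[OF u(1), of "p - q"] by simp
    then obtain a where a: "p = q + a *\<^sub>R u" by (metis add.commute diff_add_cancel)
    obtain e where e: "e \<noteq> 0" "w = e *\<^sub>R u"
      using *(1) by (metis scaleR_minus1_left scaleR_one zero_neq_neg_one zero_neq_one)
    show "range (\<lambda>t. p + t *\<^sub>R w) = range (\<lambda>t. q + t *\<^sub>R u)"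
      unfolding a e(2) by (rule range_line_rescale[OF e(1)])
  next
    assume eq: "range (\<lambda>t. p + t *\<^sub>R w) = range (\<lambda>t. q + t *\<^sub>R u)"
    have "p + 0 *\<^sub>R w \<in> range (\<lambda>t. p + t *\<^sub>R w)" "p + 1 *\<^sub>R w \<in> range (\<lambda>t. p + t *\<^sub>R w)" by blast+
    then obtain a b where ab: "p = q + a *\<^sub>R u" "p + w = q + b *\<^sub>R u" unfolding eq scaleR_zero_left scaleR_one add_0_right by blast
    have w': "w = (b - a) *\<^sub>R u"
      using ab by (metis add_diff_cancel_left add_diff_cancel_left' scaleR_left_diff_distrib)
    then have "(b - a) * (b - a) = 1" using w u by simp
    then have "u = (b - a) *\<^sub>R w" using w' by simp
    then have vw: "v = (k * (b - a)) *\<^sub>R w" using k(2) by (metis scaleR_scaleR)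
    have "mirror_E2 q u (p + t *\<^sub>R w) = p + t *\<^sub>R w" for t
    proof -
      have "p + t *\<^sub>R w \<in> range (\<lambda>t. q + t *\<^sub>R u)" unfolding eq[symmetric] by blast
      then show ?thesis using mirror_E2_line[OF u(1)] by auto
    qed
    then have "translates (\<lambda>x. mirror_E2 q u x + v) (\<lambda>t. p + t *\<^sub>R w) (k * (b - a))"
      unfolding translates_def vw by (simp add: scaleR_left_distrib add.assoc)
    moreover have "k * (b - a) \<noteq> 0" using k(1) \<open>(b - a) * (b - a) = 1\<close> by auto
    ultimately show "\<exists>l. l \<noteq> 0 \<and> translates (\<lambda>x. mirror_E2 q u x + v) (\<lambda>t. p + t *\<^sub>R w) l" by blast
  qed
qed

text \<open>
  The linear part of the rotation must fix the direction of the line, so the rotation is the identity.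
\<close>

lemma rotation_translates_none:
  assumes "geodesic E2 \<sigma>" "l > 0"
  shows "\<not> translates (rotation_about c \<theta>) \<sigma> l"
proof
  assume tr: "translates (rotation_about c \<theta>) \<sigma> l"
  obtain p u where u: "u \<bullet> u = 1" "\<sigma> = (\<lambda>t. p + t *\<^sub>R u)" using geodesic_E2_obtain[OF assms(1)] .
  have uu: "u$1 * u$1 + u$2 * u$2 = 1" using u(1) by (simp add: inner_vec_def sum_2)
  have *: "rotation_about c \<theta> (p + t *\<^sub>R u) = p + (t + l) *\<^sub>R u" for t
    using tr by (simp add: translates_def u(2))
  let ?c = "cos \<theta>" and ?s = "sin \<theta>"
  have 1: "c$1 + (?c * (p$1 + t * u$1 - c$1) - ?s * (p$2 + t * u$2 - c$2)) = p$1 + (t + l) * u$1"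
    "c$2 + (?s * (p$1 + t * u$1 - c$1) + ?c * (p$2 + t * u$2 - c$2)) = p$2 + (t + l) * u$2" for t
    using *[of t] by (simp_all add: rotation_about_def vec_eq_iff forall_2)
  have Au: "?c * u$1 - ?s * u$2 = u$1" "?s * u$1 + ?c * u$2 = u$2"
    using 1[of 0] 1[of 1] by (simp_all add: algebra_simps)
  have "?c = u$1 * (?c * u$1 - ?s * u$2) + u$2 * (?s * u$1 + ?c * u$2)"
    "?s = u$1 * (?s * u$1 + ?c * u$2) - u$2 * (?c * u$1 - ?s * u$2)" using uu by algebra+
  then have cs: "?c = 1" "?s = 0" unfolding Au using uu by simp_all
  then have "l * u$1 = 0" "l * u$2 = 0" using 1[of 0] by simp_all
  then show False using assms(2) uu by auto
qed

section \<open>The sphere and the hyperboloid\<close>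

definition form :: "real \<Rightarrow> real^3 \<Rightarrow> real^3 \<Rightarrow> real" where
  "form \<kappa> x y = x $ 1 * y $ 1 + x $ 2 * y $ 2 + \<kappa> * (x $ 3 * y $ 3)"

lemma form_linear:
  "form \<kappa> (x + y) z = form \<kappa> x z + form \<kappa> y z" "form \<kappa> z (x + y) = form \<kappa> z x + form \<kappa> z y"
  "form \<kappa> (x - y) z = form \<kappa> x z - form \<kappa> y z" "form \<kappa> z (x - y) = form \<kappa> z x - form \<kappa> z y"
  "form \<kappa> (a *\<^sub>R x) z = a * form \<kappa> x z" "form \<kappa> z (a *\<^sub>R x) = a * form \<kappa> z x"
  "form \<kappa> (- x) z = - form \<kappa> x z" "form \<kappa> z (- x) = - form \<kappa> z x"
  "form \<kappa> 0 z = 0" "form \<kappa> z 0 = 0"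
  by (simp_all add: form_def algebra_simps)

lemma form_commute: "form \<kappa> x y = form \<kappa> y x"
  by (simp add: form_def mult.commute)

text \<open>The vector product adapted to the form: its product with \<open>x\<close> is the determinant of \<open>p\<close>, \<open>v\<close>, \<open>x\<close>.\<close>

definition form_cross :: "real \<Rightarrow> real^3 \<Rightarrow> real^3 \<Rightarrow> real^3" where
  "form_cross \<kappa> p v = vector [p$2 * v$3 - p$3 * v$2, p$3 * v$1 - p$1 * v$3, \<kappa> * (p$1 * v$2 - p$2 * v$1)]"

definition frame :: "real \<Rightarrow> real^3 \<Rightarrow> real^3 \<Rightarrow> real^3 \<Rightarrow> bool" where
  "frame \<kappa> p v n \<longleftrightarrow> form \<kappa> p p = \<kappa> \<and> form \<kappa> v v = 1 \<and> form \<kappa> n n = 1 \<and>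
     form \<kappa> p v = 0 \<and> form \<kappa> p n = 0 \<and> form \<kappa> v n = 0"

lemma frame_form_cross:
  assumes "\<kappa> = 1 \<or> \<kappa> = - 1" "form \<kappa> p p = \<kappa>" "form \<kappa> v v = 1" "form \<kappa> p v = 0"
  shows "frame \<kappa> p v (form_cross \<kappa> p v)"
proof -
  have \<kappa>2: "\<kappa> * \<kappa> = 1" using assms(1) by auto
  moreover have "form \<kappa> (form_cross \<kappa> p v) (form_cross \<kappa> p v) =
      \<kappa> * (form \<kappa> p p * form \<kappa> v v - form \<kappa> p v * form \<kappa> p v)"
    using \<kappa>2 unfolding form_def form_cross_def vector_3 by algebra
  moreover have "form \<kappa> p (form_cross \<kappa> p v) = 0" "form \<kappa> v (form_cross \<kappa> p v) = 0"
    using \<kappa>2 unfolding form_def form_cross_def vector_3 by algebra+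
  ultimately show ?thesis using assms by (simp add: frame_def)
qed

text \<open>The Gram determinant of a frame is \<open>\<kappa>\<close> times the square of its determinant, so the
  latter is not zero and Cramer's rule applies.\<close>

lemma frame_complete:
  assumes \<kappa>: "\<kappa> = 1 \<or> \<kappa> = - 1" and "frame \<kappa> p v n"
    and "form \<kappa> w p = 0" "form \<kappa> w v = 0" "form \<kappa> w n = 0"
  shows "w = 0"
proof -
  let ?D = "p$1 * (v$2 * n$3 - v$3 * n$2) - p$2 * (v$1 * n$3 - v$3 * n$1) + p$3 * (v$1 * n$2 - v$2 * n$1)"
  have "form \<kappa> p p * form \<kappa> v v * form \<kappa> n n + 2 * form \<kappa> p v * form \<kappa> v n * form \<kappa> p n
      - form \<kappa> p p * (form \<kappa> v n)\<^sup>2 - form \<kappa> v v * (form \<kappa> p n)\<^sup>2 - form \<kappa> n n * (form \<kappa> p v)\<^sup>2 = \<kappa> * ?D\<^sup>2"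
    by (simp add: form_def) algebra
  then have "?D \<noteq> 0" using assms(1,2) by (auto simp: frame_def)
  moreover have "w$1 * ?D = 0" "w$2 * ?D = 0" "w$3 * \<kappa> * ?D = 0"
    using assms(3-5) unfolding form_def by algebra+
  ultimately have "w$1 = 0" "w$2 = 0" "w$3 = 0" using \<kappa> by auto
  then show ?thesis by (simp add: vec_eq_iff forall_3)
qed

lemma frame_expand:
  assumes \<kappa>: "\<kappa> = 1 \<or> \<kappa> = - 1" and fr: "frame \<kappa> p v n"
  shows "x = (\<kappa> * form \<kappa> x p) *\<^sub>R p + form \<kappa> x v *\<^sub>R v + form \<kappa> x n *\<^sub>R n"
proof -
  have "\<kappa> * \<kappa> = 1" using \<kappa> by auto
  then have "x - ((\<kappa> * form \<kappa> x p) *\<^sub>R p + form \<kappa> x v *\<^sub>R v + form \<kappa> x n *\<^sub>R n) = 0"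
    using fr by (intro frame_complete[OF \<kappa> fr])
      (simp_all add: frame_def form_linear form_commute[of \<kappa> v p] form_commute[of \<kappa> n p] form_commute[of \<kappa> n v])
  then show ?thesis by simp
qed

lemma frame_form:
  assumes \<kappa>: "\<kappa> = 1 \<or> \<kappa> = - 1" and fr: "frame \<kappa> p v n"
  shows "form \<kappa> x y = \<kappa> * (form \<kappa> x p * form \<kappa> y p) + form \<kappa> x v * form \<kappa> y v + form \<kappa> x n * form \<kappa> y n"
  using arg_cong[OF frame_expand[OF \<kappa> fr, of x], of "\<lambda>z. form \<kappa> z y"]
  by (simp add: form_linear form_commute[of \<kappa> _ y])

lemma frame_orthogonal:
  assumes "frame \<kappa> p v n"
  shows "form \<kappa> p v = 0" "form \<kappa> v p = 0" "form \<kappa> p n = 0" "form \<kappa> n p = 0" "form \<kappa> v n = 0" "form \<kappa> n v = 0"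
  using assms form_commute[of \<kappa> v p] form_commute[of \<kappa> n p] form_commute[of \<kappa> n v]
  by (auto simp: frame_def)

text \<open>
  \<open>M\<close> is the whole sphere for \<open>\<kappa> = 1\<close> and one of the two sheets of a hyperboloid for \<open>\<kappa> = - 1\<close>; on a
  sheet the products of two points are negative, which is how membership in the sheet is detected.
\<close>

locale quadric = curvature_trig \<kappa> C S
  for \<kappa> :: real and C S :: "real \<Rightarrow> real" +
  fixes M :: "(real^3) metric"
  assumes \<kappa>: "\<kappa> = 1 \<or> \<kappa> = - 1"
    and C_diff: "C (s - t) = C s * C t + \<kappa> * (S s * S t)"
    and S_diff: "S (s - t) = S s * C t - C s * S t"
    and C_pos: "\<kappa> = - 1 \<Longrightarrow> C t > 0"
    and form_self: "x \<in> mspace M \<Longrightarrow> form \<kappa> x x = \<kappa>"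
    and form_neg: "\<kappa> = - 1 \<Longrightarrow> x \<in> mspace M \<Longrightarrow> y \<in> mspace M \<Longrightarrow> form \<kappa> x y < 0"
    and mem: "p \<in> mspace M \<Longrightarrow> form \<kappa> z z = \<kappa> \<Longrightarrow> \<kappa> = 1 \<or> form \<kappa> p z < 0 \<Longrightarrow> z \<in> mspace M"
    and definite: "p \<in> mspace M \<Longrightarrow> form \<kappa> w p = 0 \<Longrightarrow> form \<kappa> w w = 0 \<Longrightarrow> w = 0"
    and C_mdist: "x \<in> mspace M \<Longrightarrow> y \<in> mspace M \<Longrightarrow> C (mdist M x y) = \<kappa> * form \<kappa> x y"
    and mdist_eqI: "x \<in> mspace M \<Longrightarrow> y \<in> mspace M \<Longrightarrow> \<kappa> * form \<kappa> x y = C d \<Longrightarrow> 0 \<le> d \<Longrightarrow> d < 2 \<Longrightarrow>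
      mdist M x y = d"
    and mdist_cong: "form \<kappa> x y = form \<kappa> x' y' \<Longrightarrow> mdist M x y = mdist M x' y'"
begin

definition T :: "real^3 \<Rightarrow> (real^3) set" where
  "T p = {v. form \<kappa> p v = 0 \<and> form \<kappa> v v = 1}"

lemma \<kappa>2: "\<kappa> * \<kappa> = 1" "\<kappa> * (\<kappa> * a) = a"
  using \<kappa> by auto

lemma C_minus: "C (- t) = C t" and S_minus: "S (- t) = - S t"
  using C_diff[of 0 t] S_diff[of 0 t] by (simp_all add: C_0 S_0)

lemma C_abs: "C \<bar>t\<bar> = C t"
  by (simp add: abs_if C_minus)

lemma form_mdist: "x \<in> mspace M \<Longrightarrow> y \<in> mspace M \<Longrightarrow> form \<kappa> x y = \<kappa> * C (mdist M x y)"
  using C_mdist[of x y] \<kappa>2 by simp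

lemma mdist_eq_iff:
  assumes "x \<in> mspace M" "y \<in> mspace M" "x' \<in> mspace M" "y' \<in> mspace M"
  shows "mdist M x y = mdist M x' y' \<longleftrightarrow> form \<kappa> x y = form \<kappa> x' y'"
  using form_mdist assms mdist_cong by metis

lemma form_arc:
  assumes "p \<in> mspace M" "v \<in> T p"
  shows "form \<kappa> (C s *\<^sub>R p + S s *\<^sub>R v) (C t *\<^sub>R p + S t *\<^sub>R v) = \<kappa> * C (s - t)"
  using assms by (simp add: T_def form_linear form_self form_commute[of \<kappa> v p] C_diff \<kappa>2 algebra_simps)

lemma arc_mem:
  assumes "p \<in> mspace M" "v \<in> T p"
  shows "C t *\<^sub>R p + S t *\<^sub>R v \<in> mspace M"
proof (rule mem[OF assms(1)])
  show "form \<kappa> (C t *\<^sub>R p + S t *\<^sub>R v) (C t *\<^sub>R p + S t *\<^sub>R v) = \<kappa>"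
    using form_arc[OF assms, of t t] by (simp add: C_0)
  show "\<kappa> = 1 \<or> form \<kappa> p (C t *\<^sub>R p + S t *\<^sub>R v) < 0"
    using form_arc[OF assms, of 0 t] \<kappa> C_pos[of "-t"] by (auto simp: C_0 S_0)
qed

lemma mdist_arc:
  assumes "p \<in> mspace M" "v \<in> T p" "\<bar>s - t\<bar> < 2"
  shows "mdist M (C s *\<^sub>R p + S s *\<^sub>R v) (C t *\<^sub>R p + S t *\<^sub>R v) = \<bar>s - t\<bar>"
  using assms by (intro mdist_eqI arc_mem) (simp_all add: form_arc \<kappa>2 C_abs)

text \<open>A point at the distances \<open>t - s\<close> and \<open>t - u\<close> from the points with parameters \<open>s\<close> and \<open>u\<close> of a
  geodesic is the point with parameter \<open>t\<close>: its products with \<open>p\<close> and \<open>v\<close> are the expected ones, so the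
  difference of the two points is a null vector orthogonal to \<open>p\<close>.\<close>

lemma arc_eqI:
  assumes "p \<in> mspace M" "v \<in> T p" "form \<kappa> z z = \<kappa>" "S (u - s) \<noteq> 0"
    "form \<kappa> z (C s *\<^sub>R p + S s *\<^sub>R v) = \<kappa> * C (t - s)"
    "form \<kappa> z (C u *\<^sub>R p + S u *\<^sub>R v) = \<kappa> * C (t - u)"
  shows "z = C t *\<^sub>R p + S t *\<^sub>R v"
proof -
  define a b where "a = form \<kappa> z p - \<kappa> * C t" and "b = form \<kappa> z v - S t"
  have "C s * a + S s * b = 0" "C u * a + S u * b = 0"
    using assms(5,6) \<kappa>2 by (simp_all add: a_def b_def form_linear C_diff algebra_simps)
  then have "S (u - s) * a = 0" "S (u - s) * b = 0"
    unfolding S_diff by algebra+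
  then have ab: "form \<kappa> z p = \<kappa> * C t" "form \<kappa> z v = S t"
    using assms(4) by (auto simp: a_def b_def)
  have fa: "form \<kappa> (C t *\<^sub>R p + S t *\<^sub>R v) (C t *\<^sub>R p + S t *\<^sub>R v) = \<kappa>"
    using form_arc[OF assms(1,2), of t t] by (simp add: C_0)
  have "form \<kappa> z (C t *\<^sub>R p + S t *\<^sub>R v) = \<kappa> * (C t * C t + \<kappa> * (S t * S t))"
    using ab \<kappa>2 by (simp add: form_linear algebra_simps)
  then have "form \<kappa> z (C t *\<^sub>R p + S t *\<^sub>R v) = \<kappa>" by (simp add: C_S)
  then have "form \<kappa> (z - (C t *\<^sub>R p + S t *\<^sub>R v)) (z - (C t *\<^sub>R p + S t *\<^sub>R v)) = 0"
    using fa assms(3) form_commute[of \<kappa> "C t *\<^sub>R p + S t *\<^sub>R v" z] by (simp only: form_linear(3,4))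
  moreover have "form \<kappa> (z - (C t *\<^sub>R p + S t *\<^sub>R v)) p = 0"
    using ab(1) assms(1,2) by (simp add: form_linear form_self form_commute[of \<kappa> v p] T_def)
  ultimately have "z - (C t *\<^sub>R p + S t *\<^sub>R v) = 0" by (intro definite[OF assms(1)])
  then show ?thesis by (simp only: right_minus_eq)
qed

lemma geodesic_arc:
  assumes "p \<in> mspace M" "v \<in> T p"
  shows "geodesic M (\<lambda>t. C t *\<^sub>R p + S t *\<^sub>R v)"
  unfolding geodesic_def
proof (intro conjI allI exI[of _ 1] ballI)
  fix t s u :: real assume "s \<in> ball t 1" "u \<in> ball t 1"
  then show "mdist M (C s *\<^sub>R p + S s *\<^sub>R v) (C u *\<^sub>R p + S u *\<^sub>R v) = \<bar>s - u\<bar>"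
    using assms by (intro mdist_arc) (auto simp: dist_real_def)
qed (use arc_mem[OF assms] in auto)

text \<open>
  Two nearby points of the geodesic determine the vector \<open>v\<close>, and the distances from them determine all
  other nearby points.
\<close>

lemma geodesic_locally_arc:
  assumes \<sigma>: "geodesic M \<sigma>"
  shows "\<exists>\<epsilon>>0. \<exists>v\<in>T (\<sigma> t). \<forall>s. \<bar>s\<bar> < \<epsilon> \<longrightarrow> \<sigma> (t + s) = C s *\<^sub>R \<sigma> t + S s *\<^sub>R v"
proof -
  obtain \<epsilon> where \<epsilon>: "\<epsilon> > 0" "\<And>s u. s \<in> ball t \<epsilon> \<Longrightarrow> u \<in> ball t \<epsilon> \<Longrightarrow> mdist M (\<sigma> s) (\<sigma> u) = \<bar>s - u\<bar>"
    using \<sigma> unfolding geodesic_def by metis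
  note M = geodesic_mem[OF \<sigma>]
  have form: "form \<kappa> (\<sigma> s) (\<sigma> u) = \<kappa> * C (s - u)" if "s \<in> ball t \<epsilon>" "u \<in> ball t \<epsilon>" for s u
    using form_mdist[OF M M] \<epsilon>(2)[OF that] C_abs by metis
  define d where "d = min (\<epsilon> / 2) 1"
  have d: "0 < d" "d < 2" "t \<in> ball t \<epsilon>" "t + d \<in> ball t \<epsilon>"
    using \<epsilon>(1) by (auto simp: d_def dist_real_def)
  have Sd: "S d > 0" using S_pos d(1,2) .
  define v where "v = (1 / S d) *\<^sub>R (\<sigma> (t + d) - C d *\<^sub>R \<sigma> t)"
  have q: "\<sigma> (t + d) = C d *\<^sub>R \<sigma> t + S d *\<^sub>R v" using Sd by (simp add: v_def)
  have pp: "form \<kappa> (\<sigma> t) (\<sigma> t) = \<kappa>" "form \<kappa> (\<sigma> (t + d)) (\<sigma> (t + d)) = \<kappa>" using form_self M by auto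
  have pq: "form \<kappa> (\<sigma> t) (\<sigma> (t + d)) = \<kappa> * C d" using form[OF d(3,4)] by (simp add: C_minus)
  have pv: "form \<kappa> (\<sigma> t) v = 0" using pp pq by (simp add: v_def form_linear)
  have "form \<kappa> (\<sigma> (t + d)) (\<sigma> (t + d)) = C d * C d * \<kappa> + S d * S d * form \<kappa> v v"
    unfolding q using pv pp(1) by (simp add: form_linear form_commute[of \<kappa> v "\<sigma> t"])
  then have "S d * S d * form \<kappa> v v = \<kappa> * (1 - C d * C d)" using pp(2) by (simp add: algebra_simps)
  also have "\<dots> = S d * S d" using C_S[of d] \<kappa>2 by (metis add_diff_cancel_left')
  finally have v: "v \<in> T (\<sigma> t)" using Sd pv by (simp add: T_def)
  have "\<sigma> (t + s) = C s *\<^sub>R \<sigma> t + S s *\<^sub>R v" if "\<bar>s\<bar> < \<epsilon>" for s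
  proof (rule arc_eqI[OF M v, where s = 0 and u = d])
    have ts: "t + s \<in> ball t \<epsilon>" using that by (simp add: dist_real_def)
    show "form \<kappa> (\<sigma> (t + s)) (C 0 *\<^sub>R \<sigma> t + S 0 *\<^sub>R v) = \<kappa> * C (s - 0)"
      using form[OF ts d(3)] by (simp add: C_0 S_0)
    show "form \<kappa> (\<sigma> (t + s)) (C d *\<^sub>R \<sigma> t + S d *\<^sub>R v) = \<kappa> * C (s - d)"
      using form[OF ts d(4)] q by simp
  qed (use Sd form_self M in auto)
  with \<epsilon>(1) v show ?thesis by blast
qed

end

sublocale quadric \<subseteq> geodesics_by_initial_data \<kappa> C S M T
  by standard (use geodesic_arc geodesic_locally_arc in auto)

context quadric
begin

lemma form_geo: "p \<in> mspace M \<Longrightarrow> v \<in> T p \<Longrightarrow> form \<kappa> (geo p v s) (geo p v t) = \<kappa> * C (s - t)"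
  unfolding geo_def by (rule form_arc)

lemma geo_mem: "p \<in> mspace M \<Longrightarrow> v \<in> T p \<Longrightarrow> geo p v t \<in> mspace M"
  unfolding geo_def by (rule arc_mem)

lemma geo_eqI:
  assumes "p \<in> mspace M" "v \<in> T p" "form \<kappa> z z = \<kappa>" "S (u - s) \<noteq> 0"
    "form \<kappa> z (geo p v s) = \<kappa> * C (t - s)" "form \<kappa> z (geo p v u) = \<kappa> * C (t - u)"
  shows "z = geo p v t"
  using arc_eqI[OF assms[unfolded geo_def]] by (simp add: geo_def)

lemma geodesic_geoI: "p \<in> mspace M \<Longrightarrow> v \<in> T p \<Longrightarrow> geodesic M (geo p v)"
  using geodesic_iff_geo by blast

lemma geodesic_obtain:
  assumes "geodesic M \<sigma>"
  obtains p v where "p \<in> mspace M" "v \<in> T p" "\<sigma> = geo p v"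
  using geodesic_iff_geo assms by blast

lemma frame_normal:
  assumes "p \<in> mspace M" "v \<in> T p"
  obtains n where "frame \<kappa> p v n"
  using frame_form_cross[OF \<kappa> form_self[OF assms(1)], of v] assms(2) by (auto simp: T_def)

lemma frame_geo_normal:
  assumes "frame \<kappa> p v n"
  shows "form \<kappa> (geo p v t) n = 0" "form \<kappa> n (geo p v t) = 0"
  using frame_orthogonal[OF assms] by (simp_all add: geo_def form_linear)

lemma geodesic_agree:
  assumes "geodesic M \<sigma>" "geodesic M \<tau>" "\<sigma> s = \<tau> s" "\<sigma> u = \<tau> u" "S (u - s) \<noteq> 0"
  shows "\<sigma> = \<tau>"
proof
  fix t
  obtain p v where p: "p \<in> mspace M" "v \<in> T p" "\<sigma> = geo p v" using geodesic_obtain[OF assms(1)] .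
  obtain q w where q: "q \<in> mspace M" "w \<in> T q" "\<tau> = geo q w" using geodesic_obtain[OF assms(2)] .
  \<comment> \<open>At the parameters where the two geodesics agree, the distances along the first one are those along the second.\<close>
  have "form \<kappa> (geo p v t) (geo q w r) = \<kappa> * C (t - r)" if "geo p v r = geo q w r" for r
    using form_geo[OF p(1,2), of t r] that by simp
  then have "geo p v t = geo q w t"
    using assms(3-5) p q by (intro geo_eqI[OF q(1,2) _ assms(5)] form_self geo_mem) auto
  then show "\<sigma> t = \<tau> t" using p q by simp
qed

subsection \<open>Mirrors\<close>

text \<open>The reflection, orthogonal for the form, in the plane through the origin with unit normal \<open>n\<close>.\<close>

definition mirror :: "real^3 \<Rightarrow> real^3 \<Rightarrow> real^3" where
  "mirror n x = x - (2 * form \<kappa> x n) *\<^sub>R n"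

lemma form_mirror:
  assumes "form \<kappa> n n = 1"
  shows "form \<kappa> (mirror n x) (mirror n y) = form \<kappa> x y"
    "form \<kappa> (mirror n x) n = - form \<kappa> x n"
    "form \<kappa> n q = 0 \<Longrightarrow> form \<kappa> (mirror n x) q = form \<kappa> x q"
  using assms by (simp_all add: mirror_def form_linear form_commute[of \<kappa> n y] algebra_simps)

lemma mirror_mirror: "form \<kappa> n n = 1 \<Longrightarrow> mirror n (mirror n x) = x"
  using form_mirror(2)[of n x] by (simp add: mirror_def[of n "mirror n x"]) (simp add: mirror_def)

lemma mirror_fix: "form \<kappa> x n = 0 \<Longrightarrow> mirror n x = x"
  by (simp add: mirror_def)

lemma mirror_isometry:
  assumes q: "q \<in> mspace M" and fr: "frame \<kappa> q u n"
  shows "isometry M (mirror n)" "\<not> is_identity M (mirror n)"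
proof -
  have n: "form \<kappa> n n = 1" "form \<kappa> n q = 0" using fr frame_orthogonal[OF fr] by (auto simp: frame_def)
  have mem': "mirror n x \<in> mspace M" if "x \<in> mspace M" for x
  proof (rule mem[OF q])
    show "form \<kappa> (mirror n x) (mirror n x) = \<kappa>" using form_mirror(1)[OF n(1)] form_self that by simp
    show "\<kappa> = 1 \<or> form \<kappa> q (mirror n x) < 0"
      using form_mirror(3)[OF n, of x] form_neg[OF _ that q] \<kappa> form_commute[of \<kappa> q] by auto
  qed
  show "isometry M (mirror n)"
    by (rule isometry_if_involution)
      (use mem' mirror_mirror[OF n(1)] mdist_eq_iff form_mirror(1)[OF n(1)] in auto)
  \<comment> \<open>The point at distance \<open>1\<close> from \<open>q\<close> in the direction of the normal is off the mirror, hence moved.\<close>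
  have nT: "n \<in> T q" using fr by (simp add: T_def frame_def)
  have "S 1 > 0" using S_pos by simp
  then have "form \<kappa> (geo q n 1) n \<noteq> 0" using n nT by (simp add: geo_def form_linear T_def)
  moreover have "n \<noteq> 0" using n(1) by (auto simp: form_linear)
  ultimately have "mirror n (geo q n 1) \<noteq> geo q n 1" by (simp add: mirror_def)
  then show "\<not> is_identity M (mirror n)" using geo_mem[OF q nT] by (auto simp: is_identity_def)
qed

text \<open>
  The two distances determine the coordinates of \<open>z\<close> in the plane of the geodesic; the remaining coordinate
  is determined up to sign by \<open>\<langle>z, z\<rangle> = \<kappa>\<close>.
\<close>

lemma mirror_or_fixed:
  assumes q: "q \<in> mspace M" and fr: "frame \<kappa> q u n" and yz: "y \<in> mspace M" "z \<in> mspace M"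
    and S: "S (s' - s) \<noteq> 0"
    and eq: "form \<kappa> z (geo q u s) = form \<kappa> y (geo q u s)" "form \<kappa> z (geo q u s') = form \<kappa> y (geo q u s')"
  shows "z = y \<or> z = mirror n y"
proof -
  have n: "form \<kappa> n n = 1" "form \<kappa> n q = 0" "form \<kappa> n u = 0"
    using fr frame_orthogonal[OF fr] by (auto simp: frame_def)
  have "C s * (form \<kappa> z q - form \<kappa> y q) + S s * (form \<kappa> z u - form \<kappa> y u) = 0"
    "C s' * (form \<kappa> z q - form \<kappa> y q) + S s' * (form \<kappa> z u - form \<kappa> y u) = 0"
    using eq by (simp_all add: geo_def form_linear algebra_simps)
  then have "S (s' - s) * (form \<kappa> z q - form \<kappa> y q) = 0" "S (s' - s) * (form \<kappa> z u - form \<kappa> y u) = 0"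
    unfolding S_diff by algebra+
  then have zq: "form \<kappa> z q = form \<kappa> y q" "form \<kappa> z u = form \<kappa> y u" using S by auto
  have "(form \<kappa> z n)\<^sup>2 = (form \<kappa> y n)\<^sup>2"
    using frame_form[OF \<kappa> fr, of z z] frame_form[OF \<kappa> fr, of y y] form_self yz zq
    by (simp add: power2_eq_square)
  then have "form \<kappa> z n = form \<kappa> y n \<or> form \<kappa> z n = form \<kappa> (mirror n y) n"
    by (simp add: power2_eq_iff form_mirror(2)[OF n(1)])
  moreover have "form \<kappa> (mirror n y) q = form \<kappa> y q" "form \<kappa> (mirror n y) u = form \<kappa> y u"
    using form_mirror(3)[OF n(1)] n by auto
  ultimately show ?thesis
    using frame_expand[OF \<kappa> fr, of z] frame_expand[OF \<kappa> fr, of y] frame_expand[OF \<kappa> fr, of "mirror n y"] zq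
    by metis
qed

end

sublocale quadric \<subseteq> constant_curvature_plane \<kappa> C S M T
proof
  fix p v assume p: "p \<in> mspace M" and v: "v \<in> T p"
  obtain w where fr: "frame \<kappa> p v w" using frame_normal[OF p v] .
  have w: "form \<kappa> v v = 1" "form \<kappa> w w = 1" "form \<kappa> p v = 0" "form \<kappa> p w = 0" "form \<kappa> v w = 0" "form \<kappa> w v = 0"
    using fr form_commute by (auto simp: frame_def)
  have "cos \<theta> *\<^sub>R v + sin \<theta> *\<^sub>R w \<in> T p" for \<theta>
    using w by (simp add: T_def form_linear flip: power2_eq_square)
  moreover have "a = 0 \<and> b = 0" if "a *\<^sub>R v + b *\<^sub>R w = 0" for a b
    using arg_cong[OF that, of "form \<kappa> v"] arg_cong[OF that, of "form \<kappa> w"] w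
    by (simp add: form_linear)
  moreover have "\<exists>A b c. (A \<noteq> 0 \<or> b \<noteq> 0 \<or> c \<noteq> 0) \<and>
     (\<forall>\<theta> t. geo p (cos \<theta> *\<^sub>R v + sin \<theta> *\<^sub>R w) t \<in> range \<tau> \<longrightarrow>
        C t * A + S t * (cos \<theta> * b + sin \<theta> * c) = 0)" if \<tau>: "geodesic M \<tau>" for \<tau>
  proof -
    obtain q u where q: "q \<in> mspace M" "u \<in> T q" "\<tau> = geo q u" using geodesic_obtain[OF \<tau>] .
    obtain n where n: "frame \<kappa> q u n" using frame_normal[OF q(1,2)] .
    have "n \<noteq> 0" using n by (auto simp: frame_def form_linear)
    then have "form \<kappa> n p \<noteq> 0 \<or> form \<kappa> n v \<noteq> 0 \<or> form \<kappa> n w \<noteq> 0"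
      using frame_complete[OF \<kappa> fr] by blast
    moreover have "C t * form \<kappa> n p + S t * (cos \<theta> * form \<kappa> n v + sin \<theta> * form \<kappa> n w) = 0"
      if "geo p (cos \<theta> *\<^sub>R v + sin \<theta> *\<^sub>R w) t \<in> range \<tau>" for \<theta> t
    proof -
      have "form \<kappa> n (geo p (cos \<theta> *\<^sub>R v + sin \<theta> *\<^sub>R w) t) = 0"
        using that frame_geo_normal(2)[OF n] q(3) by auto
      then show ?thesis by (simp add: geo_def form_linear)
    qed
    ultimately show ?thesis by blast
  qed
  ultimately show "\<exists>w. (\<forall>\<theta>. cos \<theta> *\<^sub>R v + sin \<theta> *\<^sub>R w \<in> T p) \<and>
          (\<forall>a b. a *\<^sub>R v + b *\<^sub>R w = 0 \<longrightarrow> a = 0 \<and> b = 0) \<and>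
          (\<forall>\<tau>. geodesic M \<tau> \<longrightarrow>
             (\<exists>A b c. (A \<noteq> 0 \<or> b \<noteq> 0 \<or> c \<noteq> 0) \<and>
                (\<forall>\<theta> t. geo p (cos \<theta> *\<^sub>R v + sin \<theta> *\<^sub>R w) t \<in> range \<tau> \<longrightarrow>
                   C t * A + S t * (cos \<theta> * b + sin \<theta> * c) = 0)))" by blast
next
  fix \<tau> assume \<tau>: "geodesic M \<tau>"
  obtain q u where q: "q \<in> mspace M" "u \<in> T q" "\<tau> = geo q u" using geodesic_obtain[OF \<tau>] .
  obtain n where fr: "frame \<kappa> q u n" using frame_normal[OF q(1,2)] .
  have nn: "form \<kappa> n n = 1" using fr by (simp add: frame_def)
  note iso = mirror_isometry[OF q(1) fr]
  have "z = y \<or> z = mirror n y" if "s \<noteq> s'" "\<bar>s - s'\<bar> < 2" "y \<in> mspace M" "z \<in> mspace M"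
    "mdist M z (\<tau> s) = mdist M y (\<tau> s)" "mdist M z (\<tau> s') = mdist M y (\<tau> s')" for s s' y z
  proof (rule mirror_or_fixed[OF q(1) fr that(3,4)])
    show "S (s' - s) \<noteq> 0"
      using S_pos[of "s' - s"] S_pos[of "s - s'"] S_minus[of "s - s'"] that(1,2) by fastforce
    show "form \<kappa> z (geo q u s) = form \<kappa> y (geo q u s)" "form \<kappa> z (geo q u s') = form \<kappa> y (geo q u s')"
      using that(3-6) mdist_eq_iff geo_mem[OF q(1,2)] q(3) by auto
  qed
  moreover have "mirror n y = y \<or> mirror n z = z"
    if "y \<in> mspace M" "z \<in> mspace M" "mdist M y (mirror n z) = mdist M y z" for y z
  proof -
    have "form \<kappa> y (mirror n z) = form \<kappa> y z"
      using that mdist_eq_iff isometry_mem[OF iso(1)] by auto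
    then have "form \<kappa> z n * form \<kappa> y n = 0" by (simp add: mirror_def form_linear)
    then show ?thesis using mirror_fix by auto
  qed
  ultimately show "\<exists>r. isometry M r \<and> \<not> is_identity M r \<and>
          (\<forall>x\<in>mspace M. r (r x) = x) \<and> (\<forall>t. r (\<tau> t) = \<tau> t) \<and>
          (\<forall>s u. s \<noteq> u \<longrightarrow> \<bar>s - u\<bar> < 2 \<longrightarrow> (\<forall>y\<in>mspace M. \<forall>z\<in>mspace M.
             mdist M z (\<tau> s) = mdist M y (\<tau> s) \<longrightarrow> mdist M z (\<tau> u) = mdist M y (\<tau> u) \<longrightarrow>
             z = y \<or> z = r y)) \<and>
          (\<forall>y\<in>mspace M. \<forall>z\<in>mspace M. mdist M y (r z) = mdist M y z \<longrightarrow> r y = y \<or> r z = z)"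
    using iso mirror_mirror[OF nn] mirror_fix frame_geo_normal(1)[OF fr] q(3)
    by (intro exI[of _ "mirror n"]) auto
qed

subsection \<open>The sphere and the hyperboloid as instances\<close>

lemma form_lorentz: "form (- 1) = lorentz"
  by (simp add: fun_eq_iff form_def lorentz_def)

lemma form_inner: "form 1 = (\<bullet>)"
  by (simp add: fun_eq_iff form_def inner_vec_def sum_3)

interpretation S2: quadric 1 cos sin S2
proof
  fix x y z p w x' y' :: "real^3" and d s t :: real
  have bd: "- 1 \<le> x \<bullet> y" "x \<bullet> y \<le> 1" if "x \<in> mspace S2" "y \<in> mspace S2"
    using Cauchy_Schwarz_ineq2[of x y] that by auto
  show "x \<in> mspace S2 \<Longrightarrow> form 1 x x = 1" by (simp add: form_inner norm_eq_1)
  show "form 1 z z = 1 \<Longrightarrow> z \<in> mspace S2" by (simp add: form_inner norm_eq_1)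
  show "form 1 w w = 0 \<Longrightarrow> w = 0" by (simp add: form_inner)
  show "cos (mdist S2 x y) = 1 * form 1 x y" if "x \<in> mspace S2" "y \<in> mspace S2"
    using cos_arccos[OF bd[OF that]] by (simp add: form_inner mdist_S2)
  show "mdist S2 x y = d" if "1 * form 1 x y = cos d" "0 \<le> d" "d < 2"
    using that pi_ge_two by (simp add: form_inner mdist_S2 arccos_cos)
  show "form 1 x y = form 1 x' y' \<Longrightarrow> mdist S2 x y = mdist S2 x' y'"
    by (simp add: form_inner mdist_S2)
  show "0 < t \<Longrightarrow> t < 2 \<Longrightarrow> sin t > 0" using pi_ge_two by (intro sin_gt_zero) auto
  show "cos t * cos t + 1 * (sin t * sin t) = 1" by (simp flip: power2_eq_square)
qed (auto intro!: derivative_eq_intros simp: cos_diff sin_diff)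

interpretation H2: quadric "- 1" cosh sinh H2
proof
  fix x y z p w x' y' :: "real^3" and d s t :: real
  have le: "1 \<le> - lorentz x y" if "x \<in> mspace H2" "y \<in> mspace H2"
    using lorentz_le(1)[of x y] that by simp
  show "x \<in> mspace H2 \<Longrightarrow> form (- 1) x x = - 1" by (simp add: form_lorentz hyperboloid_def)
  show "x \<in> mspace H2 \<Longrightarrow> y \<in> mspace H2 \<Longrightarrow> form (- 1) x y < 0" using le by (simp add: form_lorentz)
  show "z \<in> mspace H2" if p: "p \<in> mspace H2" and z: "form (- 1) z z = - 1" 
    and neg: "- 1 = (1::real) \<or> form (- 1) p z < 0"
  proof -
    have "z $ 3 \<noteq> 0" using z by (auto simp: form_lorentz lorentz_def) (smt (verit) not_sum_squares_lt_zero)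
    moreover have "\<not> z $ 3 < 0"
    proof
      assume "z $ 3 < 0"
      then have "- z \<in> hyperboloid" using z by (simp add: hyperboloid_def form_lorentz lorentz_def)
      then have "lorentz p (- z) \<le> - 1" using lorentz_le(1) p by simp
      then show False using neg by (simp add: form_lorentz lorentz_def)
    qed
    ultimately show ?thesis using z by (simp add: hyperboloid_def form_lorentz)
  qed
  show "w = 0" if "p \<in> mspace H2" "form (- 1) w p = 0" "form (- 1) w w = 0"
  proof -
    have p: "p$1 * p$1 + p$2 * p$2 - p$3 * p$3 = - 1" using that by (simp add: hyperboloid_def lorentz_def)
    have wp: "w$1 * p$1 + w$2 * p$2 = w$3 * p$3" "w$1 * w$1 + w$2 * w$2 = w$3 * w$3"
      using that by (auto simp: form_lorentz lorentz_def)
    have "(w$1 * p$2 - w$2 * p$1)\<^sup>2 + (w$3)\<^sup>2 = 0" using p wp by algebra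
    then have "w$3 = 0" by (simp add: sum_power2_eq_zero_iff)
    moreover from this have "w$1 = 0" "w$2 = 0" using wp(2) by (auto simp: sum_squares_eq_zero_iff)
    ultimately show ?thesis by (simp add: vec_eq_iff forall_3)
  qed
  show "cosh (mdist H2 x y) = - 1 * form (- 1) x y" if "x \<in> mspace H2" "y \<in> mspace H2"
    using le[OF that] by (simp add: form_lorentz mdist_H2)
  show "mdist H2 x y = d" if "- 1 * form (- 1) x y = cosh d" "0 \<le> d" "d < 2"
    using that by (simp add: form_lorentz mdist_H2 arcosh_cosh_real)
  show "form (- 1) x y = form (- 1) x' y' \<Longrightarrow> mdist H2 x y = mdist H2 x' y'"
    by (simp add: form_lorentz mdist_H2)
  show "cosh t * cosh t + - 1 * (sinh t * sinh t) = 1"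
    using hyperbolic_pythagoras[of t] by (simp add: power2_eq_square)
qed (auto intro!: derivative_eq_intros simp: cosh_diff sinh_diff cosh_real_pos)

section \<open>The hyperbolic plane\<close>

lemma cosh_eq_iff_abs: "cosh x = cosh y \<longleftrightarrow> \<bar>x\<bar> = \<bar>y\<bar>" for x y :: real
  using cosh_real_nonneg_le_iff[of "\<bar>x\<bar>" "\<bar>y\<bar>"] cosh_real_nonneg_le_iff[of "\<bar>y\<bar>" "\<bar>x\<bar>"]
  by (simp add: cosh_real_abs)

lemma cosh_mdist_H2: "x \<in> mspace H2 \<Longrightarrow> y \<in> mspace H2 \<Longrightarrow> cosh (mdist H2 x y) = - form (- 1) x y"
  using H2.C_mdist by simp

lemma mdist_H2_geo:
  assumes "p \<in> mspace H2" "v \<in> H2.T p"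
  shows "mdist H2 (H2.geo p v s) (H2.geo p v t) = \<bar>s - t\<bar>"
proof -
  have "cosh (mdist H2 (H2.geo p v s) (H2.geo p v t)) = cosh (s - t)"
    using cosh_mdist_H2 H2.geo_mem H2.form_geo assms by simp
  then show ?thesis by (simp add: cosh_eq_iff_abs)
qed

lemma H2_not_k_reflective:
  assumes "billiard_table H2 \<Omega> W" "k \<ge> 1"
  shows "\<not> k_reflective H2 \<Omega> W k"
proof (rule H2.not_k_reflective[OF _ assms])
  fix p v v' l l'
  assume p: "p \<in> mspace H2" and v: "v \<in> H2.T p" "v' \<in> H2.T p" and l: "0 < l" "0 < l'"
    and eq: "H2.geo p v l = H2.geo p v' l'"
  have "l = l'"
    using mdist_H2_geo[OF p v(1), of 0 l] mdist_H2_geo[OF p v(2), of 0 l'] eq l by (simp add: H2.geo_0)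
  then have "sinh l *\<^sub>R v = sinh l *\<^sub>R v'" using eq by (simp add: H2.geo_def)
  then show "v = v'" using l by simp
qed

text \<open>
  Decompose \<open>y\<close> along a frame whose first two vectors span the plane of the translated geodesic. The
  isometry acts on the first two coordinates by a boost and preserves the square \<open>c\<^sup>2\<close> of the third one,
  so \<open>cosh\<close> of the displacement is \<open>(1 + c\<^sup>2) cosh l\<close> plus or minus \<open>c\<^sup>2\<close>.
\<close>

lemma displacement_lower_bound:
  assumes g: "isometry H2 g" and p: "p \<in> mspace H2" and v: "v \<in> H2.T p"
    and tr: "translates g (H2.geo p v) l" and l: "l \<noteq> 0" and fr: "frame (- 1) p v n"
    and y: "y \<in> mspace H2"
  shows "cosh (mdist H2 y (g y)) \<ge> cosh l + (form (- 1) y n)\<^sup>2 * (cosh l - 1)"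
proof -
  define f where "f = form (- 1)"
  let ?\<sigma> = "H2.geo p v"
  define z where "z = g y"
  have z: "z \<in> mspace H2" using isometry_mem[OF g y] by (simp add: z_def)
  have "f z (?\<sigma> (t + l)) = f y (?\<sigma> t)" for t
    using isometry_mdist[OF g y H2.geo_mem[OF p v, of t]] tr H2.mdist_eq_iff[of "g y" "?\<sigma> (t + l)" y "?\<sigma> t"]
      z y H2.geo_mem[OF p v] by (simp add: translates_def z_def f_def)
  from this[of 0] this[of "- l"]
  have 1: "cosh l * f z p + sinh l * f z v = f y p" and 2: "f z p = cosh l * f y p - sinh l * f y v"
    by (simp_all add: H2.geo_def form_linear f_def)
  have cs: "cosh l * cosh l - sinh l * sinh l = 1"
    using hyperbolic_pythagoras[of l] by (simp add: power2_eq_square)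
  have "sinh l * f z v = sinh l * (cosh l * f y v - sinh l * f y p)"
  proof -
    have "sinh l * f z v = f y p - cosh l * (cosh l * f y p - sinh l * f y v)"
      using 1 unfolding 2 by simp
    also have "\<dots> = f y p * (1 - (cosh l * cosh l - sinh l * sinh l))
        + sinh l * (cosh l * f y v - sinh l * f y p)"
      by (simp add: algebra_simps)
    finally show ?thesis unfolding cs by simp
  qed
  then have 3: "f z v = cosh l * f y v - sinh l * f y p" using l by simp
  have ff: "f x x' = - (f x p * f x' p) + f x v * f x' v + f x n * f x' n" for x x'
    using frame_form[OF _ fr, of x x'] by (simp add: f_def)
  have yy: "f y p * f y p - f y v * f y v = 1 + f y n * f y n"
    using ff[of y y] H2.form_self[OF y] by (simp add: f_def)
  have zz: "f z p * f z p - f z v * f z v = 1 + f z n * f z n"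
    using ff[of z z] H2.form_self[OF z] by (simp add: f_def)
  have "f z n * f z n = f y n * f y n"
  proof -
    have "f z p * f z p - f z v * f z v
        = (cosh l * cosh l - sinh l * sinh l) * (f y p * f y p - f y v * f y v)"
      unfolding 2 3 by (simp add: algebra_simps)
    then show ?thesis unfolding cs yy zz by simp
  qed
  then have "\<bar>f z n\<bar> = \<bar>f y n\<bar>" by (metis abs_mult_self_eq power2_eq_square power2_eq_iff_nonneg abs_ge_zero)
  then have "f y n * f z n \<le> \<bar>f y n\<bar> * \<bar>f y n\<bar>" by (metis abs_ge_self abs_mult)
  then have n: "f y n * f z n \<le> f y n * f y n" by simp
  have "- f y z = f y p * f z p - f y v * f z v - f y n * f z n" using ff[of y z] by simp
  also have "f y p * f z p - f y v * f z v = cosh l * (1 + f y n * f y n)"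
    unfolding yy[symmetric] 2 3 by (simp add: algebra_simps)
  finally have "- f y z \<ge> cosh l + (f y n)\<^sup>2 * (cosh l - 1)"
    using n by (simp add: power2_eq_square algebra_simps)
  then show ?thesis using cosh_mdist_H2[OF y z] by (simp add: z_def f_def)
qed

text \<open>
  The bound for the displacement is attained exactly on the plane of the geodesic, where the third
  coordinate vanishes.
\<close>

lemma translated_geodesic_axis:
  assumes g: "isometry H2 g" and \<sigma>: "geodesic H2 \<sigma>" and tr: "translates g \<sigma> l" and l: "l \<noteq> 0"
  shows "axis_of H2 g = range \<sigma>" "y \<in> mspace H2 \<Longrightarrow> \<bar>l\<bar> \<le> mdist H2 y (g y)"
proof -
  obtain p v where pv: "p \<in> mspace H2" "v \<in> H2.T p" "\<sigma> = H2.geo p v" using H2.geodesic_obtain[OF \<sigma>] .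
  note tr' = tr[unfolded pv(3)]
  obtain n where fr: "frame (- 1) p v n" using H2.frame_normal[OF pv(1,2)] .
  have l1: "cosh l > 1" using cosh_real_strict_mono[of 0 "\<bar>l\<bar>"] l by simp
  note bound = displacement_lower_bound[OF g pv(1,2) tr' l fr]
  show le: "\<bar>l\<bar> \<le> mdist H2 y (g y)" if "y \<in> mspace H2" for y
  proof -
    have "(form (- 1) y n)\<^sup>2 * (cosh l - 1) \<ge> 0" using l1 by simp
    then have "cosh \<bar>l\<bar> \<le> cosh (mdist H2 y (g y))" using bound[OF that] by simp
    then show ?thesis using cosh_real_nonneg_le_iff[of "\<bar>l\<bar>" "mdist H2 y (g y)"] by simp
  qed
  have on: "mdist H2 (\<sigma> t) (g (\<sigma> t)) = \<bar>l\<bar>" for t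
    using tr mdist_H2_geo[OF pv(1,2), of t "t + l"] pv(3) by (simp add: translates_def)
  show "axis_of H2 g = range \<sigma>"
  proof
    show "range \<sigma> \<subseteq> axis_of H2 g"
      using on le geodesic_mem[OF \<sigma>] by (auto simp: min_displacement_set_def)
    show "axis_of H2 g \<subseteq> range \<sigma>"
    proof
      fix y assume "y \<in> axis_of H2 g"
      then have y: "y \<in> mspace H2" and "mdist H2 y (g y) \<le> mdist H2 (\<sigma> 0) (g (\<sigma> 0))"
        using geodesic_mem[OF \<sigma>] unfolding min_displacement_set_def by blast+
      then have "mdist H2 y (g y) = \<bar>l\<bar>" using on[of 0] le[OF y] by simp
      then have "(form (- 1) y n)\<^sup>2 * (cosh l - 1) \<le> 0" using bound[OF y] by simp
      then have c: "form (- 1) y n = 0" using l1 by (simp add: mult_le_0_iff)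
      define t where "t = arsinh (form (- 1) y v)"
      have "form (- 1) y p < 0" using H2.form_neg[OF _ y pv(1)] by simp
      moreover have "(form (- 1) y p)\<^sup>2 = (form (- 1) y v)\<^sup>2 + 1"
        using frame_form[OF _ fr, of y y] H2.form_self[OF y] c by (simp add: power2_eq_square)
      ultimately have "cosh t = - form (- 1) y p"
        unfolding t_def cosh_arsinh_real by (metis abs_of_neg real_sqrt_abs)
      then have "y = H2.geo p v t"
        using frame_expand[OF _ fr, of y] c by (simp add: H2.geo_def t_def)
      then show "y \<in> range \<sigma>" using pv(3) by blast
    qed
  qed
qed

text \<open>
  Let \<open>x\<close> have minimal displacement, and let \<open>m\<close> be the midpoint of \<open>x\<close> and \<open>g x\<close>. The triangle
  inequality for \<open>m\<close>, \<open>g x\<close>, \<open>g m\<close> bounds the displacement of \<open>m\<close> by that of \<open>x\<close>; minimality makes it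
  an equality, so \<open>g m\<close> lies on the geodesic through \<open>x\<close> and \<open>g x\<close>.
\<close>

lemma hyperbolic_translates_geodesic:
  assumes "hyperbolic H2 g"
  obtains \<sigma> l where "geodesic H2 \<sigma>" "l \<noteq> 0" "translates g \<sigma> l"
proof -
  obtain x where g: "isometry H2 g" and x: "x \<in> mspace H2" "mdist H2 x (g x) > 0"
    and min: "\<And>y. y \<in> mspace H2 \<Longrightarrow> mdist H2 x (g x) \<le> mdist H2 y (g y)"
    using assms by (auto simp: hyperbolic_def min_displacement_set_def)
  define d where "d = mdist H2 x (g x)"
  have d: "d > 0" "sinh d > 0" using x by (auto simp: d_def)
  have y: "g x \<in> mspace H2" using isometry_mem[OF g x(1)] .
  have xx: "form (- 1) x x = - 1" "form (- 1) (g x) (g x) = - 1" and xy: "form (- 1) x (g x) = - cosh d"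
    using H2.form_self x(1) y cosh_mdist_H2[OF x(1) y] by (auto simp: d_def)
  \<comment> \<open>\<open>v\<close> is the initial direction of the geodesic from \<open>x\<close> to \<open>g x\<close>.\<close>
  define v where "v = (1 / sinh d) *\<^sub>R (g x - cosh d *\<^sub>R x)"
  have "sinh d * sinh d * form (- 1) v v = cosh d * cosh d - 1"
    using d(2) xx xy form_commute[of "- 1" "g x" x] by (simp add: v_def form_linear algebra_simps)
  also have "\<dots> = sinh d * sinh d" using hyperbolic_pythagoras[of d] by (simp add: power2_eq_square)
  finally have v: "v \<in> H2.T x" using d(2) xx xy by (simp add: H2.T_def) (simp add: v_def form_linear)
  let ?\<sigma> = "H2.geo x v"
  have gd: "?\<sigma> d = g x" using d(2) by (simp add: H2.geo_def v_def)
  have \<sigma>: "geodesic H2 ?\<sigma>" using H2.geodesic_geoI[OF x(1) v] .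
  define m where "m = ?\<sigma> (d / 2)"
  have m: "m \<in> mspace H2" "g m \<in> mspace H2" using H2.geo_mem[OF x(1) v] isometry_mem[OF g] by (auto simp: m_def)
  have xm: "mdist H2 x m = d / 2" "mdist H2 m (g x) = d / 2"
    using mdist_H2_geo[OF x(1) v, of 0 "d/2"] mdist_H2_geo[OF x(1) v, of "d/2" d] d(1)
    by (auto simp: H2.geo_0 m_def gd)
  have gm: "mdist H2 (g x) (g m) = d / 2" using isometry_mdist[OF g x(1) m(1)] xm(1) by simp
  have "mdist H2 m (g m) \<le> d" using mdist_triangle[OF m(1) y m(2)] xm gm by simp
  then have "mdist H2 m (g m) = d" using min[OF m(1)] by (simp add: d_def)
  then have f1: "form (- 1) (g m) m = - cosh d"
    using cosh_mdist_H2[OF m] form_commute[of "- 1" m] by simp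
  have f2: "form (- 1) (g m) (g x) = - cosh (d / 2)"
    using cosh_mdist_H2[OF y m(2)] gm form_commute[of "- 1" "g x"] by simp
  have "g m = ?\<sigma> (3 * d / 2)"
  proof (rule H2.geo_eqI[OF x(1) v, where s = "d/2" and u = d])
    show "form (- 1) (g m) (H2.geo x v (d / 2)) = - 1 * cosh (3 * d / 2 - d / 2)"
      using f1 by (simp add: m_def field_simps)
    show "form (- 1) (g m) (H2.geo x v d) = - 1 * cosh (3 * d / 2 - d)"
      using f2 by (simp add: gd field_simps)
  qed (use H2.form_self m d in auto)
  then have "(g \<circ> ?\<sigma>) (d / 2) = ?\<sigma> (d + 1 * (d / 2))" by (simp add: m_def field_simps)
  moreover have "(g \<circ> ?\<sigma>) 0 = ?\<sigma> (d + 1 * 0)" by (simp add: H2.geo_0 gd)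
  ultimately have "g \<circ> ?\<sigma> = (\<lambda>t. ?\<sigma> (d + 1 * t))"
    using d(1) by (intro H2.geodesic_agree[of _ _ 0 "d/2"] geodesic_isometry[OF g \<sigma>] geodesic_reparam[OF \<sigma>]) auto
  then have "translates g ?\<sigma> d" by (simp add: translates_def fun_eq_iff add.commute)
  with \<sigma> d(1) show thesis using that[of ?\<sigma> d] by simp
qed

lemma translates_same_range:
  assumes \<sigma>: "geodesic H2 \<sigma>" and \<tau>: "geodesic H2 \<tau>" and eq: "range \<sigma> = range \<tau>"
    and tr: "translates g \<tau> l"
  shows "\<exists>e. \<bar>e\<bar> = 1 \<and> translates g \<sigma> (e * l)"
proof -
  obtain p v where p: "p \<in> mspace H2" "v \<in> H2.T p" "\<sigma> = H2.geo p v" using H2.geodesic_obtain[OF \<sigma>] .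
  obtain q w where q: "q \<in> mspace H2" "w \<in> H2.T q" "\<tau> = H2.geo q w" using H2.geodesic_obtain[OF \<tau>] .
  have "\<sigma> 0 \<in> range \<tau>" "\<sigma> 1 \<in> range \<tau>" unfolding eq[symmetric] by blast+
  then obtain a b where ab: "\<sigma> 0 = \<tau> a" "\<sigma> 1 = \<tau> b" by blast
  define e where "e = b - a"
  have e: "\<bar>e\<bar> = 1"
    using mdist_H2_geo[OF p(1,2), of 1 0] mdist_H2_geo[OF q(1,2), of b a] ab p q by (simp add: e_def)
  then have "e * e = 1" by (metis abs_mult_self_eq mult_1)
  have "\<sigma> = (\<lambda>t. \<tau> (a + e * t))"
    using ab by (intro H2.geodesic_agree[of _ _ 0 1] \<sigma> geodesic_reparam[OF \<tau> e]) (auto simp: e_def)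
  then have "translates g \<sigma> (e * l)"
  proof -
    have "a + e * (t + e * l) = (a + e * t) + l" for t using \<open>e * e = 1\<close> by algebra
    then show ?thesis using tr unfolding \<open>\<sigma> = (\<lambda>t. \<tau> (a + e * t))\<close> translates_def by metis
  qed
  with e show ?thesis by blast
qed

lemma hyperbolic_translates_iff_axis:
  assumes "hyperbolic H2 g"
  shows "\<exists>\<sigma>. geodesic H2 \<sigma> \<and> range \<sigma> = axis_of H2 g"
    "geodesic H2 \<sigma> \<Longrightarrow> (\<exists>l. l \<noteq> 0 \<and> translates g \<sigma> l) \<longleftrightarrow> range \<sigma> = axis_of H2 g"
proof -
  have g: "isometry H2 g" using assms by (simp add: hyperbolic_def)
  obtain \<tau> l where \<tau>: "geodesic H2 \<tau>" "l \<noteq> 0" "translates g \<tau> l"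
    using hyperbolic_translates_geodesic[OF assms] .
  note ax = translated_geodesic_axis(1)[OF g]
  show "\<exists>\<sigma>. geodesic H2 \<sigma> \<and> range \<sigma> = axis_of H2 g" using ax[OF \<tau>(1,3,2)] \<tau>(1) by blast
  show "(\<exists>l. l \<noteq> 0 \<and> translates g \<sigma> l) \<longleftrightarrow> range \<sigma> = axis_of H2 g" if \<sigma>: "geodesic H2 \<sigma>"
  proof
    assume "\<exists>l. l \<noteq> 0 \<and> translates g \<sigma> l"
    then show "range \<sigma> = axis_of H2 g" using ax[OF \<sigma>] by blast
  next
    assume "range \<sigma> = axis_of H2 g"
    then obtain e where "\<bar>e\<bar> = 1" "translates g \<sigma> (e * l)"
      using translates_same_range[OF \<sigma> \<tau>(1) _ \<tau>(3)] ax[OF \<tau>(1,3,2)] by auto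
    moreover from this have "e * l \<noteq> 0" using \<tau>(2) by auto
    ultimately show "\<exists>l. l \<noteq> 0 \<and> translates g \<sigma> l" by blast
  qed
qed

text \<open>
  An isometry that translates a geodesic by \<open>l\<close> has displacement at least \<open>l\<close> everywhere and attains it, so
  it has neither a fixed point nor an empty set of minimal displacement.
\<close>

lemma non_hyperbolic_translates_none:
  assumes g: "elliptic H2 g \<or> parabolic H2 g \<or> is_identity H2 g" and \<sigma>: "geodesic H2 \<sigma>" and l: "l > 0"
  shows "\<not> translates g \<sigma> l"
proof
  assume tr: "translates g \<sigma> l"
  have M: "\<sigma> t \<in> mspace H2" for t using geodesic_mem[OF \<sigma>] .
  consider "elliptic H2 g" | "parabolic H2 g" | "is_identity H2 g" using g by blast
  then show False
  proof cases
    case 1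
    then obtain x where "isometry H2 g" "x \<in> mspace H2" "g x = x" by (auto simp: elliptic_def)
    then show False using translated_geodesic_axis(2)[of g, OF _ \<sigma> tr, of x] l mdist_zero[of x H2] by fastforce
  next
    case 2
    then show False using translated_geodesic_axis(1)[of g, OF _ \<sigma> tr] l by (auto simp: parabolic_def)
  next
    case 3
    then have "\<sigma> l = \<sigma> 0" using tr M[of 0] by (simp add: is_identity_def translates_def) (metis add_0)
    moreover obtain p v where "p \<in> mspace H2" "v \<in> H2.T p" "\<sigma> = H2.geo p v" using H2.geodesic_obtain[OF \<sigma>] .
    ultimately show False using mdist_H2_geo[of p v l 0] mdist_zero[of "\<sigma> 0" H2] M[of 0] l by fastforce
  qed
qed

section \<open>The sphere\<close>

lemma mspace_S2_iff: "x \<in> mspace S2 \<longleftrightarrow> x \<bullet> x = 1"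
  by (simp add: norm_eq_1)

lemma S2_T_iff: "v \<in> S2.T p \<longleftrightarrow> p \<bullet> v = 0 \<and> v \<bullet> v = 1"
  by (simp add: S2.T_def form_inner)

lemma S2_geo: "S2.geo p v t = cos t *\<^sub>R p + sin t *\<^sub>R v"
  by (simp add: S2.geo_def)

lemma S2_geo_shift:
  assumes "cos l = c" "c * c = 1"
  shows "S2.geo p v (t + l) = c *\<^sub>R S2.geo p v t"
proof -
  have "sin l * sin l = 0" using sin_cos_squared_add3[of l] assms by simp
  then have "sin l = 0" by simp
  then show ?thesis using assms(1) by (simp add: S2_geo cos_add sin_add scaleR_add_right mult.commute)
qed

lemma S2_translates_scaled:
  assumes "p \<in> mspace S2" "v \<in> S2.T p" "c * c = 1"
    and "\<And>x. x \<in> mspace S2 \<Longrightarrow> g x = c *\<^sub>R x"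
  shows "translates g (S2.geo p v) l \<longleftrightarrow> cos l = c"
proof
  assume "translates g (S2.geo p v) l"
  then have "c *\<^sub>R p = S2.geo p v l"
    using assms(1,4) unfolding translates_def by (metis S2.geo_0 add_0)
  from arg_cong[OF this, of "\<lambda>x. p \<bullet> x"] show "cos l = c"
    using assms(1,2) by (simp add: S2_geo inner_add_right S2_T_iff mspace_S2_iff del: mspace_S2)
next
  assume "cos l = c"
  then show "translates g (S2.geo p v) l"
    using S2_geo_shift[OF _ assms(3)] assms(4) S2.geo_mem[OF assms(1,2)] by (simp add: translates_def)
qed

text \<open>Congruences modulo \<open>2 \<pi>\<close> become conditions on the cosine, the form in which lengths appear.\<close>

lemma rcong_pi_iff: "[l = pi] (rmod (2 * pi)) \<longleftrightarrow> cos l = - 1"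
  and rcong_0_2pi_iff: "[l = 0] (rmod (2 * pi)) \<longleftrightarrow> cos l = 1"
  and rcong_2pi_iff: "[l = 2 * pi] (rmod (2 * pi)) \<longleftrightarrow> cos l = 1"
proof -
  have *: "[l = x] (rmod (2 * pi)) \<longleftrightarrow> cos (x - l) = 1" for x
    by (auto simp: rcong_altdef cos_one_2pi_int algebra_simps)
  show "[l = pi] (rmod (2 * pi)) \<longleftrightarrow> cos l = - 1" "[l = 0] (rmod (2 * pi)) \<longleftrightarrow> cos l = 1"
    "[l = 2 * pi] (rmod (2 * pi)) \<longleftrightarrow> cos l = 1"
    unfolding * by (auto simp: cos_diff)
qed

lemma antipodal_translates_iff:
  assumes "geodesic S2 \<sigma>"
  shows "translates (\<lambda>x. - x) \<sigma> l \<longleftrightarrow> [l = pi] (rmod (2 * pi))"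
proof -
  obtain p v where "p \<in> mspace S2" "v \<in> S2.T p" "\<sigma> = S2.geo p v" using S2.geodesic_obtain[OF assms] .
  then show ?thesis unfolding rcong_pi_iff using S2_translates_scaled[of p v "- 1" "\<lambda>x. - x" l] by simp
qed

lemma identity_translates_iff:
  assumes "geodesic S2 \<sigma>"
  shows "translates (\<lambda>x. x) \<sigma> l \<longleftrightarrow> [l = 2 * pi] (rmod (2 * pi))"
proof -
  obtain p v where "p \<in> mspace S2" "v \<in> S2.T p" "\<sigma> = S2.geo p v" using S2.geodesic_obtain[OF assms] .
  then show ?thesis unfolding rcong_2pi_iff using S2_translates_scaled[of p v 1 "\<lambda>x. x" l] by simp
qed

text \<open>
  Two distinct great circles through \<open>p\<close> meet only in \<open>p\<close> and \<open>- p\<close>, so an isometry \<open>g\<close> that translates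
  both has \<open>g p = c p\<close> with \<open>c = \<plusminus> 1\<close>. Then \<open>g\<close> is multiplication by \<open>c\<close> on both circles, which span the
  space.
\<close>

lemma translates_two_circles_through_point:
  assumes g: "isometry S2 g" and p: "p \<in> mspace S2" and v: "v \<in> S2.T p" and v': "v' \<in> S2.T p"
    and indep: "\<And>a b. a *\<^sub>R v + b *\<^sub>R v' = 0 \<Longrightarrow> a = 0 \<and> b = 0"
    and tr: "translates g (S2.geo p v) l" "translates g (S2.geo p v') l'"
  shows "(\<forall>x\<in>mspace S2. g x = x) \<or> (\<forall>x\<in>mspace S2. g x = - x)"
proof -
  have eq: "cos l *\<^sub>R p + sin l *\<^sub>R v = cos l' *\<^sub>R p + sin l' *\<^sub>R v'"
    using tr unfolding translates_def by (metis S2.geo_0 S2_geo add_0)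
  from arg_cong[OF this, of "\<lambda>x. p \<bullet> x"] have cos: "cos l = cos l'"
    using p v v' by (simp add: inner_add_right S2_T_iff mspace_S2_iff del: mspace_S2)
  with eq have "sin l *\<^sub>R v + (- sin l') *\<^sub>R v' = 0" by simp
  then have "sin l = 0" using indep by blast
  define c where "c = cos l"
  have c: "c * c = 1" using sin_cos_squared_add3[of l] \<open>sin l = 0\<close> by (simp add: c_def)
  obtain n where fr: "frame 1 p v n" using S2.frame_normal[OF p v] .
  have "g x = c *\<^sub>R x" if x: "x \<in> mspace S2" for x
  proof -
    have orth: "(g x - c *\<^sub>R x) \<bullet> S2.geo p u t = 0"
      if u: "u \<in> S2.T p" and tr: "translates g (S2.geo p u) L" and L: "cos L = c" for u t L
    proof -
      have y: "S2.geo p u t \<in> mspace S2" using S2.geo_mem[OF p u] .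
      have "g (S2.geo p u t) = c *\<^sub>R S2.geo p u t"
        using tr S2_geo_shift[OF L c] by (simp add: translates_def)
      moreover have "g x \<bullet> g (S2.geo p u t) = x \<bullet> S2.geo p u t"
        using isometry_mdist[OF g x y] S2.mdist_eq_iff isometry_mem[OF g] x y form_inner by metis
      ultimately have "c * (g x \<bullet> S2.geo p u t) = x \<bullet> S2.geo p u t" by simp
      then have "g x \<bullet> S2.geo p u t = c * (x \<bullet> S2.geo p u t)" using c by (metis mult.assoc mult_1)
      then show ?thesis by (simp add: inner_diff_left)
    qed
    let ?w = "g x - c *\<^sub>R x"
    have "?w \<bullet> p = 0" "?w \<bullet> v = 0" "?w \<bullet> v' = 0"
      using orth[OF v tr(1), of 0] orth[OF v tr(1), of "pi/2"] orth[OF v' tr(2), of "pi/2"] cos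
      by (simp_all add: S2_geo c_def)
    moreover have v'_eq: "v' = (v' \<bullet> v) *\<^sub>R v + (v' \<bullet> n) *\<^sub>R n"
      using frame_expand[OF _ fr, of v'] v' by (simp add: form_inner S2_T_iff inner_commute)
    moreover have "v' \<bullet> n \<noteq> 0"
    proof
      assume "v' \<bullet> n = 0"
      then have "(v' \<bullet> v) *\<^sub>R v + (- 1) *\<^sub>R v' = 0" using v'_eq by simp
      then show False using indep by fastforce
    qed
    ultimately have "?w \<bullet> n = 0"
    proof -
      have "?w \<bullet> v' = ?w \<bullet> ((v' \<bullet> v) *\<^sub>R v + (v' \<bullet> n) *\<^sub>R n)" using v'_eq by metis
      also have "\<dots> = (v' \<bullet> v) * (?w \<bullet> v) + (v' \<bullet> n) * (?w \<bullet> n)"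
        by (simp only: inner_add_right inner_scaleR_right)
      finally show ?thesis using \<open>?w \<bullet> v = 0\<close> \<open>?w \<bullet> v' = 0\<close> \<open>v' \<bullet> n \<noteq> 0\<close> by simp
    qed
    then have "?w = 0"
      using frame_complete[OF _ fr, of ?w] \<open>?w \<bullet> p = 0\<close> \<open>?w \<bullet> v = 0\<close> by (simp add: form_inner)
    then show ?thesis by simp
  qed
  moreover have "c = 1 \<or> c = - 1" using c by (simp add: square_eq_1_iff)
  ultimately show ?thesis by auto
qed

lemma S2_geodesic_from:
  assumes "geodesic S2 \<sigma>"
  obtains v where "\<sigma> s \<in> mspace S2" "v \<in> S2.T (\<sigma> s)" "(\<lambda>t. \<sigma> (s + t)) = S2.geo (\<sigma> s) v"
proof -
  have "geodesic S2 (\<lambda>t. \<sigma> (s + 1 * t))" by (rule geodesic_reparam[OF assms]) simp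
  from S2.geodesic_obtain_geo[OF this] obtain v where
    "v \<in> S2.T (\<sigma> s)" "(\<lambda>t. \<sigma> (s + 1 * t)) = S2.geo (\<sigma> s) v" by auto
  then show thesis using that geodesic_mem[OF assms] by simp
qed

lemma range_shift: "range (\<lambda>t. \<sigma> (s + t)) = range \<sigma>" for s :: real
proof -
  have "(\<lambda>t. \<sigma> (s + t)) = \<sigma> \<circ> (+) s" by (simp add: fun_eq_iff)
  then show ?thesis by (simp only: image_comp[symmetric] surj_plus)
qed

text \<open>
  Any two great circles meet, so after a shift of the parameters both start at a common point. If they
  were distinct, then their directions there would be independent and \<open>g\<close> would be plus or minus the identity.
\<close>

lemma two_translated_circles:
  assumes g: "isometry S2 g"
    and not_pm: "\<not> (\<forall>x\<in>mspace S2. g x = x)" "\<not> (\<forall>x\<in>mspace S2. g x = - x)"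
    and \<sigma>: "geodesic S2 \<sigma>" and \<tau>: "geodesic S2 \<tau>" and tr: "translates g \<sigma> l" "translates g \<tau> m"
  shows "range \<sigma> = range \<tau>"
proof -
  obtain a b where ab: "a \<in> mspace S2" "b \<in> S2.T a" "\<sigma> = S2.geo a b" using S2.geodesic_obtain[OF \<sigma>] .
  obtain q u where q: "q \<in> mspace S2" "u \<in> S2.T q" "\<tau> = S2.geo q u" using S2.geodesic_obtain[OF \<tau>] .
  obtain n where fr: "frame 1 q u n" using S2.frame_normal[OF q(1,2)] .
  \<comment> \<open>The two circles meet: a sinusoid has a zero.\<close>
  obtain t where "(a \<bullet> n) * cos t + (b \<bullet> n) * sin t = 0"
  proof (cases "a \<bullet> n = 0")
    case True
    then show thesis using that[of 0] by simp
  next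
    case False
    define r where "r = sqrt ((a \<bullet> n)\<^sup>2 + (b \<bullet> n)\<^sup>2)"
    have r: "r > 0" "r\<^sup>2 = (a \<bullet> n)\<^sup>2 + (b \<bullet> n)\<^sup>2"
      using False by (auto simp: r_def sum_power2_gt_zero_iff)
    have "(- (b \<bullet> n) / r)\<^sup>2 + ((a \<bullet> n) / r)\<^sup>2 = 1"
      using r by (simp add: power_divide add_divide_distrib[symmetric] add.commute del: mspace_S2) (use r in auto)
    then obtain t where "- (b \<bullet> n) / r = cos t" "(a \<bullet> n) / r = sin t" by (rule sincos_total_2pi)
    then have "b \<bullet> n = - (r * cos t)" "a \<bullet> n = r * sin t" using r(1) by (auto simp: field_simps)
    then show thesis using that[of t] by simp
  qed
  then have tn: "\<sigma> t \<bullet> n = 0" by (simp add: ab(3) S2_geo inner_add_left mult.commute)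
  obtain v where v: "\<sigma> t \<in> mspace S2" "v \<in> S2.T (\<sigma> t)" "(\<lambda>x. \<sigma> (t + x)) = S2.geo (\<sigma> t) v"
    using S2_geodesic_from[OF \<sigma>] .
  have "(\<sigma> t \<bullet> q)\<^sup>2 + (\<sigma> t \<bullet> u)\<^sup>2 = 1"
    using frame_form[OF _ fr, of "\<sigma> t" "\<sigma> t"] tn v(1)
    by (simp add: form_inner mspace_S2_iff power2_eq_square del: mspace_S2)
  then obtain s where "\<sigma> t \<bullet> q = cos s" "\<sigma> t \<bullet> u = sin s" by (rule sincos_total_2pi)
  then have st: "\<tau> s = \<sigma> t"
    using frame_expand[OF _ fr, of "\<sigma> t"] tn by (simp add: form_inner q(3) S2_geo)
  obtain w where w: "w \<in> S2.T (\<sigma> t)" "(\<lambda>x. \<tau> (s + x)) = S2.geo (\<sigma> t) w"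
    using S2_geodesic_from[OF \<tau>, of s] unfolding st by metis
  have "translates g (S2.geo (\<sigma> t) v) l" "translates g (S2.geo (\<sigma> t) w) m"
    using tr unfolding v(3)[symmetric] w(2)[symmetric] translates_def by (simp_all add: add.assoc)
  then obtain x y where xy: "x *\<^sub>R v + y *\<^sub>R w = 0" "x \<noteq> 0 \<or> y \<noteq> 0"
    using translates_two_circles_through_point[OF g v(1,2) w(1)] not_pm by blast
  have vw: "v \<bullet> v = 1" "w \<bullet> w = 1" using v(2) w(1) by (auto simp: S2_T_iff)
  have xv: "x *\<^sub>R v = - (y *\<^sub>R w)" using xy(1) by (simp add: add_eq_0_iff2)
  have "x * x = (x *\<^sub>R v) \<bullet> (x *\<^sub>R v)" using vw by simp
  also have "\<dots> = y * y" unfolding xv using vw by simp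
  finally have "x * x = y * y" .
  then have "x = y \<or> x = - y" and "y \<noteq> 0" using xy(2) by (auto simp: square_eq_iff)
  then have "v = w \<or> v = - w" using xv by (auto simp flip: scaleR_minus_right)
  moreover have "range (S2.geo (\<sigma> t) (- w)) = range (S2.geo (\<sigma> t) w)"
  proof -
    have "S2.geo (\<sigma> t) (- w) x = S2.geo (\<sigma> t) w (- x)" for x by (simp add: S2_geo)
    then have "S2.geo (\<sigma> t) (- w) = S2.geo (\<sigma> t) w \<circ> uminus" by (simp add: fun_eq_iff)
    then show ?thesis by (simp only: image_comp[symmetric]) simp
  qed
  ultimately show ?thesis using range_shift[of \<sigma> t] range_shift[of \<tau> s] unfolding v(3) w(2) by auto
qed

lemma axis_tangent:
  fixes i j :: 3
  assumes "i \<noteq> j"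
  shows "axis i 1 \<in> mspace S2" "axis j 1 \<in> S2.T (axis i 1)"
  using assms by (simp_all add: S2_T_iff inner_axis_axis)

lemma axis_geodesic: "i \<noteq> j \<Longrightarrow> geodesic S2 (S2.geo (axis i 1) (axis j 1))" for i j :: 3
  using S2.geodesic_geoI axis_tangent by blast

lemma translates_all_iff:
  assumes g: "isometry S2 g"
  shows "(\<forall>\<sigma>. geodesic S2 \<sigma> \<longrightarrow> (\<exists>l>0. translates g \<sigma> l)) \<longleftrightarrow>
    (\<forall>x\<in>mspace S2. g x = x) \<or> (\<forall>x\<in>mspace S2. g x = - x)"
proof
  assume all: "\<forall>\<sigma>. geodesic S2 \<sigma> \<longrightarrow> (\<exists>l>0. translates g \<sigma> l)"
  show "(\<forall>x\<in>mspace S2. g x = x) \<or> (\<forall>x\<in>mspace S2. g x = - x)"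
  proof (rule ccontr)
    assume not_pm: "\<not> ?thesis"
    let ?\<sigma> = "S2.geo (axis 1 1) (axis 2 1)" and ?\<tau> = "S2.geo (axis 1 1) (axis 3 1)"
    have g1: "geodesic S2 ?\<sigma>" and g2: "geodesic S2 ?\<tau>" by (rule axis_geodesic; simp)+
    then have "range ?\<sigma> = range ?\<tau>" using two_translated_circles[OF g _ _ g1 g2] not_pm all by blast
    moreover have "?\<tau> (pi / 2) = axis 3 1" by (simp add: S2_geo)
    ultimately obtain t where "axis 3 1 = ?\<sigma> t" by (metis rangeI rangeE)
    then have "(axis 3 1 :: real^3) $ 3 = ?\<sigma> t $ 3" by simp
    then show False by (simp add: S2_geo axis_def)
  qed
next
  assume pm: "(\<forall>x\<in>mspace S2. g x = x) \<or> (\<forall>x\<in>mspace S2. g x = - x)"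
  show "\<forall>\<sigma>. geodesic S2 \<sigma> \<longrightarrow> (\<exists>l>0. translates g \<sigma> l)"
  proof (intro allI impI)
    fix \<sigma> assume "geodesic S2 \<sigma>"
    then obtain p v where p: "p \<in> mspace S2" "v \<in> S2.T p" "\<sigma> = S2.geo p v" by (rule S2.geodesic_obtain)
    from pm show "\<exists>l>0. translates g \<sigma> l"
    proof
      assume "\<forall>x\<in>mspace S2. g x = x"
      then have "translates g \<sigma> (2 * pi)" using S2_translates_scaled[OF p(1,2), of 1 g] p(3) by simp
      then show ?thesis by (intro exI[of _ "2 * pi"]) simp
    next
      assume "\<forall>x\<in>mspace S2. g x = - x"
      then have "translates g \<sigma> pi" using S2_translates_scaled[OF p(1,2), of "- 1" g] p(3) by simp
      then show ?thesis by (intro exI[of _ pi]) simp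
    qed
  qed
qed

text \<open>
  The fan at one impact point contains two orbits with independent directions; together they force
  \<open>g = c I\<close> with \<open>c = \<plusminus> 1\<close>. This \<open>c\<close> is the cosine of the length of each orbit of the family.
\<close>

lemma S2_periodic_family:
  assumes table: "billiard_table S2 \<Omega> W" and fam: "periodic_family S2 \<Omega> W as U"
  shows "(\<forall>x\<in>mspace S2. reflection_product S2 as x = - x) \<and>
          (\<forall>x\<in>U. \<forall>L. periodic_orbit S2 \<Omega> W as L x \<longrightarrow> [L = pi] (rmod (2 * pi)))
        \<or>
        (\<forall>x\<in>mspace S2. reflection_product S2 as x = x) \<and>
          (\<forall>x\<in>U. \<forall>L. periodic_orbit S2 \<Omega> W as L x \<longrightarrow> [L = 0] (rmod (2 * pi)))"
proof -
  let ?g = "reflection_product S2 as"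
  obtain p v where pv: "(p, v) \<in> U" and U: "openin (top_of_set (orbit_space S2 \<Omega> W)) U"
    and per: "\<And>x. x \<in> U \<Longrightarrow> \<exists>L. periodic_orbit S2 \<Omega> W as L x"
    using fam unfolding periodic_family_def by fastforce
  have tangent: "q \<in> mspace S2 \<and> u \<in> S2.T q" if "(q, u) \<in> U" for q u
    using S2.orbit_space_tangent[of q u \<Omega> W] openin_imp_subset[OF U] that by auto
  have p: "p \<in> mspace S2" using tangent[OF pv] by blast
  obtain w \<delta> where \<delta>: "\<delta> > 0" "\<delta> \<le> 1" and indep: "\<And>a b. a *\<^sub>R v + b *\<^sub>R w = 0 \<Longrightarrow> a = 0 \<and> b = 0"
    and fan: "\<And>\<theta>. 0 \<le> \<theta> \<Longrightarrow> \<theta> < \<delta> \<Longrightarrow> (p, cos \<theta> *\<^sub>R v + sin \<theta> *\<^sub>R w) \<in> U"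
    using S2.open_family_contains_fan[OF table U pv] by metis
  define \<theta> where "\<theta> = \<delta> / 2"
  define v' where "v' = cos \<theta> *\<^sub>R v + sin \<theta> *\<^sub>R w"
  have v': "(p, v') \<in> U" using fan[of \<theta>] \<delta> by (simp add: v'_def \<theta>_def)
  have "sin \<theta> > 0" using \<delta> pi_ge_two by (intro sin_gt_zero) (auto simp: \<theta>_def)
  have indep': "a = 0 \<and> b = 0" if "a *\<^sub>R v + b *\<^sub>R v' = 0" for a b
  proof -
    have "(a + b * cos \<theta>) *\<^sub>R v + (b * sin \<theta>) *\<^sub>R w = 0" using that by (simp add: v'_def algebra_simps)
    from indep[OF this] show ?thesis using \<open>sin \<theta> > 0\<close> by auto
  qed
  obtain L L' where L: "periodic_orbit S2 \<Omega> W as L (p, v)" "periodic_orbit S2 \<Omega> W as L' (p, v')"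
    using per[OF pv] per[OF v'] by blast
  note tr = S2.periodic_orbit_translates[OF _ table]
  have walls: "wall S2 a" if "a \<in> set as" for a
    using that tr(2)[OF L(1)] table by (auto simp: billiard_table_def)
  have g: "isometry S2 ?g" using S2.isometry_reflection_product[OF walls] .
  have pm: "(\<forall>x\<in>mspace S2. ?g x = x) \<or> (\<forall>x\<in>mspace S2. ?g x = - x)"
    using translates_two_circles_through_point[OF g p _ _ indep' tr(1)[OF L(1)] tr(1)[OF L(2)]]
      tangent[OF pv] tangent[OF v'] by blast
  have len: "cos l = c" if "\<And>x. x \<in> mspace S2 \<Longrightarrow> ?g x = c *\<^sub>R x" "c * c = 1" "x \<in> U"
    "periodic_orbit S2 \<Omega> W as l x" for x l c
  proof -
    obtain q u where x: "x = (q, u)" by (cases x)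
    then show ?thesis
      using S2_translates_scaled[of q u c ?g l] tangent[of q u] tr(1)[of as l q u] that by blast
  qed
  from pm show ?thesis
  proof
    assume "\<forall>x\<in>mspace S2. ?g x = x"
    then show ?thesis using len[of 1] by (auto simp: rcong_0_2pi_iff)
  next
    assume "\<forall>x\<in>mspace S2. ?g x = - x"
    then show ?thesis using len[of "- 1"] by (auto simp: rcong_pi_iff)
  qed
qed

subsection \<open>The hemisphere\<close>

text \<open>
  In a hemisphere every geodesic that starts on the equator reaches it again at the antipode
  after the length \<open>\<pi>\<close>, and after two reflections it is back with its initial velocity. So all
  orbits are periodic.
\<close>

definition equator :: "(real^3) set" where "equator = {x \<in> sphere 0 1. x $ 3 = 0}"
definition hemisphere :: "(real^3) set" where "hemisphere = {x \<in> sphere 0 1. x $ 3 > 0}"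

lemma equator_eq: "equator = range (S2.geo (axis 1 1) (axis 2 1))"
proof (intro equalityI subsetI)
  fix x assume "x \<in> equator"
  then have "x \<bullet> x = 1" "x $ 3 = 0" by (auto simp: equator_def norm_eq_1)
  then have "(x $ 1)\<^sup>2 + (x $ 2)\<^sup>2 = 1" by (simp add: inner_vec_def sum_3 power2_eq_square)
  then obtain t where "x $ 1 = cos t" "x $ 2 = sin t" by (rule sincos_total_2pi)
  then have "x = S2.geo (axis 1 1) (axis 2 1) t"
    using \<open>x $ 3 = 0\<close> by (simp add: S2_geo vec_eq_iff forall_3 axis_def)
  then show "x \<in> range (S2.geo (axis 1 1) (axis 2 1))" by blast
next
  fix x assume "x \<in> range (S2.geo (axis 1 1) (axis 2 1))"
  then obtain t where t: "x = S2.geo (axis 1 1) (axis 2 1) t" by blast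
  have "x \<in> mspace S2" unfolding t using S2.geo_mem axis_tangent[of 1 2] by simp
  then show "x \<in> equator" by (simp add: equator_def t S2_geo axis_def)
qed

lemma geodesic_equator: "geodesic S2 (S2.geo (axis 1 1) (axis 2 1))"
  by (rule axis_geodesic) simp

lemma frame_equator: "frame 1 (axis 1 1) (axis 2 1) (axis 3 1)"
  by (simp add: frame_def form_inner inner_axis_axis)

lemma equator_regular: "x \<in> equator \<Longrightarrow> regular_point S2 {equator} equator x"
proof -
  assume "x \<in> equator"
  then obtain s where s: "x = S2.geo (axis 1 1) (axis 2 1) s" unfolding equator_eq by blast
  have "geodesic S2 (\<lambda>t. S2.geo (axis 1 1) (axis 2 1) (s + 1 * t))"
    by (rule geodesic_reparam[OF geodesic_equator]) simp
  then show "regular_point S2 {equator} equator x"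
    unfolding regular_point_def
    by (intro conjI exI[of _ "\<lambda>t. S2.geo (axis 1 1) (axis 2 1) (s + 1 * t)"] exI[of _ 1])
      (auto simp: s equator_eq)
qed

lemma hemisphere_table: "billiard_table S2 hemisphere {equator}"
  unfolding billiard_table_def
proof (intro conjI)
  have "axis 3 1 \<in> hemisphere" using axis_tangent(1)[of 3 1] by (simp add: hemisphere_def)
  then show "hemisphere \<noteq> {}" by blast
  have half: "open {x :: real^3. x $ 3 > 0}" by (intro open_Collect_less continuous_intros)
  have hemi: "hemisphere = sphere 0 1 \<inter> {x. x $ 3 > 0}" by (auto simp: hemisphere_def)
  show op: "openin (top_of_set (mspace S2)) hemisphere"
    unfolding hemi mspace_S2 openin_open using half by blast
  have "connected {x :: real^3. x $ 3 > 0}"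
    using convex_connected[OF convex_halfspace_gt[of 0 "axis 3 1 :: real^3"]] by (simp add: inner_axis')
  then have "connected ((\<lambda>x. (1 / norm x) *\<^sub>R x) ` {x :: real^3. x $ 3 > 0})"
    by (rule connected_continuous_image[rotated]) (intro continuous_intros, auto)
  also have "(\<lambda>x. (1 / norm x) *\<^sub>R x) ` {x :: real^3. x $ 3 > 0} = hemisphere"
  proof (intro equalityI subsetI)
    fix x assume "x \<in> hemisphere"
    then show "x \<in> (\<lambda>x. (1 / norm x) *\<^sub>R x) ` {x :: real^3. x $ 3 > 0}"
      by (intro image_eqI[of _ _ x]) (auto simp: hemisphere_def)
  next
    fix y assume "y \<in> (\<lambda>x. (1 / norm x) *\<^sub>R x) ` {x :: real^3. x $ 3 > 0}"
    then obtain x where x: "y = (1 / norm x) *\<^sub>R x" "x $ 3 > 0" by blast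
    then have "norm x > 0" by auto
    with x show "y \<in> hemisphere" by (simp add: hemisphere_def)
  qed
  finally show "connected hemisphere" .
  show "finite {equator}" by simp
  show "\<forall>a\<in>{equator}. wall S2 a" using wall_range[OF geodesic_equator] by (simp add: equator_eq)
  have "top_of_set (mspace S2) frontier_of hemisphere = sphere 0 1 \<inter> closure hemisphere - hemisphere"
    unfolding frontier_of_def interior_of_openin[OF op] closure_of_subtopology euclidean_closure_of
    by (simp add: hemi Int_absorb1 flip: Int_assoc)
  also have "\<dots> = equator"
  proof (intro equalityI subsetI)
    fix x assume x: "x \<in> sphere 0 1 \<inter> closure hemisphere - hemisphere"
    have "closed {x :: real^3. x $ 3 \<ge> 0}" by (intro closed_Collect_le continuous_intros)
    then have "closure hemisphere \<subseteq> {x. x $ 3 \<ge> 0}" by (intro closure_minimal) (auto simp: hemisphere_def)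
    with x show "x \<in> equator" by (force simp: equator_def hemisphere_def)
  next
    fix x assume x: "x \<in> equator"
    let ?f = "S2.geo x (axis 3 1)"
    have T: "x \<in> mspace S2" "axis 3 1 \<in> S2.T x" using x by (auto simp: equator_def S2_T_iff inner_axis inner_axis_axis)
    have "?f t \<in> hemisphere" if "t \<in> {0<..<1}" for t
    proof -
      have "sin t > 0" using that pi_ge_two by (intro sin_gt_zero) auto
      then show ?thesis
        using S2.geo_mem[OF T, of t] x by (simp add: hemisphere_def equator_def S2_geo axis_def)
    qed
    then have "?f ` {0<..<1} \<subseteq> closure hemisphere"
      using closure_subset[of hemisphere] by blast
    then have "?f ` closure {0<..<1} \<subseteq> closure hemisphere"
      unfolding S2_geo[abs_def] by (intro image_closure_subset continuous_intros closed_closure)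
    moreover have "?f 0 \<in> ?f ` closure {0<..<1}" by (intro imageI) simp
    ultimately have "x \<in> closure hemisphere" by (auto simp: S2.geo_0)
    with x show "x \<in> sphere 0 1 \<inter> closure hemisphere - hemisphere" by (auto simp: equator_def hemisphere_def)
  qed
  finally show "top_of_set (mspace S2) frontier_of hemisphere = \<Union>{equator}" by simp
qed

lemma S2_mirror_axis_3: "S2.mirror (axis 3 1) x = x - (2 * x $ 3) *\<^sub>R axis 3 1"
  by (simp add: S2.mirror_def form_inner inner_axis)

lemma hemisphere_bounce:
  assumes p: "p \<in> equator" and v: "v \<in> S2.T p" "v $ 3 > 0"
  shows "bounce S2 hemisphere {equator} (p, v) equator pi (- p, - S2.mirror (axis 3 1) v)"
proof -
  let ?R = "S2.mirror (axis 3 1)"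
  have p': "p \<in> mspace S2" "p $ 3 = 0" using p by (auto simp: equator_def)
  have g: "geodesic S2 (S2.geo p v)" using S2.geodesic_geoI[OF p'(1) v(1)] .
  have "S2.geo p v t \<in> hemisphere" if "t \<in> {0<..<pi}" for t
    using S2.geo_mem[OF p'(1) v(1), of t] that p'(2) v(2)
    by (simp add: hemisphere_def S2_geo sin_gt_zero)
  then have sub: "S2.geo p v ` {0<..<pi} \<subseteq> hemisphere" by blast
  have "wall_reflection S2 equator x = ?R x" if "x \<in> mspace S2" for x
  proof (rule S2.wall_reflection_eq[OF _ _ _ _ that])
    show "wall S2 equator" unfolding equator_eq by (rule wall_range[OF geodesic_equator])
    show "isometry S2 ?R" "\<not> is_identity S2 ?R"
      using S2.mirror_isometry[OF _ frame_equator] axis_tangent(1)[of 1 2] by auto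
    show "?R x = x" if "x \<in> equator" for x
      using that by (simp add: S2_mirror_axis_3 equator_def)
  qed
  then have "wall_reflection S2 equator (S2.geo p v t) = ?R (S2.geo p v t)" for t
    using S2.geo_mem[OF p'(1) v(1)] by blast
  moreover have "?R (S2.geo p v t) = S2.geo p (?R v) t" for t
    using p'(2) by (simp add: S2_mirror_axis_3 S2_geo algebra_simps)
  ultimately have "(wall_reflection S2 equator \<circ> S2.geo p v) t = S2.geo p (?R v) t" for t by simp
  then have "wall_reflection S2 equator \<circ> S2.geo p v = S2.geo p (?R v)" ..
  moreover have "(S2.geo p (?R v) has_vector_derivative - ?R v) (at pi)"
    using S2.geo_deriv[of p "?R v" pi] by simp
  moreover have "- p \<in> equator" using p by (simp add: equator_def)
  ultimately show ?thesis
    unfolding bounce_def using g sub equator_regular[of "- p"]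
    by (intro exI[of _ "S2.geo p v"]) (simp add: S2.geo_0 S2.geo_deriv_0 S2_geo[of _ _ pi])
qed

lemma hemisphere_periodic_family:
  "periodic_family S2 hemisphere {equator} [equator, equator] (orbit_space S2 hemisphere {equator})"
proof -
  let ?R = "S2.mirror (axis 3 1)" and ?O = "orbit_space S2 hemisphere {equator}"
  have "(axis 1 1, axis 3 1) \<in> ?O"
  proof -
    have "axis 1 1 \<in> equator" using axis_tangent(1)[of 1 2] by (simp add: equator_def) (simp add: axis_def)
    then have "regular_point S2 {equator} equator (axis 1 1)" by (rule equator_regular)
    moreover have "geodesic S2 (S2.geo (axis 1 1) (axis 3 1))"
      by (rule axis_geodesic) simp
    moreover have "S2.geo (axis 1 1) (axis 3 1) ` {0<..<pi} \<subseteq> hemisphere"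
    proof safe
      fix t :: real assume "t \<in> {0<..<pi}"
      then show "S2.geo (axis 1 1) (axis 3 1) t \<in> hemisphere"
        using S2.geo_mem[OF axis_tangent[of 1 3], of t]
        by (simp add: hemisphere_def S2_geo axis_def sin_gt_zero)
    qed
    ultimately show ?thesis
      unfolding orbit_space_def using pi_gt_zero S2.geo_0 S2.geo_deriv_0 by blast
  qed
  moreover have "periodic_orbit S2 hemisphere {equator} [equator, equator] (pi + (pi + 0)) x" if orb: "x \<in> ?O" for x
  proof -
    obtain p v where x: "x = (p, v)" by (cases x)
    note pv = S2.orbit_space_tangent[OF orb[unfolded x]]
    obtain a \<sigma> \<epsilon> where reg: "regular_point S2 {equator} a p" and
      \<sigma>: "geodesic S2 \<sigma>" "\<sigma> 0 = p" "(\<sigma> has_vector_derivative v) (at 0)" "\<epsilon> > 0" "\<sigma> ` {0<..<\<epsilon>} \<subseteq> hemisphere"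
      using orb unfolding x orbit_space_def by blast
    have p: "p \<in> equator" using regular_point_mem[OF reg] by simp
    have "\<sigma> = S2.geo p v" using S2.geodesic_determined(1)[OF \<sigma>(1,3)] \<sigma>(2) by simp
    define t where "t = min (\<epsilon> / 2) 1"
    have t: "0 < t" "t < \<epsilon>" "sin t > 0"
      using \<sigma>(4) pi_ge_two by (auto simp: t_def intro!: sin_gt_zero)
    then have "S2.geo p v t \<in> hemisphere" using \<sigma>(5) \<open>\<sigma> = _\<close> by auto
    then have v3: "v $ 3 > 0"
      using p t(3) by (simp add: hemisphere_def equator_def S2_geo zero_less_mult_iff)
    have nn: "form 1 (axis 3 1) (axis 3 1 :: real^3) = 1" by (simp add: form_inner inner_axis_axis)
    have "- p \<in> equator" using p by (simp add: equator_def)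
    moreover have "- ?R v \<in> S2.T (- p)"
    proof -
      have "p \<bullet> ?R v = 0" using pv(2) p by (simp add: S2_mirror_axis_3 S2_T_iff inner_diff_right inner_axis equator_def)
      moreover have "?R v \<bullet> ?R v = 1"
        using S2.form_mirror(1)[OF nn, of v v] pv(2) by (simp add: form_inner S2_T_iff)
      ultimately show ?thesis by (simp add: S2_T_iff)
    qed
    moreover have "(- ?R v) $ 3 > 0" using v3 by (simp add: S2_mirror_axis_3)
    ultimately have "bounce S2 hemisphere {equator} (- p, - ?R v) equator pi (- (- p), - ?R (- ?R v))"
      by (rule hemisphere_bounce)
    moreover have "- ?R (- ?R v) = v"
    proof -
      have "?R (- y) = - ?R y" for y by (simp add: S2_mirror_axis_3)
      then show ?thesis using S2.mirror_mirror[OF nn, of v] by simp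
    qed
    ultimately have return: "bounce S2 hemisphere {equator} (- p, - ?R v) equator pi (p, v)" by simp
    have "trajectory S2 hemisphere {equator} (p, v) [equator, equator] (pi + (pi + 0)) (p, v)"
      using trajectory.Cons[OF hemisphere_bounce[OF p pv(2) v3] trajectory.Cons[OF return trajectory.Nil]] .
    then show ?thesis using orb x by (simp add: periodic_orbit_def)
  qed
  moreover have "openin (top_of_set ?O) ?O" by simp
  ultimately show ?thesis unfolding periodic_family_def by (intro conjI ballI exI) auto
qed

section \<open>Translated geodesics and reflective billiards\<close>

theorem theorem5p26:
  shows
  "(\<comment> \<open>(i) the hyperbolic plane\<close>
    (\<forall>g. hyperbolic H2 g \<longrightarrow>
        (\<exists>\<sigma>. geodesic H2 \<sigma> \<and> range \<sigma> = axis_of H2 g) \<and>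
        (\<forall>\<sigma>. geodesic H2 \<sigma> \<longrightarrow> ((\<exists>l. l \<noteq> 0 \<and> translates g \<sigma> l) \<longleftrightarrow> range \<sigma> = axis_of H2 g))) \<and>
    (\<forall>g. elliptic H2 g \<or> parabolic H2 g \<or> is_identity H2 g \<longrightarrow>
        (\<forall>\<sigma> l. geodesic H2 \<sigma> \<and> l > 0 \<longrightarrow> \<not> translates g \<sigma> l)) \<and>
    (\<forall>\<Omega> W k. billiard_table H2 \<Omega> W \<and> k \<ge> 1 \<longrightarrow> \<not> k_reflective H2 \<Omega> W k))
   \<and>
   (\<comment> \<open>(ii) the Euclidean plane\<close>
    (\<forall>v. v \<noteq> 0 \<longrightarrow>
        (\<forall>\<sigma>. geodesic E2 \<sigma> \<longrightarrow>
           ((\<exists>l. l \<noteq> 0 \<and> translates (\<lambda>x. x + v) \<sigma> l) \<longleftrightarrow> parallel_to \<sigma> v)) \<and>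
        (\<forall>w. w \<notin> span {v} \<longrightarrow>
           bij_betw (\<lambda>c. range (\<lambda>t. c *\<^sub>R w + t *\<^sub>R v)) (UNIV :: real set)
             {range \<sigma> | \<sigma>. geodesic E2 \<sigma> \<and> (\<exists>l. l \<noteq> 0 \<and> translates (\<lambda>x. x + v) \<sigma> l)})) \<and>
    (\<forall>\<tau> v. geodesic E2 \<tau> \<and> v \<noteq> 0 \<and> parallel_to \<tau> v \<longrightarrow>
        (\<forall>\<sigma>. geodesic E2 \<sigma> \<longrightarrow>
           ((\<exists>l. l \<noteq> 0 \<and> translates (\<lambda>x. wall_reflection E2 (range \<tau>) x + v) \<sigma> l)
              \<longleftrightarrow> range \<sigma> = range \<tau>))) \<and>
    (\<forall>c \<theta> \<sigma> l. geodesic E2 \<sigma> \<and> l > 0 \<longrightarrow> \<not> translates (rotation_about c \<theta>) \<sigma> l) \<and>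
    (\<forall>\<tau> \<sigma> l. geodesic E2 \<tau> \<and> geodesic E2 \<sigma> \<and> l > 0 \<longrightarrow>
        \<not> translates (wall_reflection E2 (range \<tau>)) \<sigma> l) \<and>
    (\<forall>\<Omega> W k. billiard_table E2 \<Omega> W \<and> k \<ge> 1 \<longrightarrow> \<not> k_reflective E2 \<Omega> W k))
   \<and>
   (\<comment> \<open>(iii) the sphere\<close>
    (\<exists>\<Omega> W as U. billiard_table S2 \<Omega> W \<and> as \<noteq> [] \<and> periodic_family S2 \<Omega> W as U) \<and>
    (\<forall>g. isometry S2 g \<longrightarrow>
        ((\<forall>\<sigma>. geodesic S2 \<sigma> \<longrightarrow> (\<exists>l>0. translates g \<sigma> l)) \<longleftrightarrow>
         (\<forall>x\<in>mspace S2. g x = x) \<or> (\<forall>x\<in>mspace S2. g x = - x))) \<and>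
    (\<forall>\<sigma> l. geodesic S2 \<sigma> \<longrightarrow> (translates (\<lambda>x. - x) \<sigma> l \<longleftrightarrow> [l = pi] (rmod (2 * pi)))) \<and>
    (\<forall>\<sigma> l. geodesic S2 \<sigma> \<longrightarrow> (translates (\<lambda>x. x) \<sigma> l \<longleftrightarrow> [l = 2 * pi] (rmod (2 * pi)))) \<and>
    (\<forall>g. isometry S2 g \<and> \<not> (\<forall>x\<in>mspace S2. g x = x) \<and> \<not> (\<forall>x\<in>mspace S2. g x = - x) \<longrightarrow>
        (\<forall>\<sigma> \<tau> l m. geodesic S2 \<sigma> \<and> geodesic S2 \<tau> \<and> translates g \<sigma> l \<and> translates g \<tau> m
            \<longrightarrow> range \<sigma> = range \<tau>)) \<and>
    (\<forall>\<Omega> W as U. billiard_table S2 \<Omega> W \<and> as \<noteq> [] \<and> periodic_family S2 \<Omega> W as U \<longrightarrow>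
        (\<forall>x\<in>mspace S2. reflection_product S2 as x = - x) \<and>
          (\<forall>x\<in>U. \<forall>L. periodic_orbit S2 \<Omega> W as L x \<longrightarrow> [L = pi] (rmod (2 * pi)))
        \<or>
        (\<forall>x\<in>mspace S2. reflection_product S2 as x = x) \<and>
          (\<forall>x\<in>U. \<forall>L. periodic_orbit S2 \<Omega> W as L x \<longrightarrow> [L = 0] (rmod (2 * pi)))))"
proof (intro conjI allI impI)
  show "\<exists>\<sigma>. geodesic H2 \<sigma> \<and> range \<sigma> = axis_of H2 g" if "hyperbolic H2 g" for g
    using hyperbolic_translates_iff_axis(1)[OF that] .
  show "(\<exists>l. l \<noteq> 0 \<and> translates g \<sigma> l) \<longleftrightarrow> range \<sigma> = axis_of H2 g"
    if "hyperbolic H2 g" "geodesic H2 \<sigma>" for g \<sigma>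
    using hyperbolic_translates_iff_axis(2)[OF that] .
  show "\<not> translates g \<sigma> l"
    if "elliptic H2 g \<or> parabolic H2 g \<or> is_identity H2 g" "geodesic H2 \<sigma> \<and> l > 0" for g \<sigma> l
    using non_hyperbolic_translates_none that by blast
  show "\<not> k_reflective H2 \<Omega> W k" if "billiard_table H2 \<Omega> W \<and> k \<ge> 1" for \<Omega> W k
    using H2_not_k_reflective that by blast
  show "(\<exists>l. l \<noteq> 0 \<and> translates (\<lambda>x. x + v) \<sigma> l) \<longleftrightarrow> parallel_to \<sigma> v"
    if "v \<noteq> 0" "geodesic E2 \<sigma>" for v \<sigma>
    using translation_translates_iff[OF that(2,1)] .
  show "bij_betw (\<lambda>c. range (\<lambda>t. c *\<^sub>R w + t *\<^sub>R v)) (UNIV :: real set)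
      {range \<sigma> | \<sigma>. geodesic E2 \<sigma> \<and> (\<exists>l. l \<noteq> 0 \<and> translates (\<lambda>x. x + v) \<sigma> l)}"
    if "v \<noteq> 0" "w \<notin> span {v}" for v w
    using translated_lines_one_parameter[OF that] .
  show "(\<exists>l. l \<noteq> 0 \<and> translates (\<lambda>x. wall_reflection E2 (range \<tau>) x + v) \<sigma> l) \<longleftrightarrow> range \<sigma> = range \<tau>"
    if "geodesic E2 \<tau> \<and> v \<noteq> 0 \<and> parallel_to \<tau> v" "geodesic E2 \<sigma>" for \<tau> v \<sigma>
    using glide_reflection_translates_iff that by blast
  show "\<not> translates (rotation_about c \<theta>) \<sigma> l" if "geodesic E2 \<sigma> \<and> l > 0" for c \<theta> \<sigma> l
    using rotation_translates_none that by blast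
  show "\<not> translates (wall_reflection E2 (range \<tau>)) \<sigma> l"
    if "geodesic E2 \<tau> \<and> geodesic E2 \<sigma> \<and> l > 0" for \<tau> \<sigma> l
    using reflection_E2_translates_none that by blast
  show "\<not> k_reflective E2 \<Omega> W k" if "billiard_table E2 \<Omega> W \<and> k \<ge> 1" for \<Omega> W k
    using E2_not_k_reflective that by blast
  show "\<exists>\<Omega> W as U. billiard_table S2 \<Omega> W \<and> as \<noteq> [] \<and> periodic_family S2 \<Omega> W as U"
    using hemisphere_table hemisphere_periodic_family by blast
  show "(\<forall>\<sigma>. geodesic S2 \<sigma> \<longrightarrow> (\<exists>l>0. translates g \<sigma> l)) \<longleftrightarrow>
      (\<forall>x\<in>mspace S2. g x = x) \<or> (\<forall>x\<in>mspace S2. g x = - x)" if "isometry S2 g" for g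
    using translates_all_iff[OF that] .
  show "translates (\<lambda>x. - x) \<sigma> l \<longleftrightarrow> [l = pi] (rmod (2 * pi))" if "geodesic S2 \<sigma>" for \<sigma> l
    using antipodal_translates_iff[OF that] .
  show "translates (\<lambda>x. x) \<sigma> l \<longleftrightarrow> [l = 2 * pi] (rmod (2 * pi))" if "geodesic S2 \<sigma>" for \<sigma> l
    using identity_translates_iff[OF that] .
  show "range \<sigma> = range \<tau>"
    if "isometry S2 g \<and> \<not> (\<forall>x\<in>mspace S2. g x = x) \<and> \<not> (\<forall>x\<in>mspace S2. g x = - x)"
      "geodesic S2 \<sigma> \<and> geodesic S2 \<tau> \<and> translates g \<sigma> l \<and> translates g \<tau> m" for g \<sigma> \<tau> l m
    using two_translated_circles that by blast
  show "(\<forall>x\<in>mspace S2. reflection_product S2 as x = - x) \<and>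
          (\<forall>x\<in>U. \<forall>L. periodic_orbit S2 \<Omega> W as L x \<longrightarrow> [L = pi] (rmod (2 * pi)))
        \<or>
        (\<forall>x\<in>mspace S2. reflection_product S2 as x = x) \<and>
          (\<forall>x\<in>U. \<forall>L. periodic_orbit S2 \<Omega> W as L x \<longrightarrow> [L = 0] (rmod (2 * pi)))"
    if "billiard_table S2 \<Omega> W \<and> as \<noteq> [] \<and> periodic_family S2 \<Omega> W as U" for \<Omega> W as U
    using S2_periodic_family that by blast
qed

end
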